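(* Let $m\le n$ be positive integers and let $\omega^n_m$ be the random $m$-out-of-$n$ subnetwork. For every integer $j$ with $1\le j\le m-1$, the expected number of swaps in location $j$ in $\omega^n_m$ does not depend on $n$, and equals $$\mathbb{E}\,\#\big\{t: s_t(\omega^n_m)=j\big\}=\frac{(j-\tfrac12)_{j-1}\,(m-j-\tfrac12)_{m-j-1}}{(j-1)!\,(m-j-1)!},$$ where $(a)_r:=a(a-1)\cdots(a-r+1)$ denotes the falling factorial.
   Context: Let $S_n$ be the symmetric group on $\{1,\ldots,n\}$, with composition $(\sigma\tau)(i):=\sigma(\tau(i))$, and write $\sigma=(\sigma(1),\ldots,\sigma(n))$. For $1\le s\le n-1$ let $\tau_s=(s\ \ s+1)\in S_n$ be the adjacent transposition (swap at location $s$), and let $\rho=(n,\ldots,2,1)$ be the reverse permutation. An $n$-particle sorting network is a sequence $\omega=(s_1,\ldots,s_N)$ with $N=\binom n2$ and $s_t\in\{1,\ldots,n-1\}$ such that $\tau_{s_1}\tau_{s_2}\cdots\tau_{s_N}=\rho$. We write $s_t=s_t(\omega)$ for the $t$th swap location, and $\sigma_t=\tau_{s_1}\cdots\tau_{s_t}$ for the configuration at time $t$, $0\le t\le N$ (so $\sigma_0$ is the identity). Given an $n$-particle sorting network $\omega$ and a subset $A=\{a_1<\cdots<a_m\}\subseteq\{1,\ldots,n\}$, the induced subnetwork $\omega|_A$ is the $m$-particle sorting network defined as follows: delete from each configuration $(\sigma_t(1),\ldots,\sigma_t(n))$ all elements not in $A$ and replace $a_i$ with $i$, to give a permutation in $S_m$;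 then remove all duplicates from the resulting sequence of permutations. The result is the sequence of configurations of $\omega|_A$. The uniform sorting network $\omega_n$ is a uniformly random element of the (finite) set of all $n$-particle sorting networks. For $m\le n$, the random $m$-out-of-$n$ subnetwork is $\omega^n_m:=(\omega_n)|_{\mathcal A}$, where $\mathcal A$ is a uniformly random $m$-element subset of $\{1,\ldots,n\}$ independent of $\omega_n$. In the falling factorial, $(a)_0=1$ (empty product), and $a$ may be any real number. *)

theory Defs
  imports "HOL-Probability.Probability" "HOL-Combinatorics.Combinatorics"
begin

text \<open>
  Permutations of \<open>{1..n}\<close> are functions on \<^typ>\<open>nat\<close> that are the identity outside
  \<open>{1..n}\<close>. \<open>Transposition.transpose\<close> is qualified because \<open>transpose\<close> alone also denotes
  the matrix transpose.
\<close>

definition adj_swap :: "nat \<Rightarrow> nat \<Rightarrow> nat" where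
  "adj_swap s = Transposition.transpose s (Suc s)"

definition reverse_perm :: "nat \<Rightarrow> nat \<Rightarrow> nat" where
  "reverse_perm n = (\<lambda>i. if i \<in> {1..n} then n + 1 - i else i)"

definition config :: "nat list \<Rightarrow> nat \<Rightarrow> nat \<Rightarrow> nat" where
  "config \<omega> t = foldr (\<lambda>s \<sigma>. adj_swap s \<circ> \<sigma>) (take t \<omega>) id"

definition sorting_networks :: "nat \<Rightarrow> nat list set" where
  "sorting_networks n =
     {\<omega>. length \<omega> = n choose 2 \<and> set \<omega> \<subseteq> {1..n - 1} \<and> config \<omega> (n choose 2) = reverse_perm n}"

text \<open>Swap locations are indexed by times \<open>t = 1, \<dots>, N\<close>, list positions start at \<open>0\<close>.\<close>

definition swap_loc :: "nat list \<Rightarrow> nat \<Rightarrow> nat" where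
  "swap_loc \<omega> t = \<omega> ! (t - 1)"

definition one_line :: "nat \<Rightarrow> (nat \<Rightarrow> nat) \<Rightarrow> nat list" where
  "one_line n \<sigma> = map \<sigma> [1..<Suc n]"

definition configs :: "nat \<Rightarrow> nat list \<Rightarrow> nat list list" where
  "configs n \<omega> = map (\<lambda>t. one_line n (config \<omega> t)) [0..<Suc (length \<omega>)]"

text \<open>For \<open>a \<in> A\<close> the cardinality below is the index \<open>i\<close> with \<open>a = a\<^sub>i\<close> in \<open>A = {a\<^sub>1 < \<dots> < a\<^sub>m}\<close>.\<close>

definition restrict_word :: "nat set \<Rightarrow> nat list \<Rightarrow> nat list" where
  "restrict_word A w = map (\<lambda>a. card {b \<in> A. b \<le> a}) (filter (\<lambda>a. a \<in> A) w)"

text \<open>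
  A network is determined by its sequence of configurations. Equal restricted words
  always occur at consecutive times (two particles change their relative order exactly once),
  so it does not matter that \<^const>\<open>remdups\<close> keeps the last copy of each entry.
\<close>

definition subnetwork :: "nat \<Rightarrow> nat list \<Rightarrow> nat set \<Rightarrow> nat list" where
  "subnetwork n \<omega> A =
     (THE \<eta>. \<eta> \<in> sorting_networks (card A) \<and>
             configs (card A) \<eta> = remdups (map (restrict_word A) (configs n \<omega>)))"

definition uniform_network :: "nat \<Rightarrow> nat list pmf" where
  "uniform_network n = pmf_of_set (sorting_networks n)"

definition uniform_subset :: "nat \<Rightarrow> nat \<Rightarrow> nat set pmf" where
  "uniform_subset n m = pmf_of_set {A. A \<subseteq> {1..n} \<and> card A = m}"

definition random_subnetwork :: "nat \<Rightarrow> nat \<Rightarrow> nat list pmf" where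
  "random_subnetwork n m =
     map_pmf (\<lambda>(\<omega>, A). subnetwork n \<omega> A) (pair_pmf (uniform_network n) (uniform_subset n m))"

definition falling_fact :: "real \<Rightarrow> nat \<Rightarrow> real" where
  "falling_fact a r = (\<Prod>i<r. a - real i)"

end

theory Submission
  imports Defs
begin

text \<open>
  A swap at location \<open>k\<close> of the large network survives in the subnetwork as a swap at location \<open>j\<close>
  iff the random subset contains both swapped particles and exactly \<open>j - 1\<close> of the particles to
  their left. Hence only the law of the swap locations of the uniform \<open>n\<close>-particle network matters,
  and a Chu-Vandermonde summation removes the dependence on \<open>n\<close>. Since
  \<open>(s\<^sub>1, \<dots>, s\<^sub>N) \<mapsto> (s\<^sub>2, \<dots>, s\<^sub>N, n - s\<^sub>1)\<close> permutes the networks, all swap locations have the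
  law of the last one, so that the ratio of the numbers of reduced words of \<open>\<rho> \<tau>\<^sub>k\<close> and of \<open>\<rho>\<close> is needed.

  This ratio is obtained without the Edelman-Greene correspondence. For a finitely supported
  permutation \<open>v\<close> of the integers and a position \<open>r\<close>, the numbers of reduced words of the Bruhat covers
  \<open>v t\<^sub>r\<^sub>s\<close>, \<open>r < s\<close>, and of the covers \<open>v t\<^sub>i\<^sub>r\<close>, \<open>i < r\<close>, have the same sum (induction on the length).
  If both sides have a single term, as happens for the last descent of a 2143-avoiding
  permutation, this exchanges two entries of the Lehmer code and preserves the number of reduced
  words. Iterating, which amounts to an insertion sort of the code, turns \<open>\<rho>\<close> and \<open>\<rho> \<tau>\<^sub>k\<close> into Grassmannian
  permutations. There the number of reduced words is given by Frobenius' formula, whose recursion is a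
  Lagrange interpolation identity.
\<close>

subsection \<open>Covers and the transition identity\<close>

text \<open>The integers replace \<open>{1..n}\<close> because every exchange needs a smaller entry
  further left; the fixed points to the left of the support always supply one, at the price that the
  code drifts leftwards. Covers transpose positions, hence act on the right, while letters of
  reduced words are removed on the left. The two operations therefore almost commute, which is what
  makes an induction on the length possible. Avoidance of 2143 enters since a second lower cover
  would exhibit exactly this pattern. Reduced words of a Grassmannian permutation correspond to
  standard tableaux whose row lengths are the code entries: the staircase for the reverse
  permutation, the staircase without one corner for its neighbour. Parts plus indices of the
  staircase are the odd numbers 1, 3, 5, ..., and lowering one of them by 1 changes the Vandermonde
  product by half-integer ratios; this is the origin of the coefficients of \<open>(1 - x)\<close>
  to the power -3/2. Choosing the other members of the subset turns two such series into powers
  whose exponents add up to the integer \<open>- (m + 1)\<close>, so the convolution is a multiple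
  of \<open>n choose m\<close>, the number of subsets, and cancels.\<close>

abbreviation tr :: "'a \<Rightarrow> 'a \<Rightarrow> 'a \<Rightarrow> 'a" where
  "tr \<equiv> Transposition.transpose"

abbreviation adj :: "int \<Rightarrow> int \<Rightarrow> int" where
  "adj k \<equiv> tr k (k + 1)"

text \<open>The \<open>k\<close> for which left multiplication by \<open>adj k\<close> shortens
  \<open>v\<close>, hence the possible first letters of reduced words.\<close>

definition left_desc :: "(int \<Rightarrow> int) \<Rightarrow> int set" where
  "left_desc v = {k. inv v (k + 1) < inv v k}"

text \<open>The number of reduced words if \<open>n\<close> is the length of \<open>v\<close>, and \<open>0\<close> otherwise.\<close>

primrec nred :: "nat \<Rightarrow> (int \<Rightarrow> int) \<Rightarrow> real" where
  "nred 0 v = (if v = id then 1 else 0)"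
| "nred (Suc n) v = (\<Sum>k\<in>left_desc v. nred n (adj k \<circ> v))"

definition up_covers :: "(int \<Rightarrow> int) \<Rightarrow> int \<Rightarrow> int set" where
  "up_covers v r = {s. r < s \<and> v r < v s \<and> (\<forall>j. r < j \<and> j < s \<longrightarrow> \<not> (v r < v j \<and> v j < v s))}"

definition down_covers :: "(int \<Rightarrow> int) \<Rightarrow> int \<Rightarrow> int set" where
  "down_covers v r = {i. i < r \<and> v i < v r \<and> (\<forall>j. i < j \<and> j < r \<longrightarrow> \<not> (v i < v j \<and> v j < v r))}"

lemma adj_less_iff:
  assumes "x \<noteq> y" "\<not> (x = k \<and> y = k + 1)" "\<not> (x = k + 1 \<and> y = k)"
  shows "adj k x < adj k y \<longleftrightarrow> x < y"
  using assms by (auto simp: Transposition.transpose_def)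

lemma permutation_bound:
  assumes "permutation (v :: int \<Rightarrow> int)"
  obtains B :: int where "C \<le> B" "\<And>x. B \<le> \<bar>x\<bar> \<Longrightarrow> v x = x"
proof -
  have fin: "finite {x. v x \<noteq> x}" using assms by (simp add: permutation)
  define B where "B = max C (Max (insert 0 (abs ` {x. v x \<noteq> x})) + 1)"
  have "v x = x" if "B \<le> \<bar>x\<bar>" for x
  proof (rule ccontr)
    assume "v x \<noteq> x"
    then have "\<bar>x\<bar> \<le> Max (insert 0 (abs ` {x. v x \<noteq> x}))" using fin by (intro Max_ge) auto
    then show False using that unfolding B_def by linarith
  qed
  moreover have "C \<le> B" unfolding B_def by simp
  ultimately show ?thesis using that by blast
qed

lemma finite_left_desc:
  assumes "permutation v"
  shows "finite (left_desc v)"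
proof -
  have "permutation (inv v)" using assms by (rule permutation_inverse)
  then obtain B where B: "0 \<le> B" "\<And>x. B \<le> \<bar>x\<bar> \<Longrightarrow> inv v x = x"
    using permutation_bound by blast
  have "left_desc v \<subseteq> {- B - 1..B}"
  proof (rule ccontr)
    assume "\<not> ?thesis"
    then obtain k where k: "k \<in> left_desc v" "k < - B - 1 \<or> B < k"
      by (metis atLeastAtMost_iff linorder_not_le subsetI)
    then have "B \<le> \<bar>k\<bar>" "B \<le> \<bar>k + 1\<bar>" using B(1) by linarith+
    then have "inv v k = k" "inv v (k + 1) = k + 1" using B(2) by blast+
    then show False using k(1) by (simp add: left_desc_def)
  qed
  then show ?thesis by (rule finite_subset) simp
qed

text \<open>A cover cannot reach far beyond the support: for \<open>s > B\<close> the fixed point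
  \<open>B\<close> would lie strictly between \<open>r\<close> and \<open>s\<close> in position and
  in value.\<close>

lemma finite_up_covers:
  assumes "permutation v"
  shows "finite (up_covers v r)"
proof -
  obtain B where B: "\<bar>r\<bar> + \<bar>v r\<bar> + 1 \<le> B" "\<And>x. B \<le> \<bar>x\<bar> \<Longrightarrow> v x = x"
using permutation_bound[OF assms] by blast
  have "up_covers v r \<subseteq> {r..B}"
  proof
    fix s assume s: "s \<in> up_covers v r"
    show "s \<in> {r..B}"
    proof (rule ccontr)
      assume "s \<notin> {r..B}"
      then have "B < s" using s by (auto simp: up_covers_def)
      moreover have "v s = s" "v B = B" using \<open>B < s\<close> B(1) by (auto intro!: B(2))
      moreover have "r < B" "v r < B" using B(1) by linarith+
      ultimately show False using s by (auto simp: up_covers_def)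
    qed
  qed
  then show ?thesis by (rule finite_subset) simp
qed

lemma finite_down_covers:
  assumes "permutation v"
  shows "finite (down_covers v r)"
proof -
  obtain B where B: "\<bar>r\<bar> + \<bar>v r\<bar> + 1 \<le> B" "\<And>x. B \<le> \<bar>x\<bar> \<Longrightarrow> v x = x"
using permutation_bound[OF assms] by blast
  have "down_covers v r \<subseteq> {- B..r}"
  proof
    fix s assume s: "s \<in> down_covers v r"
    show "s \<in> {- B..r}"
    proof (rule ccontr)
      assume "s \<notin> {- B..r}"
      then have "s < - B" using s by (auto simp: down_covers_def)
      moreover have "v s = s" "v (- B) = - B" using \<open>s < - B\<close> B(1) by (auto intro!: B(2))
      moreover have "- B < r" "- B < v r" using B(1) by linarith+
      ultimately show False using s by (auto simp: down_covers_def)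
    qed
  qed
  then show ?thesis by (rule finite_subset) simp
qed

text \<open>
  Left multiplication by \<open>adj k\<close> and the cover \<open>t\<^sub>r\<^sub>s\<close> can be exchanged unless they produce the same
  permutation; the exceptional terms are what is left over in the induction for the transition identity.
\<close>

lemma up_covers_adj_iff:
  assumes v: "bij v" and p: "v p = k" and q: "v q = k + 1" and rs: "r < s"
    and ne: "\<not> (r = p \<and> s = q)" "\<not> (r = q \<and> s = p)"
  shows "s \<in> up_covers v r \<and> tr r s q < tr r s p \<longleftrightarrow> q < p \<and> s \<in> up_covers (adj k \<circ> v) r"
proof -
  have inj: "v x = v y \<longleftrightarrow> x = y" for x y using v by (simp add: bij_def inj_eq)
  have pq: "p \<noteq> q" using p q by auto
  have eq: "x = p \<longleftrightarrow> v x = k" "x = q \<longleftrightarrow> v x = k + 1" for x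
    using p q inj by metis+
  have cmp: "adj k (v x) < adj k (v y) \<longleftrightarrow> (if x = p \<and> y = q then False else if x = q \<and> y = p then True else v x < v y)"
    for x y
    unfolding eq by (auto simp: Transposition.transpose_def)
  consider "r \<noteq> p" "r \<noteq> q" "s \<noteq> p" "s \<noteq> q" | "r = p" "s \<noteq> q" "s \<noteq> p" | "r = q" "s \<noteq> p" "s \<noteq> q"
    | "s = p" "r \<noteq> q" "r \<noteq> p" | "s = q" "r \<noteq> p" "r \<noteq> q"
    using ne rs pq by blast
  then show ?thesis
  proof cases
    case 1
    then show ?thesis unfolding up_covers_def o_def mem_Collect_eq cmp by auto
  next
    case 2
    have t: "tr r s p = s" "tr r s q = q" using 2 pq by (auto simp: Transposition.transpose_def)
    show ?thesis unfolding up_covers_def o_def mem_Collect_eq cmp t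
      using 2 pq eq p q rs by (smt (verit))
  next
    case 3
    have t: "tr r s q = s" "tr r s p = p" using 3 pq by (auto simp: Transposition.transpose_def)
    show ?thesis unfolding up_covers_def o_def mem_Collect_eq cmp t
      using 3 pq eq p q rs by (smt (verit))
  next
    case 4
    have t: "tr r s p = r" "tr r s q = q" using 4 pq by (auto simp: Transposition.transpose_def)
    show ?thesis unfolding up_covers_def o_def mem_Collect_eq cmp t
      using 4 pq eq p q rs by (smt (verit))
  next
    case 5
    have t: "tr r s q = r" "tr r s p = p" using 5 pq by (auto simp: Transposition.transpose_def)
    show ?thesis unfolding up_covers_def o_def mem_Collect_eq cmp t
      using 5 pq eq p q rs by (smt (verit))
  qed
qed


text \<open>Lets \<open>up_covers_adj_iff\<close> serve for lower covers too, with the roles of the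
  two positions exchanged.\<close>

lemma down_covers_iff_up_covers: "i \<in> down_covers v r \<longleftrightarrow> r \<in> up_covers v i"
  by (auto simp: down_covers_def up_covers_def)

lemma left_desc_comp_transpose:
  assumes "bij v"
  shows "k \<in> left_desc (v \<circ> tr a b) \<longleftrightarrow> tr a b (inv v (k + 1)) < tr a b (inv v k)"
proof -
  have "inv (v \<circ> tr a b) = tr a b \<circ> inv v"
    using assms by (simp add: o_inv_distrib)
  then show ?thesis by (simp add: left_desc_def)
qed

lemma adj_comp_comp_transpose:
  assumes "bij v" "v a = k \<and> v b = k + 1 \<or> v b = k \<and> v a = k + 1"
  shows "adj k \<circ> v \<circ> tr a b = v"
proof
  fix x
  have inj: "v x = v y \<longleftrightarrow> x = y" for y using assms by (simp add: bij_def inj_eq)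
  show "(adj k \<circ> v \<circ> tr a b) x = v x"
    using assms(2) inj[of a] inj[of b] by (auto simp: Transposition.transpose_def)
qed

text \<open>Unfolding \<open>nred\<close> produces pairs of a cover \<open>s\<close> and a descent
  \<open>k\<close>. Choosing them in either order gives the same pairs except where the two swaps
  cancel; the correction terms come from the values \<open>c + 1\<close> and \<open>c - 1\<close>
  next to the value at \<open>r\<close>.\<close>

lemma sum_up_covers_nred_Suc:
  assumes v: "permutation v" and c: "c = v r"
  shows "(\<Sum>s\<in>up_covers v r. nred (Suc n) (v \<circ> tr r s)) =
    (\<Sum>k\<in>left_desc v. \<Sum>s\<in>up_covers (adj k \<circ> v) r. nred n (adj k \<circ> v \<circ> tr r s))
    + of_bool (r < inv v (c + 1)) * nred n v - of_bool (r < inv v (c - 1)) * nred n v"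
proof -
  have bij: "bij v" using v by (simp add: permutation)
  have vi: "v (inv v x) = x" for x using bij by (simp add: bij_def surj_f_inv_f)
  have iv: "inv v y = x \<longleftrightarrow> v x = y" for x y using bij by (metis bij_inv_eq_iff)
  have ivv: "inv v (v x) = x" for x using iv by blast
  define L where "L = (SIGMA s : up_covers v r. left_desc (v \<circ> tr r s))"
  define R where "R = (\<lambda>(k, s). (s, k)) ` (SIGMA k : left_desc v. up_covers (adj k \<circ> v) r)"
  \<comment> \<open>On \<open>X\<close> the exchange of the positions \<open>r\<close>,
    \<open>s\<close> and the exchange of the values \<open>k\<close>, \<open>k + 1\<close> undo each
    other, so each summand is \<open>nred n v\<close>.\<close>
  define X where "X = {(s, k). v r = k \<and> v s = k + 1 \<or> v r = k + 1 \<and> v s = k}"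
  define f where "f = (\<lambda>(s, k). nred n (adj k \<circ> v \<circ> tr r s))"
  have perm: "permutation (adj k \<circ> v)" "permutation (v \<circ> tr r s)" for k s
    using v by (auto intro: permutation_compose permutation_swap_id)
  have finL: "finite L" unfolding L_def
    using finite_up_covers[OF v] finite_left_desc[OF perm(2)] by blast
  have finR: "finite R" unfolding R_def
    using finite_left_desc[OF v] finite_up_covers[OF perm(1)] by blast
  have L: "(s, k) \<in> L \<longleftrightarrow> s \<in> up_covers v r \<and> tr r s (inv v (k + 1)) < tr r s (inv v k)" for s k
    by (simp add: L_def left_desc_comp_transpose[OF bij])
  have R: "(s, k) \<in> R \<longleftrightarrow> inv v (k + 1) < inv v k \<and> s \<in> up_covers (adj k \<circ> v) r" for s k
    by (auto simp: R_def left_desc_def image_iff)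
  have sumL: "(\<Sum>s\<in>up_covers v r. nred (Suc n) (v \<circ> tr r s)) = sum f L"
    unfolding L_def f_def by (subst sum.Sigma[symmetric])
      (auto simp: o_assoc finite_up_covers[OF v] finite_left_desc[OF perm(2)])
  have sumR: "(\<Sum>k\<in>left_desc v. \<Sum>s\<in>up_covers (adj k \<circ> v) r. nred n (adj k \<circ> v \<circ> tr r s)) = sum f R"
    unfolding R_def f_def by (subst sum.reindex, force simp: inj_on_def)
      (simp add: sum.Sigma finite_left_desc[OF v] finite_up_covers[OF perm(1)] case_prod_unfold)
  have f: "f x = nred n v" if "x \<in> X" for x
    using that unfolding X_def f_def by (auto simp: adj_comp_comp_transpose[OF bij])
  have "(s, k) \<in> L - X \<longleftrightarrow> (s, k) \<in> R - X" for s k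
  proof (cases "r < s \<and> (s, k) \<notin> X")
    case True
    then have "\<not> (r = inv v k \<and> s = inv v (k + 1))" "\<not> (r = inv v (k + 1) \<and> s = inv v k)"
      by (auto simp: X_def vi)
    from up_covers_adj_iff[OF bij vi vi _ this] True show ?thesis by (simp add: L R)
  next
    case False
    then show ?thesis by (auto simp: L R up_covers_def)
  qed
  then have eq: "L - X = R - X" by auto
  \<comment> \<open>Consecutive values always form a cover, as nothing lies strictly between them;
    after the exchange \<open>c\<close> is a descent because \<open>c + 1\<close> has moved to
    \<open>r\<close>.\<close>
  have LX: "L \<inter> X = (if r < inv v (c + 1) then {(inv v (c + 1), c)} else {})"
    by (auto simp: L X_def c vi up_covers_def ivv Transposition.transpose_def split: if_splits dest: sym[of "v _" "v r + 1"])
  have RX: "R \<inter> X = (if r < inv v (c - 1) then {(inv v (c - 1), c - 1)} else {})"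
    by (auto simp: R X_def c vi ivv up_covers_def Transposition.transpose_def split: if_splits)
  have "sum f (L \<inter> X) = of_bool (r < inv v (c + 1)) * nred n v"
    using f[of "(inv v (c + 1), c)"] unfolding LX by (auto simp: X_def c vi)
  moreover have "sum f (R \<inter> X) = of_bool (r < inv v (c - 1)) * nred n v"
    using f[of "(inv v (c - 1), c - 1)"] unfolding RX by (auto simp: X_def c vi)
  moreover have "sum f L = sum f (L \<inter> X) + sum f (L - X)" "sum f R = sum f (R \<inter> X) + sum f (R - X)"
    using sum.Int_Diff[OF finL] sum.Int_Diff[OF finR] by auto
  ultimately show ?thesis unfolding sumL sumR eq by simp
qed

lemma sum_down_covers_nred_Suc:
  assumes v: "permutation v" and c: "c = v r"
  shows "(\<Sum>s\<in>down_covers v r. nred (Suc n) (v \<circ> tr r s)) =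
    (\<Sum>k\<in>left_desc v. \<Sum>s\<in>down_covers (adj k \<circ> v) r. nred n (adj k \<circ> v \<circ> tr r s))
    + of_bool (inv v (c - 1) < r) * nred n v - of_bool (inv v (c + 1) < r) * nred n v"
proof -
  have bij: "bij v" using v by (simp add: permutation)
  have vi: "v (inv v x) = x" for x using bij by (simp add: bij_def surj_f_inv_f)
  have iv: "inv v y = x \<longleftrightarrow> v x = y" for x y using bij by (metis bij_inv_eq_iff)
  have ivv: "inv v (v x) = x" for x using iv by blast
  define L where "L = (SIGMA s : down_covers v r. left_desc (v \<circ> tr r s))"
  define R where "R = (\<lambda>(k, s). (s, k)) ` (SIGMA k : left_desc v. down_covers (adj k \<circ> v) r)"
  define X where "X = {(s, k). v r = k \<and> v s = k + 1 \<or> v r = k + 1 \<and> v s = k}"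
  define f where "f = (\<lambda>(s, k). nred n (adj k \<circ> v \<circ> tr r s))"
  have perm: "permutation (adj k \<circ> v)" "permutation (v \<circ> tr r s)" for k s
    using v by (auto intro: permutation_compose permutation_swap_id)
  have finL: "finite L" unfolding L_def
    using finite_down_covers[OF v] finite_left_desc[OF perm(2)] by blast
  have finR: "finite R" unfolding R_def
    using finite_left_desc[OF v] finite_down_covers[OF perm(1)] by blast
  have L: "(s, k) \<in> L \<longleftrightarrow> s \<in> down_covers v r \<and> tr r s (inv v (k + 1)) < tr r s (inv v k)" for s k
    by (simp add: L_def left_desc_comp_transpose[OF bij])
  have R: "(s, k) \<in> R \<longleftrightarrow> inv v (k + 1) < inv v k \<and> s \<in> down_covers (adj k \<circ> v) r" for s k
    by (auto simp: R_def left_desc_def image_iff)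
  have sumL: "(\<Sum>s\<in>down_covers v r. nred (Suc n) (v \<circ> tr r s)) = sum f L"
    unfolding L_def f_def by (subst sum.Sigma[symmetric])
      (auto simp: o_assoc finite_down_covers[OF v] finite_left_desc[OF perm(2)])
  have sumR: "(\<Sum>k\<in>left_desc v. \<Sum>s\<in>down_covers (adj k \<circ> v) r. nred n (adj k \<circ> v \<circ> tr r s)) = sum f R"
    unfolding R_def f_def by (subst sum.reindex, force simp: inj_on_def)
      (simp add: sum.Sigma finite_left_desc[OF v] finite_down_covers[OF perm(1)] case_prod_unfold)
  have f: "f x = nred n v" if "x \<in> X" for x
    using that unfolding X_def f_def by (auto simp: adj_comp_comp_transpose[OF bij])
  have "(s, k) \<in> L - X \<longleftrightarrow> (s, k) \<in> R - X" for s k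
  proof (cases "s < r \<and> (s, k) \<notin> X")
    case True
    then have "\<not> (r = inv v k \<and> s = inv v (k + 1))" "\<not> (r = inv v (k + 1) \<and> s = inv v k)"
      by (auto simp: X_def vi)
    from up_covers_adj_iff[OF bij vi vi, of s r k] True this show ?thesis
      by (auto simp: L R down_covers_iff_up_covers transpose_commute[of r s])
  next
    case False
    then show ?thesis by (auto simp: L R down_covers_def)
  qed
  then have eq: "L - X = R - X" by auto
  have LX: "L \<inter> X = (if inv v (c - 1) < r then {(inv v (c - 1), c - 1)} else {})"
    by (auto simp: L X_def c vi down_covers_def ivv Transposition.transpose_def split: if_splits)
  have RX: "R \<inter> X = (if inv v (c + 1) < r then {(inv v (c + 1), c)} else {})"
    by (auto simp: R X_def c vi ivv down_covers_def Transposition.transpose_def split: if_splits dest: sym[of "v _" "v r + 1"])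
  have "sum f (L \<inter> X) = of_bool (inv v (c - 1) < r) * nred n v"
    using f[of "(inv v (c - 1), c - 1)"] unfolding LX by (auto simp: X_def c vi)
  moreover have "sum f (R \<inter> X) = of_bool (inv v (c + 1) < r) * nred n v"
    using f[of "(inv v (c + 1), c)"] unfolding RX by (auto simp: X_def c vi)
  moreover have "sum f L = sum f (L \<inter> X) + sum f (L - X)" "sum f R = sum f (R \<inter> X) + sum f (R - X)"
    using sum.Int_Diff[OF finL] sum.Int_Diff[OF finR] by auto
  ultimately show ?thesis unfolding sumL sumR eq by simp
qed


text \<open>A counting form of the transition formula of Lascoux and Schutzenberger, realised
  bijectively by Little. The surplus terms in the induction agree because \<open>c + 1\<close> lies
  on exactly one side of \<open>r\<close>, and so does \<open>c - 1\<close>.\<close>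

lemma transition:
  assumes "permutation v"
  shows "(\<Sum>s\<in>up_covers v r. nred n (v \<circ> tr r s)) = (\<Sum>i\<in>down_covers v r. nred n (v \<circ> tr r i))"
  using assms
proof (induction n arbitrary: v)
  case 0
  have bij: "bij v" using 0 by (simp add: permutation)
  \<comment> \<open>\<open>nred 0\<close> sees only the identity, but then \<open>v\<close> would be
    the transposition itself, with an inversion where a cover needs an ascent.\<close>
  have "v \<circ> tr r s \<noteq> id" if "s \<in> up_covers v r" for s
  proof
    assume "v \<circ> tr r s = id"
    then have "v s = r" "v r = s" by (auto simp: fun_eq_iff) (metis transpose_apply_first transpose_apply_second)+
    then show False using that by (auto simp: up_covers_def)
  qed
  moreover have "v \<circ> tr r s \<noteq> id" if "s \<in> down_covers v r" for s
  proof
    assume "v \<circ> tr r s = id"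
    then have "v s = r" "v r = s" by (auto simp: fun_eq_iff) (metis transpose_apply_first transpose_apply_second)+
    then show False using that by (auto simp: down_covers_def)
  qed
  ultimately show ?case by (simp del: o_apply)
next
  case (Suc n)
  have bij: "bij v" using Suc.prems by (simp add: permutation)
  define c where "c = v r"
  have ne: "inv v (c + 1) \<noteq> r" "inv v (c - 1) \<noteq> r"
    using bij unfolding c_def by (metis add_cancel_right_right bij_inv_eq_iff one_neq_zero, metis bij_inv_eq_iff diff_add_cancel add_cancel_right_right one_neq_zero)
  have "permutation (adj k \<circ> v)" for k
    using Suc.prems by (auto intro: permutation_compose permutation_swap_id)
  then have IH: "(\<Sum>s\<in>up_covers (adj k \<circ> v) r. nred n (adj k \<circ> v \<circ> tr r s))
      = (\<Sum>i\<in>down_covers (adj k \<circ> v) r. nred n (adj k \<circ> v \<circ> tr r i))" for k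
    by (rule Suc.IH)
  show ?case
    unfolding sum_up_covers_nred_Suc[OF Suc.prems c_def] sum_down_covers_nred_Suc[OF Suc.prems c_def] IH
    using ne by auto
qed

subsection \<open>The transition step for 2143-avoiding permutations\<close>

definition avoids_2143 :: "(int \<Rightarrow> int) \<Rightarrow> bool" where
  "avoids_2143 w \<longleftrightarrow>
    (\<forall>a b c d. a < b \<longrightarrow> b < c \<longrightarrow> c < d \<longrightarrow> \<not> (w b < w a \<and> w a < w d \<and> w d < w c))"

definition code :: "(int \<Rightarrow> int) \<Rightarrow> int \<Rightarrow> nat" where
  "code w a = card {j. a < j \<and> w j < w a}"

lemma finite_code_set:
  assumes "permutation (w :: int \<Rightarrow> int)"
  shows "finite {j. a < j \<and> w j < w a}"
proof -
  obtain B where B: "\<bar>a\<bar> + \<bar>w a\<bar> + 1 \<le> B" "\<And>x. B \<le> \<bar>x\<bar> \<Longrightarrow> w x = x"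
    using permutation_bound[OF assms] by blast
  have "{j. a < j \<and> w j < w a} \<subseteq> {a..B}"
  proof
    fix j assume j: "j \<in> {j. a < j \<and> w j < w a}"
    show "j \<in> {a..B}"
    proof (rule ccontr)
      assume "j \<notin> {a..B}"
      then have "B < j" using j by auto
      moreover have "w j = j" using \<open>B < j\<close> B(1) by (intro B(2)) linarith
      ultimately show False using j B(1) by auto
    qed
  qed
  then show ?thesis by (rule finite_subset) simp
qed

text \<open>Here \<open>r\<close> is the last descent, \<open>s\<close> the last position to its
  right with a smaller entry, and \<open>i\<close> the last position to its left with an entry below
  \<open>w s\<close>.\<close>

locale transition_step =
  fixes w :: "int \<Rightarrow> int" and i r s :: int
  assumes perm: "permutation w" and avoid: "avoids_2143 w"
    and incr: "\<And>x y. r < x \<Longrightarrow> x < y \<Longrightarrow> w x < w y"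
    and ir: "i < r" and rs: "r < s" and wis: "w i < w s" and wsr: "w s < w r"
    and above: "\<And>j. s < j \<Longrightarrow> w r < w j"
    and left: "\<And>j. i < j \<Longrightarrow> j < r \<Longrightarrow> w s < w j"
begin

text \<open>Both \<open>w\<close> and \<open>w'\<close> cover \<open>w \<circ> tr r s\<close>: the
  former exchanges its entry at \<open>r\<close> with one to the right, the latter with one to the
  left.\<close>

definition w' :: "int \<Rightarrow> int" where "w' = w \<circ> tr r s \<circ> tr r i"

lemma w'_simps: "w' i = w s" "w' r = w i" "w' s = w r"
  "x \<noteq> i \<Longrightarrow> x \<noteq> r \<Longrightarrow> x \<noteq> s \<Longrightarrow> w' x = w x"
  using ir rs by (auto simp: w'_def Transposition.transpose_def)

lemma below: "r < j \<Longrightarrow> j < s \<Longrightarrow> w j < w s"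
  by (rule incr)

lemma permutation_w': "permutation w'"
  using perm unfolding w'_def by (intro permutation_compose permutation_swap_id)

text \<open>Entries between \<open>r\<close> and \<open>s\<close> are below \<open>w s\<close>, and
  any entry beyond \<open>s\<close> exceeds \<open>w r\<close>, which now stands at \<open>s\<close>
  and blocks the cover.\<close>

lemma up_covers_eq: "up_covers (w \<circ> tr r s) r = {s}"
proof -
  have v: "(w \<circ> tr r s) r = w s" "(w \<circ> tr r s) s = w r" "\<And>j. r < j \<Longrightarrow> j \<noteq> s \<Longrightarrow> (w \<circ> tr r s) j = w j"
    by (auto simp: Transposition.transpose_def)
  have "x = s" if "x \<in> up_covers (w \<circ> tr r s) r" for x
  proof (rule ccontr)
    assume ne: "x \<noteq> s"
    have x: "r < x" "w s < w x" "\<And>j. r < j \<Longrightarrow> j < x \<Longrightarrow> \<not> (w s < (w \<circ> tr r s) j \<and> (w \<circ> tr r s) j < w x)"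
      using that ne unfolding up_covers_def mem_Collect_eq v(1) using v(3)[of x] by auto
    have "s < x" using below[of x] x ne by force
    then show False using x(3)[of s] rs v(2) wsr above by auto
  qed
  moreover have "s \<in> up_covers (w \<circ> tr r s) r"
    unfolding up_covers_def mem_Collect_eq v(1,2) using rs wsr below v(3) by force
  ultimately show ?thesis by blast
qed

text \<open>A second lower cover would sit left of \<open>i\<close> with a value between
  \<open>w i\<close> and \<open>w s\<close>; together with \<open>i\<close>, \<open>r\<close>,
  \<open>s\<close> it would be a 2143 pattern of \<open>w\<close>.\<close>

lemma down_covers_eq: "down_covers (w \<circ> tr r s) r = {i}"
proof -
  have v: "(w \<circ> tr r s) r = w s" "\<And>j. j < r \<Longrightarrow> (w \<circ> tr r s) j = w j"
    using rs by (auto simp: Transposition.transpose_def)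
  have "x = i" if "x \<in> down_covers (w \<circ> tr r s) r" for x
  proof (rule ccontr)
    assume ne: "x \<noteq> i"
    have x: "x < r" "w x < w s" "\<And>j. x < j \<Longrightarrow> j < r \<Longrightarrow> \<not> (w x < w j \<and> w j < w s)"
      using that unfolding down_covers_def mem_Collect_eq v(1) using v(2) by auto
    have "x < i" using left[of x] x ne by force
    moreover have "w i \<noteq> w x" using perm ne by (metis bij_def inj_eq permutation)
    ultimately have "w i < w x" using x(3)[of i] ir wis by force
    then show False
      using avoid \<open>x < i\<close> ir rs x(2) wsr unfolding avoids_2143_def by blast
  qed
  moreover have "i \<in> down_covers (w \<circ> tr r s) r"
    unfolding down_covers_def mem_Collect_eq v(1) using ir wis left v(2) by force
  ultimately show ?thesis by blast
qed

lemma nred_w': "nred n w' = nred n w"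
proof -
  have "permutation (w \<circ> tr r s)" using perm by (intro permutation_compose permutation_swap_id)
  from transition[OF this, where r = r and n = n] have "nred n (w \<circ> tr r s \<circ> tr r s) = nred n w'"
    by (simp only: up_covers_eq down_covers_eq w'_def) simp
  then show ?thesis by (simp add: o_assoc[symmetric])
qed

lemma incr':
  assumes "r < x" "x < y"
  shows "w' x < w' y"
proof -
  have "w' z = w z" if "r < z" "z \<noteq> s" for z using that ir by (intro w'_simps) auto
  then show ?thesis using assms incr[of x y] w'_simps(3) above[of y] below[of x] wsr
    by (cases "x = s"; cases "y = s") auto
qed

text \<open>A pattern of \<open>w'\<close> is turned into one of \<open>w\<close> by trading the
  positions \<open>i\<close>, \<open>r\<close>, \<open>s\<close> among each other. Since
  \<open>w'\<close> increases after \<open>r\<close>, the largest entry of the pattern is at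
  \<open>r\<close> or to its left.\<close>

lemma avoids_2143_w': "avoids_2143 w'"
  unfolding avoids_2143_def
proof (intro allI impI notI)
  fix a b c d
  assume lt: "a < b" "b < c" "c < d" and pat: "w' b < w' a \<and> w' a < w' d \<and> w' d < w' c"
  have av: False if "a < b" "b < c" "c < d" "w b < w a" "w a < w d" "w d < w c" for a b c d
    using avoid that unfolding avoids_2143_def by blast
  consider "r < c" | "c = r" | "c < r" by linarith
  then show False
  proof cases
    case 1
    then show False
      using lt pat incr'[of c d] by auto
  next
    case 2
    \<comment> \<open>The entry at \<open>r\<close> is now \<open>w i\<close>, so the other three
      entries are below \<open>w i\<close>; this puts \<open>a\<close> and \<open>b\<close> left of
      \<open>i\<close>, and the same four positions are a pattern of \<open>w\<close>.\<close>
    have "d < s" using pat lt w'_simps(2,3) w'_simps(4)[of d] above[of d] 2 ir wsr wis by (smt (verit))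
    have ab: "a < i" "b < i"
      using pat lt w'_simps w'_simps(4)[of a] w'_simps(4)[of b] left[of a] left[of b] 2 ir wis rs
      by (smt (verit))+
    show False using av[of a b r d] ab w'_simps pat lt \<open>d < s\<close> 2 ir rs below[of d] wsr by (smt (verit))
  next
    case 3
    have ne: "a \<noteq> r" "b \<noteq> r" "a \<noteq> s" "b \<noteq> s" "c \<noteq> s" using 3 lt rs by auto
    consider "a = i" | "b = i" | "c = i" | "a \<noteq> i" "b \<noteq> i" "c \<noteq> i" by blast
    then show False
    proof cases
      case 1
      then show False using pat lt w'_simps(1) w'_simps(4)[of b] left[of b] 3 ne by (smt (verit))
    next
      case b: 2
      have a: "w' a = w a" and c: "w' c = w c" using b ne lt 3 by (auto intro: w'_simps)
      have "w s < w a" using pat b w'_simps(1) a by simp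
      show False
      proof (cases "d = s")
        case True
        then show False using av[of a i c r] pat lt b a c 3 w'_simps \<open>w s < w a\<close> wis by auto
      next
        case False
        moreover have "d \<noteq> r" using pat a w'_simps \<open>w s < w a\<close> wis by auto
        ultimately have "w' d = w d" using lt b by (intro w'_simps) auto
        then show False using av[of a i c d] pat lt b a c \<open>w s < w a\<close> wis by auto
      qed
    next
      case c: 3
      have a: "w' a = w a" and b: "w' b = w b" using c ne lt 3 by (auto intro: w'_simps)
      show False
      proof (cases "d = r")
        case True
        then show False using av[of a b r s] pat lt a b c w'_simps wis wsr rs by auto
      next
        case False
        have "d \<noteq> s" using pat c w'_simps wsr by auto
        then have d: "w' d = w d" using False lt c by (intro w'_simps) auto
        then have "r < d" using left[of d] False pat c w'_simps lt by (smt (verit))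
        then show False using av[of a b r d] pat lt a b c d w'_simps 3 wsr by auto
      qed
    next
      case 4
      have abc: "w' a = w a" "w' b = w b" "w' c = w c" using 4 ne 3 by (auto intro: w'_simps)
      consider "d = r" | "d = s" | "d = i" | "d \<noteq> r" "d \<noteq> s" "d \<noteq> i" by blast
      then show False
      proof cases
        case 1
        then show False
          using av[of a b c s] av[of a b c i] pat lt abc 4 3 w'_simps rs wis left[of c]
          by (smt (verit))
      next
        case 2
        then show False using av[of a b c r] pat lt abc 3 w'_simps by auto
      next
        case 3
        then show False using av[of a b c s] pat lt abc ir rs w'_simps by auto
      next
        case 4
        then show False using av[of a b c d] pat lt abc w'_simps(4)[of d] by auto
      qed
    qed
  qed
qed

text \<open>The smaller entries after \<open>r\<close> fill \<open>{r<..s}\<close> in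
  \<open>w\<close>; those after \<open>i\<close> fill \<open>{r..<s}\<close> in \<open>w'\<close>,
  which is equally many. Conversely nothing between \<open>i\<close> and \<open>r\<close> is below
  \<open>w i\<close>, so its count survives the move to \<open>r\<close>.\<close>

lemma code_w': "code w' a = code w (tr i r a)"
proof -
  consider "a = i" | "a = r" | "r < a" | "a < i" | "i < a" "a < r" by linarith
  then show ?thesis
  proof cases
    case 1
    have "{j. i < j \<and> w' j < w' i} = {r..<s}"
      using w'_simps above left ir rs wis wsr below
      by (auto; smt (verit))
    moreover have "{j. r < j \<and> w j < w r} = {r<..s}"
      using above below wsr rs by (auto; smt (verit))
    ultimately show ?thesis using 1 by (simp add: code_def)
  next
    case 2
    have "{j. r < j \<and> w' j < w' r} = {j. i < j \<and> w j < w i}"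
      using w'_simps above left ir rs wis wsr below by (auto; smt (verit))
    then show ?thesis using 2 by (simp add: code_def)
  next
    case 3
    have "{j. a < j \<and> w' j < w' a} = {}"
      using 3 incr' by force
    moreover have "{j. a < j \<and> w j < w a} = {}"
      using 3 incr by force
    moreover have "tr i r a = a" using 3 ir by (auto simp: Transposition.transpose_def)
    ultimately show ?thesis by (simp only: code_def)
  next
    case 4
    have a: "w' a = w a" "tr i r a = a" using 4 rs ir by (auto simp: w'_simps Transposition.transpose_def)
    \<comment> \<open>All moved positions lie right of \<open>a\<close>, so the counted entries are
      merely permuted.\<close>
    have q: "(tr r s \<circ> tr r i) j \<in> {j. a < j \<and> w j < w a} \<longleftrightarrow> j \<in> {j. a < j \<and> w' j < w' a}" for j
      using 4 a w'_simps(1-3) w'_simps(4)[of j] ir rs wis 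
      by (auto simp: Transposition.transpose_def)
    have "bij_betw (tr r s \<circ> tr r i) {j. a < j \<and> w' j < w' a} {j. a < j \<and> w j < w a}"
    proof (rule bij_betw_byWitness[where f' = "tr r i \<circ> tr r s"])
      show "(tr r s \<circ> tr r i) ` {j. a < j \<and> w' j < w' a} \<subseteq> {j. a < j \<and> w j < w a}"
        using q by blast
      show "(tr r i \<circ> tr r s) ` {j. a < j \<and> w j < w a} \<subseteq> {j. a < j \<and> w' j < w' a}"
        unfolding image_subset_iff using q by (metis (no_types, lifting) comp_apply transpose_involutory)
    qed auto
    then show ?thesis unfolding a(2) code_def by (rule bij_betw_same_card)
  next
    case 5
    have a: "w' a = w a" "tr i r a = a" using 5 rs ir by (auto simp: w'_simps Transposition.transpose_def)
    \<comment> \<open>To the right of \<open>a\<close> the entry \<open>w i\<close> replaces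
      \<open>w s\<close>; both are below \<open>w a\<close>, so the count is unchanged.\<close>
    have q: "(tr r s) j \<in> {j. a < j \<and> w j < w a} \<longleftrightarrow> j \<in> {j. a < j \<and> w' j < w' a}" for j
      using 5 a w'_simps(1-3) w'_simps(4)[of j] ir rs wis left[of a]
      by (auto simp: Transposition.transpose_def)
    have "bij_betw (tr r s) {j. a < j \<and> w' j < w' a} {j. a < j \<and> w j < w a}"
    proof (rule bij_betw_byWitness[where f' = "tr r s"])
      show "(tr r s) ` {j. a < j \<and> w' j < w' a} \<subseteq> {j. a < j \<and> w j < w a}"
        using q by blast
      show "(tr r s) ` {j. a < j \<and> w j < w a} \<subseteq> {j. a < j \<and> w' j < w' a}"
        unfolding image_subset_iff using q by (metis (no_types, lifting) comp_apply transpose_involutory)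
    qed auto
    then show ?thesis unfolding a(2) code_def by (rule bij_betw_same_card)
  qed
qed

end

subsection \<open>Sorting the Lehmer code\<close>

text \<open>The inequalities between code entries identify \<open>i\<close> as the last position
  before \<open>r\<close> with a smaller code entry, so that a step can be read off the code
  alone.\<close>

lemma transition_step_exists:
  assumes perm: "permutation w" and avoid: "avoids_2143 w"
    and incr: "\<And>x y. r < x \<Longrightarrow> x < y \<Longrightarrow> w x < w y" and pos: "0 < code w r"
  obtains i s where "transition_step w i r s" "code w i < code w r"
    "\<And>j. i < j \<Longrightarrow> j < r \<Longrightarrow> code w r \<le> code w j"
proof -
  let ?S = "{j. r < j \<and> w j < w r}"
  have inj: "w x = w y \<longleftrightarrow> x = y" for x y using perm by (simp add: permutation bij_def inj_eq)
  have finS: "finite ?S" using perm by (rule finite_code_set)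
  have "?S \<noteq> {}" using pos card_gt_0_iff unfolding code_def by blast
  define s where "s = Max ?S"
  have "s \<in> ?S" unfolding s_def using finS \<open>?S \<noteq> {}\<close> by (rule Max_in)
  then have rs: "r < s" and wsr: "w s < w r" by auto
  have above: "w r < w j" if "s < j" for j
  proof (rule ccontr)
    assume "\<not> w r < w j"
    then have "w j < w r" using inj[of j r] that rs by auto
    then have "j \<in> ?S" using that rs by auto
    then have "j \<le> s" unfolding s_def using finS by (intro Max_ge)
    then show False using that by simp
  qed
  obtain B where B: "\<bar>r\<bar> + \<bar>w s\<bar> + 1 \<le> B" "\<And>x. B \<le> \<bar>x\<bar> \<Longrightarrow> w x = x"
    using permutation_bound[OF perm] by blast
  let ?T = "{x \<in> {- B..<r}. w x < w s}"
  have "finite ?T" by (rule finite_subset[of _ "{- B..<r}"]) auto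
  \<comment> \<open>A fixed point far to the left is smaller than \<open>w s\<close>, hence
    \<open>i\<close> exists; inside \<open>{1..n}\<close> this could fail.\<close>
  have "- B \<in> ?T" using B by auto
  define i where "i = Max ?T"
  have "i \<in> ?T" unfolding i_def using \<open>- B \<in> ?T\<close> \<open>finite ?T\<close> Max_in by blast
  then have ir: "i < r" and wis: "w i < w s" and "- B \<le> i" by auto
  have left: "w s < w j" if "i < j" "j < r" for j
  proof (rule ccontr)
    assume "\<not> w s < w j"
    then have "w j < w s" using inj[of j s] that rs by auto
    then have "j \<in> ?T" using that \<open>- B \<le> i\<close> by auto
    then have "j \<le> i" unfolding i_def using \<open>finite ?T\<close> by (intro Max_ge)
    then show False using that by simp
  qed
  have step: "transition_step w i r s"
    by unfold_locales (fact perm avoid incr ir rs wis wsr above left)+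
  have "{j. i < j \<and> w j < w i} \<subset> ?S"
  proof
    show "{j. i < j \<and> w j < w i} \<subseteq> ?S"
    proof
      fix j assume j: "j \<in> {j. i < j \<and> w j < w i}"
      then have j: "i < j" "w j < w i" by simp_all
      then have "\<not> j < r" "j \<noteq> r" using left[of j] wis wsr by force+
      then show "j \<in> ?S" using j wis wsr by simp
    qed
    have "s \<notin> {j. i < j \<and> w j < w i}" using wis by simp
    then show "{j. i < j \<and> w j < w i} \<noteq> ?S" using \<open>s \<in> ?S\<close> by metis
  qed
  then have "code w i < code w r" unfolding code_def using finS by (intro psubset_card_mono)
  moreover have "code w r \<le> code w j" if "i < j" "j < r" for j
    unfolding code_def
  proof (rule card_mono[OF finite_code_set[OF perm]], rule subsetI)
    fix x assume x: "x \<in> ?S"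
    then have "\<not> s < x" using above by force
    then have "w x \<le> w s" using incr[of x s] x by force
    then show "x \<in> {x. j < x \<and> w x < w j}" using left[OF that] x that by auto
  qed
  ultimately show ?thesis using that step by blast
qed

lemma code_eq_0_imp_less:
  assumes "permutation w" "code w x = 0" "x < y"
  shows "w x < w y"
proof -
  have "{j. x < j \<and> w j < w x} = {}" using assms finite_code_set[OF assms(1)] by (simp add: code_def)
  moreover have "w x \<noteq> w y" using assms by (auto simp: permutation bij_def inj_eq)
  ultimately show ?thesis using assms(3) by force
qed

text \<open>The representation is deliberately not unique: a zero may be added at either end. A zero
  on the left is the slot for an entry that finds no smaller one in the list; a zero on the right
  may be dropped to expose the next descent.\<close>

definition place :: "int \<Rightarrow> nat list \<Rightarrow> int \<Rightarrow> nat" where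
  "place p xs a = (if p \<le> a \<and> a < p + int (length xs) then xs ! nat (a - p) else 0)"

lemma place_snoc_0: "place p (xs @ [0]) = place p xs"
  by (auto simp: place_def fun_eq_iff nth_append)

lemma place_Cons_0: "place p xs = place (p - 1) (0 # xs)"
  by (auto simp: place_def fun_eq_iff nth_Cons' nat_diff_distrib' intro!: arg_cong[of _ _ "nth xs"])

lemma place_append: "place p (xs @ x # ys) (p + int (length xs)) = x"
  by (simp add: place_def)

lemma place_swap:
  "place p (as @ x # bs @ [y]) \<circ> tr (p + int (length as)) (p + int (length as + length bs + 1))
    = place p (as @ y # bs @ [x])"
proof
  fix a :: int
  consider "a < p" | "a = p + int (length as)" | "a = p + int (length as + length bs + 1)"
    | n where "a = p + int n" "n \<noteq> length as" "n \<noteq> length as + length bs + 1"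
    by (metis zle_iff_zadd linorder_not_less)
  then show "(place p (as @ x # bs @ [y]) \<circ> tr (p + int (length as)) (p + int (length as + length bs + 1))) a
    = place p (as @ y # bs @ [x]) a"
  proof cases
    case 1
    then show ?thesis by (simp add: place_def transpose_apply_other)
  next
    case 2
    then show ?thesis
      using place_append[of p "as @ x # bs" y "[]"] place_append[of p as y] by (simp add: add_ac)
  next
    case 3
    then show ?thesis
      using place_append[of p "as @ y # bs" x "[]"] place_append[of p as x] by (simp add: add_ac)
  next
    case 4
    then have "(as @ x # bs @ [y]) ! n = (as @ y # bs @ [x]) ! n" if "n < length as + length bs + 2"
      using that by (auto simp: nth_append nth_Cons')
    with 4 show ?thesis by (simp add: place_def transpose_apply_other)
  qed
qed

lemma place_between:
  assumes "p + int (length as) < j" "j < p + int (length as + length bs + 1)"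
  shows "place p (as @ x # bs @ [y]) j \<in> set bs"
proof -
  obtain n where n: "j = p + int (length as) + 1 + int n"
    using assms(1) by (metis zle_iff_zadd zless_imp_add1_zle)
  then have "n < length bs" using assms(2) by linarith
  then show ?thesis using n by (simp add: place_def nth_append nat_add_distrib)
qed

text \<open>Beyond the list the code vanishes and \<open>w\<close> increases, so the positive entry
  \<open>y\<close> marks the last descent; the bound on \<open>bs\<close> makes the position of
  \<open>x\<close> the one with which it is exchanged.\<close>

lemma transition_code:
  assumes perm: "permutation w" and avoid: "avoids_2143 w"
    and code: "code w = place p (as @ x # bs @ [y])" and xy: "x < y" and bs: "\<And>b. b \<in> set bs \<Longrightarrow> y \<le> b"
  obtains w' where "permutation w'" "avoids_2143 w'" "code w' = place p (as @ y # bs @ [x])"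
    "\<And>n. nred n w' = nred n w"
proof -
  define i where "i = p + int (length as)"
  define r where "r = p + int (length as + length bs + 1)"
  have ci: "code w i = x" and cr: "code w r = y"
    using place_append[of p as x] place_append[of p "as @ x # bs" y "[]"]
    by (simp_all add: code i_def r_def add_ac)
  have "w a < w b" if "r < a" "a < b" for a b
  proof (rule code_eq_0_imp_less[OF perm _ that(2)])
    show "code w a = 0" using that(1) by (auto simp: code place_def r_def)
  qed
  moreover have "0 < code w r" using cr xy by simp
  ultimately obtain i' s where step: "transition_step w i' r s" and i': "code w i' < code w r"
    "\<And>j. i' < j \<Longrightarrow> j < r \<Longrightarrow> code w r \<le> code w j"
    using transition_step_exists[OF perm avoid] by blast
  interpret transition_step w i' r s by (rule step)
  have "i < r" by (simp add: i_def r_def)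
  have "code w r \<le> code w j" if "i < j" "j < r" for j
    using place_between[of p as j bs x y] bs that by (simp add: cr) (simp add: code i_def r_def)
  then have "i' = i" using i' xy ci cr \<open>i < r\<close> ir by (meson linorder_neqE not_le)
  have "code w' = code w \<circ> tr i r" using code_w' \<open>i' = i\<close> by auto
  then have "code w' = place p (as @ y # bs @ [x])"
    unfolding code i_def r_def place_swap .
  then show ?thesis using that permutation_w' avoids_2143_w' nred_w' by blast
qed

text \<open>
  The loop invariant of the insertion sort: \<open>F\<close> is the sorted front, \<open>T\<close> the part still to be inserted,
  and \<open>x\<close>, the entry at the last descent, is bumped through \<open>F\<close> from right to left.
\<close>

lemma transition_chain:
  assumes "permutation w" "avoids_2143 w" "code w = place p (F @ T @ [x])"
    "sorted F" "sorted (rev (T @ [x]))" "\<And>f t. f \<in> set F \<Longrightarrow> t \<in> set T \<Longrightarrow> f \<le> t"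
    "0 < x" "\<And>f. f \<in> set F \<Longrightarrow> 0 < f"
  shows "\<exists>w' p'. permutation w' \<and> code w' = place p' (sort (F @ T @ [x])) \<and> (\<forall>n. nred n w' = nred n w)"
  using assms
proof (induction "(length T, x)" arbitrary: w p F T x rule: wf_induct_rule[OF wf_lex_prod[OF wf_less_than wf_less_than]])
  case (1 T x w p F)
  note IH = 1(1) and prems = 1(2-)
  have Tx: "x \<le> t" if "t \<in> set T" for t using prems(5) that by auto
  show ?case
  proof (cases "\<exists>f\<in>set F. f < x")
    case True
    \<comment> \<open>The last smaller entry of the front is bumped: \<open>x\<close> takes its
      place and \<open>f\<close> moves to the end. The front stays sorted, and the measure drops
      because \<open>f < x\<close>.\<close>
    then obtain F1 f F2 where F: "F = F1 @ f # F2" "f < x" "\<forall>g\<in>set F2. \<not> g < x"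
      using split_list_last_prop[of F "\<lambda>f. f < x"] by blast
    have "code w = place p (F1 @ f # (F2 @ T) @ [x])" using prems(3) F by simp
    then obtain w1 where w1: "permutation w1" "avoids_2143 w1"
      "code w1 = place p (F1 @ x # (F2 @ T) @ [f])" "\<And>n. nred n w1 = nred n w"
      using transition_code[OF prems(1,2)] F Tx by (metis Un_iff not_less set_append)
    have "\<exists>w' p'. permutation w' \<and> code w' = place p' (sort ((F1 @ x # F2) @ T @ [f])) \<and> (\<forall>n. nred n w' = nred n w1)"
    proof (rule IH)
      show "((length T, f), (length T, x)) \<in> less_than <*lex*> less_than" using F by simp
      show "sorted (F1 @ x # F2)" "sorted (rev (T @ [f]))"
        using prems(4,5) F Tx by (auto simp: sorted_append) force+
      show "f \<le> t" if "f \<in> set (F1 @ x # F2)" "t \<in> set T" for f t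
        using that prems(6) F Tx by auto
    qed (use w1 prems F in auto)
    moreover have "sort ((F1 @ x # F2) @ T @ [f]) = sort (F @ T @ [x])"
      by (rule properties_for_sort) (auto simp: F)
    ultimately show ?thesis using w1(4) by auto
  next
    case False
    \<comment> \<open>No front entry is smaller, so \<open>x\<close> trades places with the zero
      just left of the front. The zero arriving at the end is dropped, and the last entry of
      \<open>T\<close> is next.\<close>
    have "code w = place (p - 1) ([] @ 0 # (F @ T) @ [x])" unfolding prems(3) by (subst place_Cons_0) simp
    then obtain w1 where w1: "permutation w1" "avoids_2143 w1"
      "code w1 = place (p - 1) ([] @ x # (F @ T) @ [0])" "\<And>n. nred n w1 = nred n w"
      using transition_code[OF prems(1,2)] False Tx prems(7) by (metis Un_iff not_less set_append)
    have code: "code w1 = place (p - 1) (x # F @ T)"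
      using place_snoc_0[of "p - 1" "x # F @ T"] w1(3) by simp
    show ?thesis
    proof (cases T rule: rev_cases)
      case Nil
      have "sort (F @ T @ [x]) = x # F"
        using False prems(4) Nil by (intro properties_for_sort) (auto simp: not_less)
      moreover have "code w1 = place (p - 1) (x # F)" using code Nil by simp
      ultimately show ?thesis using w1(1,4) by auto
    next
      case (snoc T' y)
      have "\<exists>w' p'. permutation w' \<and> code w' = place p' (sort ((x # F) @ T' @ [y])) \<and> (\<forall>n. nred n w' = nred n w1)"
      proof (rule IH)
        show "((length T', y), (length T, x)) \<in> less_than <*lex*> less_than" using snoc by simp
        show "code w1 = place (p - 1) ((x # F) @ T' @ [y])" using code snoc by simp
        show "sorted (x # F)" "sorted (rev (T' @ [y]))"
          using prems(4,5) snoc False by (auto simp: sorted_append not_less)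
        show "f \<le> t" if "f \<in> set (x # F)" "t \<in> set T'" for f t
          using that prems(6) snoc Tx by auto
        show "0 < y" using Tx[of y] prems(7) snoc by simp
      qed (use w1 prems snoc in auto)
      moreover have "sort ((x # F) @ T' @ [y]) = sort (F @ T @ [x])"
        by (rule properties_for_sort) (auto simp: snoc)
      ultimately show ?thesis using w1(4) by auto
    qed
  qed
qed

subsection \<open>A Lagrange interpolation identity\<close>

text \<open>The factor by which a Vandermonde product over \<open>S\<close> changes when
  \<open>a\<close> is lowered by 1; also minus the residue at \<open>a\<close> of the product of all
  \<open>1 - 1 / (z - b)\<close>.\<close>

definition lagrange_weight :: "real set \<Rightarrow> real \<Rightarrow> real" where
  "lagrange_weight S a = (\<Prod>b\<in>S - {a}. (a - 1 - b) / (a - b))"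

lemma lagrange_weight_insert:
  assumes "finite S" "c \<notin> S"
  shows "a \<in> S \<Longrightarrow> lagrange_weight (insert c S) a = lagrange_weight S a * (1 - 1 / (a - c))"
    and "lagrange_weight (insert c S) c = (\<Prod>b\<in>S. (c - 1 - b) / (c - b))"
proof -
  show "lagrange_weight (insert c S) a = lagrange_weight S a * (1 - 1 / (a - c))" if "a \<in> S"
  proof -
    have "insert c S - {a} = insert c (S - {a})" "a \<noteq> c" using that assms by auto
    then show ?thesis using assms by (simp add: lagrange_weight_def field_simps)
  qed
  have "insert c S - {c} = S" using assms by auto
  then show "lagrange_weight (insert c S) c = (\<Prod>b\<in>S. (c - 1 - b) / (c - b))"
    by (simp add: lagrange_weight_def)
qed

text \<open>As functions of \<open>z\<close> both sides have simple poles on \<open>S\<close> with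
  the same residues, and tend to 1 at infinity. The induction replaces this argument by
  algebra.\<close>

lemma partial_fractions:
  assumes "finite S" "z \<notin> S"
  shows "(\<Prod>b\<in>S. (z - 1 - b) / (z - b)) = 1 - (\<Sum>a\<in>S. lagrange_weight S a / (z - a))"
  using assms
proof (induction S arbitrary: z)
  case empty
  then show ?case by simp
next
  case (insert c S)
  let ?W = "lagrange_weight S"
  \<comment> \<open>The induction hypothesis at the new node \<open>z = c\<close> supplies the
    weight of that node.\<close>
  have c: "(\<Prod>b\<in>S. (c - 1 - b) / (c - b)) = 1 - (\<Sum>a\<in>S. ?W a / (c - a))"
    using insert by simp
  have zc: "z \<noteq> c" "z \<notin> S" using insert by auto
  have key: "?W a * (1 - 1 / (a - c)) / (z - a) = ?W a / (z - a) * (1 - 1 / (z - c)) + ?W a / (c - a) / (z - c)"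
    if "a \<in> S" for a
  proof -
    have "a \<noteq> c" "z \<noteq> a" using that insert zc by auto
    then show ?thesis using zc by (simp add: divide_simps) (simp add: algebra_simps)
  qed
  have "(\<Sum>a\<in>S. lagrange_weight (insert c S) a / (z - a))
      = (\<Sum>a\<in>S. ?W a / (z - a) * (1 - 1 / (z - c)) + ?W a / (c - a) / (z - c))"
    using insert by (intro sum.cong) (auto simp: lagrange_weight_insert(1) key)
  also have "\<dots> = (\<Sum>a\<in>S. ?W a / (z - a)) * (1 - 1 / (z - c)) + (\<Sum>a\<in>S. ?W a / (c - a)) / (z - c)"
    by (simp add: sum.distrib sum_distrib_right sum_divide_distrib)
  finally show ?case
    using insert zc by (simp add: lagrange_weight_insert(2) c divide_simps) (simp add: algebra_simps)
qed


text \<open>This compares the coefficients of \<open>1 / z\<close> at infinity in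
  \<open>partial_fractions\<close>.\<close>

lemma sum_lagrange_weight:
  assumes "finite S"
  shows "(\<Sum>a\<in>S. lagrange_weight S a) = card S"
  using assms
proof (induction S)
  case empty
  then show ?case by simp
next
  case (insert c S)
  let ?W = "lagrange_weight S"
  have "(\<Sum>a\<in>S. lagrange_weight (insert c S) a) = (\<Sum>a\<in>S. ?W a + ?W a / (c - a))"
  proof (rule sum.cong)
    fix a assume "a \<in> S"
    then have "a \<noteq> c" using insert by auto
    then show "lagrange_weight (insert c S) a = ?W a + ?W a / (c - a)"
      using insert \<open>a \<in> S\<close> by (simp add: lagrange_weight_insert(1) divide_simps) (simp add: algebra_simps)
  qed simp
  then show ?case
    using insert by (simp add: lagrange_weight_insert(2) partial_fractions sum.distrib)
qed

text \<open>The same comparison for the square of \<open>1 / z\<close>; the binomial coefficient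
  counts the products of two terms \<open>- 1 / (z - b)\<close>.\<close>

lemma sum_mult_lagrange_weight:
  assumes "finite S"
  shows "(\<Sum>a\<in>S. a * lagrange_weight S a) = \<Sum>S - real (card S choose 2)"
  using assms
proof (induction S)
  case empty
  then show ?case by simp
next
  case (insert c S)
  let ?W = "lagrange_weight S"
  have "(\<Sum>a\<in>S. a * lagrange_weight (insert c S) a) = (\<Sum>a\<in>S. a * ?W a - ?W a + c * (?W a / (c - a)))"
  proof (rule sum.cong)
    fix a assume "a \<in> S"
    then have "a \<noteq> c" using insert by auto
    then show "a * lagrange_weight (insert c S) a = a * ?W a - ?W a + c * (?W a / (c - a))"
      using insert \<open>a \<in> S\<close> by (simp add: lagrange_weight_insert(1) divide_simps) (simp add: algebra_simps)
  qed simp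
  also have "\<dots> = (\<Sum>a\<in>S. a * ?W a) - (\<Sum>a\<in>S. ?W a) + c * (\<Sum>a\<in>S. ?W a / (c - a))"
    by (simp add: sum.distrib sum_subtractf sum_distrib_left)
  finally have "(\<Sum>a\<in>S. a * lagrange_weight (insert c S) a)
      = \<Sum>S - real (card S choose 2) - card S + c * (\<Sum>a\<in>S. ?W a / (c - a))"
    using insert by (simp add: sum_lagrange_weight)
  moreover have "card (insert c S) choose 2 = card S + (card S choose 2)"
    using insert by (simp add: numeral_2_eq_2)
  ultimately show ?case
    using insert by (simp add: lagrange_weight_insert(2) partial_fractions) (simp add: algebra_simps)
qed

section \<open>Vandermonde products with one variable lowered\<close>

definition vdm :: "nat \<Rightarrow> (nat \<Rightarrow> real) \<Rightarrow> real" where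
  "vdm K l = (\<Prod>(a, b)\<in>{(a, b). a < b \<and> b < K}. l b - l a)"

lemma finite_pairs_less: "finite {(a, b). a < b \<and> b < (K :: nat)}"
  by (rule finite_subset[of _ "{..<K} \<times> {..<K}"]) auto

lemma vdm_upd:
  assumes inj: "inj_on l {..<K}" and t: "t < K"
  shows "vdm K (l(t := x)) = vdm K l * (\<Prod>b\<in>{..<K} - {t}. (x - l b) / (l t - l b))"
proof -
  let ?l = "l(t := x)"
  let ?P = "{(a, b). a < b \<and> b < K}"
  define q where "q = (\<lambda>(a, b). (?l b - ?l a) / (l b - l a))"
  \<comment> \<open>The pair of indices formed by \<open>t\<close> and \<open>b\<close>, put in
    increasing order; all other factors are unaffected by the update.\<close>
  define g where "g = (\<lambda>b. (min t b, max t b))"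
  have ne: "l a \<noteq> l b" if "a < K" "b < K" "a \<noteq> b" for a b
    using that inj by (auto simp: inj_on_def)
  have "vdm K ?l = (\<Prod>x\<in>?P. (case x of (a, b) \<Rightarrow> l b - l a) * q x)"
    unfolding vdm_def by (rule prod.cong) (auto simp: q_def ne[symmetric])
  also have "\<dots> = vdm K l * prod q ?P"
    by (simp add: prod.distrib vdm_def)
  also have "prod q ?P = prod q (g ` ({..<K} - {t}))"
  proof (rule prod.mono_neutral_right[OF finite_pairs_less])
    show "g ` ({..<K} - {t}) \<subseteq> ?P" using t by (auto simp: g_def)
    show "\<forall>i\<in>?P - g ` ({..<K} - {t}). q i = 1"
    proof safe
      fix a b assume ab: "a < b" "b < K" "(a, b) \<notin> g ` ({..<K} - {t})"
      have "a \<noteq> t"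
      proof
        assume "a = t"
        then have "(a, b) = g b" "b \<in> {..<K} - {t}" using ab by (auto simp: g_def)
        then show False using ab(3) by blast
      qed
      moreover have "b \<noteq> t"
      proof
        assume "b = t"
        then have "(a, b) = g a" "a \<in> {..<K} - {t}" using ab by (auto simp: g_def)
        then show False using ab(3) by blast
      qed
      ultimately show "q (a, b) = 1" using ne[of a b] ab by (simp add: q_def)
    qed
  qed
  also have "\<dots> = (\<Prod>b\<in>{..<K} - {t}. q (g b))"
    by (rule prod.reindex_cong[of g]) (auto simp: g_def inj_on_def min_def max_def split: if_splits)
  also have "\<dots> = (\<Prod>b\<in>{..<K} - {t}. (x - l b) / (l t - l b))"
  proof (rule prod.cong)
    fix b assume b: "b \<in> {..<K} - {t}"
    then have "l b \<noteq> l t" using ne t by auto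
    then show "q (g b) = (x - l b) / (l t - l b)"
      using b by (cases "b < t") (simp_all add: g_def q_def divide_simps, simp add: algebra_simps)
  qed simp
  finally show ?thesis .
qed

text \<open>If \<open>l t\<close> is the part of index \<open>t\<close> plus \<open>t\<close>, this
  is the branching rule for standard tableaux in Frobenius' form: the scalar on the right is the
  number of boxes, and each summand removes one box.\<close>

lemma sum_mult_vdm:
  assumes inj: "inj_on l {..<K}"
  shows "(\<Sum>t<K. l t * vdm K (l(t := l t - 1))) = ((\<Sum>t<K. l t) - real (K choose 2)) * vdm K l"
proof -
  have w: "(\<Prod>b\<in>{..<K} - {t}. (l t - 1 - l b) / (l t - l b)) = lagrange_weight (l ` {..<K}) (l t)"
    if "t < K" for t
  proof -
    have "l ` {..<K} - {l t} = l ` ({..<K} - {t})" using inj that by (auto simp: inj_on_def)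
    moreover have "inj_on l ({..<K} - {t})" using inj by (rule inj_on_subset) auto
    ultimately show ?thesis by (simp add: lagrange_weight_def prod.reindex)
  qed
  have "(\<Sum>t<K. l t * vdm K (l(t := l t - 1))) = (\<Sum>t<K. l t * lagrange_weight (l ` {..<K}) (l t)) * vdm K l"
    unfolding sum_distrib_right by (rule sum.cong) (auto simp: vdm_upd[OF inj] w)
  also have "(\<Sum>t<K. l t * lagrange_weight (l ` {..<K}) (l t)) = (\<Sum>a\<in>l ` {..<K}. a * lagrange_weight (l ` {..<K}) a)"
    using inj by (simp add: sum.reindex)
  also have "\<dots> = (\<Sum>t<K. l t) - real (K choose 2)"
    using inj by (simp add: sum_mult_lagrange_weight sum.reindex card_image)
  finally show ?thesis .
qed

subsection \<open>Grassmannian permutations\<close>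

lemma vdm_0: "vdm 0 l = 1"
  by (simp add: vdm_def)

lemma vdm_Suc: "vdm (Suc K) l = vdm K l * (\<Prod>a<K. l K - l a)"
proof -
  have "{(a, b). a < b \<and> b < Suc K} = {(a, b). a < b \<and> b < K} \<union> (\<lambda>a. (a, K)) ` {..<K}"
    by (auto simp: less_Suc_eq)
  moreover have "{(a, b). a < b \<and> b < K} \<inter> (\<lambda>a. (a, K)) ` {..<K} = {}" by auto
  ultimately have "vdm (Suc K) l = vdm K l * (\<Prod>(a, b)\<in>(\<lambda>a. (a, K)) ` {..<K}. l b - l a)"
    unfolding vdm_def by (simp add: prod.union_disjoint finite_pairs_less)
  then show ?thesis by (simp add: prod.reindex inj_on_def)
qed

text \<open>Makes Frobenius' formula evaluate to 1 for the empty partition, where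
  \<open>l t = t\<close>.\<close>

lemma vdm_of_nat: "vdm K real = (\<Prod>t<K. fact t)"
proof (induction K)
  case 0
  then show ?case by (simp add: vdm_0)
next
  case (Suc K)
  have "(\<Prod>a<K. real K - real a) = (\<Prod>a<K. real (K - a))"
    by (rule prod.cong) auto
  also have "\<dots> = fact K"
    unfolding fact_prod_rev by (simp add: lessThan_atLeast0)
  finally show ?case using Suc by (simp add: vdm_Suc)
qed

text \<open>Strictly increasing integer values grow by at least 1 per step, and the fixed points at
  both ends leave no slack.\<close>

lemma incr_permutation_eq_id:
  assumes "permutation (w :: int \<Rightarrow> int)" "\<And>x y. x < y \<Longrightarrow> w x < w y"
  shows "w = id"
proof
  fix x
  obtain B where B: "\<bar>x\<bar> + 1 \<le> B" "\<And>x. B \<le> \<bar>x\<bar> \<Longrightarrow> w x = x"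
    using permutation_bound[OF assms(1)] by blast
  have up: "w a + int n \<le> w (a + int n)" for a n
  proof (induction n)
    case (Suc n)
    then show ?case using assms(2)[of "a + int n" "a + int n + 1"] by (simp add: algebra_simps)
  qed simp
  have "w (- B) = - B" "w B = B" using B by auto
  then show "w x = id x"
    using up[of "- B" "nat (x + B)"] up[of x "nat (B - x)"] B(1) by (simp split: if_splits)
qed

text \<open>The only possible descent is at \<open>p + int K - 1\<close>. The numbers
  \<open>l t - t\<close> are the parts of a partition of \<open>n\<close>, and removing a letter on
  the left removes a box, so the induction follows the branching rule
  \<open>sum_mult_vdm\<close>.\<close>

lemma nred_grassmannian:
  fixes w :: "int \<Rightarrow> int" and p :: int and K n :: nat and l :: "nat \<Rightarrow> nat"
  assumes "permutation w"
    and "\<And>x y. x < y \<Longrightarrow> y < p + int K \<Longrightarrow> w x < w y"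
    and "\<And>x y. p + int K \<le> x \<Longrightarrow> x < y \<Longrightarrow> w x < w y"
    and "\<And>x. x < p \<Longrightarrow> w x = x"
    and "\<And>t. t < K \<Longrightarrow> w (p + int t) = p + int (l t)"
    and "n + (K choose 2) = (\<Sum>t<K. l t)"
  shows "nred n w = fact n * vdm K (\<lambda>t. real (l t)) / (\<Prod>t<K. fact (l t))"
  using assms
proof (induction n arbitrary: w l)
  case (0 w l)
  note incr = 0(2) and incr' = 0(3) and low = 0(4) and l = 0(5)
  \<comment> \<open>Since \<open>l\<close> increases, \<open>t \<le> l t\<close>; for the empty
    partition the sums agree, which forces equality everywhere.\<close>
  have ge: "t \<le> l t" if "t < K" for t
    using that
  proof (induction t)
    case (Suc t)
    then show ?case using incr[of "p + int t" "p + int (Suc t)"] l[of t] l[of "Suc t"] by simp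
  qed simp
  have "(\<Sum>t<K. l t) = (\<Sum>t<K. t)"
    using 0(6) by (simp add: lessThan_atLeast0 Sum_Ico_nat choose_two)
  then have eq: "l t = t" if "t < K" for t
    using that ge sum_mono_inv[of "\<lambda>t. t" "{..<K}" l t] by simp
  have wp: "w x = x" if "x < p + int K" for x
  proof (cases "x < p")
    case False
    then obtain t where "x = p + int t" by (metis not_less zle_iff_zadd)
    then show ?thesis using l[of t] eq[of t] that by simp
  qed (rule low)
  have "w x < w y" if "x < y" for x y
  proof (cases "y < p + int K \<or> p + int K \<le> x")
    case True
    then show ?thesis using incr incr' that by blast
  next
    case False
    have high: "p + int K \<le> w z" if "p + int K \<le> z" for z
    proof (rule ccontr)
      assume n: "\<not> p + int K \<le> w z"
      then have "w (w z) = w z" using wp by simp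
      then have "w z = z" using 0(1) by (metis bij_def injD permutation)
      then show False using n that by simp
    qed
    show ?thesis using False wp[of x] high[of y] by simp
  qed
  with 0(1) have "w = id" by (rule incr_permutation_eq_id)
  moreover have "vdm K (\<lambda>t. real (l t)) = vdm K real"
    unfolding vdm_def by (rule prod.cong) (auto simp: eq)
  ultimately show ?case by (simp add: vdm_of_nat eq id_def)
next
  case (Suc n w l)
  note perm = Suc.prems(1) and incr = Suc.prems(2) and incr' = Suc.prems(3)
    and low = Suc.prems(4) and l = Suc.prems(5)
  have bij: "bij w" using perm by (simp add: permutation)
  have wi: "w (inv w x) = x" for x using bij by (simp add: bij_def surj_f_inv_f)
  have iw: "inv w (w x) = x" for x using bij by (simp add: bij_def)
  \<comment> \<open>The removable boxes: the next smaller value stands on the other side of the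
    descent, so \<open>l t\<close> can be lowered.\<close>
  define C where "C = {t. t < K \<and> p + int K \<le> inv w (w (p + int t) - 1)}"
  have inj_l: "inj_on l {..<K}"
  proof (rule strict_mono_on_imp_inj_on, rule strict_mono_onI)
    fix a b assume "a \<in> {..<K}" "b \<in> {..<K}" "a < b"
    then show "l a < l b" using incr[of "p + int a" "p + int b"] l[of a] l[of b] by simp
  qed
  have desc: "left_desc w = (\<lambda>t. w (p + int t) - 1) ` C"
  proof (intro equalityI subsetI)
    fix k assume "k \<in> left_desc w"
    then have lt: "inv w (k + 1) < inv w k" by (simp add: left_desc_def)
    have y: "p + int K \<le> inv w k" using incr[OF lt] wi by force
    have x: "inv w (k + 1) < p + int K" using incr'[OF _ lt] wi by force
    have "p \<le> inv w (k + 1)"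
    proof (rule ccontr)
      assume "\<not> ?thesis"
      then have "inv w (k + 1) = k + 1" "k + 1 < p" using low[of "inv w (k + 1)"] wi by auto
      moreover have "inv w k = k" using low[of k] iw[of k] \<open>k + 1 < p\<close> by simp
      ultimately show False using lt by simp
    qed
    then obtain t where t: "inv w (k + 1) = p + int t" by (metis zle_iff_zadd)
    then have "w (p + int t) = k + 1" using wi by metis
    then show "k \<in> (\<lambda>t. w (p + int t) - 1) ` C"
      using x y t by (intro image_eqI[of _ _ t]) (auto simp: C_def)
  next
    fix k assume "k \<in> (\<lambda>t. w (p + int t) - 1) ` C"
    then obtain t where t: "k = w (p + int t) - 1" "t \<in> C" by blast
    then have "inv w (k + 1) = p + int t" by (simp add: iw)
    then show "k \<in> left_desc w" using t by (simp add: left_desc_def C_def)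
  qed
  have inj: "inj_on (\<lambda>t. w (p + int t) - 1) C"
    by (rule inj_onI) (metis add_left_cancel diff_add_cancel iw of_nat_eq_iff)
  let ?P = "\<Prod>t<K. fact (l t) :: real"
  let ?l = "\<lambda>t. real (l t)"
  have P: "?P \<noteq> 0" by simp
  have term_C: "nred n (adj (w (p + int t) - 1) \<circ> w) = fact n * (?l t * vdm K (?l(t := ?l t - 1))) / ?P"
    if t: "t \<in> C" for t
  proof -
    define k where "k = w (p + int t) - 1"
    define y where "y = inv w k"
    have tK: "t < K" and y: "p + int K \<le> y" using t by (auto simp: C_def k_def y_def)
    have wy: "w y = k" and wt: "w (p + int t) = k + 1" by (simp_all add: y_def wi k_def)
    have eqs: "w x = k \<longleftrightarrow> x = y" "w x = k + 1 \<longleftrightarrow> x = p + int t" for x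
      using wy wt iw by metis+
    have "l t \<noteq> 0"
    proof
      assume "l t = 0"
      then have "k = p - 1" using l[OF tK] by (simp add: k_def)
      then have "w (p - 1) = k" using low[of "p - 1"] by simp
      then show False using eqs(1) y by simp
    qed
    define l' where "l' = l(t := l t - 1)"
    have v: "(adj k \<circ> w) x = w x" if "x \<noteq> y" "x \<noteq> p + int t" for x
      using that eqs by (auto intro!: transpose_apply_other)
    have "nred n (adj k \<circ> w) = fact n * vdm K (\<lambda>t. real (l' t)) / (\<Prod>t<K. fact (l' t))"
    proof (rule Suc.IH)
      show "permutation (adj k \<circ> w)" using perm by (intro permutation_compose permutation_swap_id)
      show "(adj k \<circ> w) a < (adj k \<circ> w) b" if "a < b" "b < p + int K" for a b
        using incr[OF that] that y tK eqs[of a] eqs[of b] by (auto simp: adj_less_iff)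
      show "(adj k \<circ> w) a < (adj k \<circ> w) b" if "p + int K \<le> a" "a < b" for a b
        using incr'[OF that] that y tK eqs[of a] eqs[of b] by (auto simp: adj_less_iff)
      show "(adj k \<circ> w) x = x" if "x < p" for x
        using v[of x] low[OF that] that y by simp
      show "(adj k \<circ> w) (p + int a) = p + int (l' a)" if "a < K" for a
      proof (cases "a = t")
        case True
        then show ?thesis using wt l[OF tK] \<open>l t \<noteq> 0\<close> by (simp add: l'_def)
      next
        case False
        then show ?thesis using v[of "p + int a"] l[OF that] that y by (simp add: l'_def)
      qed
      have "(\<Sum>a<K. l a) = Suc (\<Sum>a<K. l' a)"
        using sum.remove[of "{..<K}" t l] sum.remove[of "{..<K}" t l'] tK \<open>l t \<noteq> 0\<close>
        by (simp add: l'_def)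
      then show "n + (K choose 2) = (\<Sum>a<K. l' a)" using Suc.prems(6) by simp
    qed
    moreover have "(\<lambda>t. real (l' t)) = ?l(t := ?l t - 1)"
      using \<open>l t \<noteq> 0\<close> by (auto simp: l'_def fun_eq_iff of_nat_diff)
    moreover have "?P = real (l t) * (\<Prod>t<K. fact (l' t))"
    proof -
      have "fact (l t) = real (l t) * fact (l t - 1)" using \<open>l t \<noteq> 0\<close> by (simp add: fact_reduce)
      then show ?thesis
        using prod.remove[of "{..<K}" t "\<lambda>t. fact (l t) :: real"] prod.remove[of "{..<K}" t "\<lambda>t. fact (l' t) :: real"] tK
        by (simp add: l'_def)
    qed
    ultimately show ?thesis using \<open>l t \<noteq> 0\<close> P unfolding k_def by (simp add: field_simps)
  qed
  \<comment> \<open>A box that cannot be removed contributes nothing: either \<open>l t = 0\<close>,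
    or lowering \<open>l t\<close> makes it collide with an earlier value and the Vandermonde
    product vanishes.\<close>
  have term_0: "?l t * vdm K (?l(t := ?l t - 1)) = 0" if t: "t < K" "t \<notin> C" for t
  proof (cases "l t = 0")
    case False
    define y where "y = inv w (w (p + int t) - 1)"
    have y: "y < p + int K" "w y = w (p + int t) - 1" using t by (auto simp: C_def y_def wi)
    have "\<not> p + int t < y" "y \<noteq> p + int t" using incr[of "p + int t" y] y by auto
    moreover have "\<not> y < p"
    proof
      assume "y < p"
      then have "y = p + int (l t) - 1" using low[of y] y l[OF t(1)] by simp
      then show False using \<open>y < p\<close> False by simp
    qed
    ultimately obtain a where a: "y = p + int a" "a < t" by (metis add_less_cancel_left linorder_neqE not_less of_nat_less_iff zle_iff_zadd)
    then have "real (l a) = real (l t) - 1" using y l[of a] l[OF t(1)] t(1) by simp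
    then have "vdm K (?l(t := ?l t - 1)) = 0"
      unfolding vdm_def prod_zero_iff[OF finite_pairs_less] using a t(1) by (intro bexI[of _ "(a, t)"]) auto
    then show ?thesis by simp
  qed simp
  have "nred (Suc n) w = (\<Sum>t\<in>C. fact n * (?l t * vdm K (?l(t := ?l t - 1))) / ?P)"
    by (simp only: nred.simps desc sum.reindex[OF inj] o_apply term_C cong: sum.cong)
  also have "\<dots> = (\<Sum>t<K. fact n * (?l t * vdm K (?l(t := ?l t - 1))) / ?P)"
    by (rule sum.mono_neutral_left) (auto simp: C_def term_0[unfolded C_def, simplified])
  also have "\<dots> = fact n * (\<Sum>t<K. ?l t * vdm K (?l(t := ?l t - 1))) / ?P"
    by (simp add: sum_distrib_left sum_divide_distrib)
  also have "(\<Sum>t<K. ?l t * vdm K (?l(t := ?l t - 1))) = ((\<Sum>t<K. ?l t) - real (K choose 2)) * vdm K ?l"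
    using inj_l by (intro sum_mult_vdm) (auto simp: inj_on_def)
  also have "(\<Sum>t<K. ?l t) - real (K choose 2) = real (Suc n)"
    using arg_cong[OF Suc.prems(6), of real] by simp
  finally show ?case by (simp add: mult_ac)
qed

subsection \<open>The reverse permutation\<close>

lemma vdm_cong: "(\<And>t. t < K \<Longrightarrow> l t = l' t) \<Longrightarrow> vdm K l = vdm K l'"
  unfolding vdm_def by (rule prod.cong) auto

text \<open>\<open>transition_chain\<close> needs a positive last entry. Trailing zeros are
  therefore stripped first; in the reversed list they reappear as leading zeros, which
  \<open>place\<close> absorbs.\<close>

lemma sort_code:
  assumes "permutation w" "avoids_2143 w" "code w = place p xs" "sorted (rev xs)"
  shows "\<exists>w' p'. permutation w' \<and> code w' = place p' (rev xs) \<and> (\<forall>n. nred n w' = nred n w)"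
  using assms
proof (induction xs rule: rev_induct)
  case Nil
  then show ?case by auto
next
  case (snoc x xs)
  show ?case
  proof (cases "x = 0")
    case True
    with snoc.prems have "code w = place p xs" "sorted (rev xs)" by (simp_all add: place_snoc_0)
    then obtain w' p' where "permutation w'" "code w' = place p' (rev xs)" "\<And>n. nred n w' = nred n w"
      using snoc by blast
    then show ?thesis using True place_Cons_0[of p' "rev xs"] by auto
  next
    case False
    have "sort (xs @ [x]) = rev (xs @ [x])"
      using snoc.prems(4) by (intro properties_for_sort) auto
    then show ?thesis
      using transition_chain[OF snoc.prems(1,2), of p "[]" xs x] snoc.prems False by simp
  qed
qed

lemma code_le_imp_less:
  assumes "permutation w" "code w a \<le> code w (a + 1)"
  shows "w a < w (a + 1)"
proof (rule ccontr)
  assume "\<not> w a < w (a + 1)"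
  moreover have "w a \<noteq> w (a + 1)"
    using assms(1) by (metis add_cancel_right_right bij_def inj_eq one_neq_zero permutation)
  ultimately have lt: "w (a + 1) < w a" by simp
  have "{j. a + 1 < j \<and> w j < w (a + 1)} \<subset> {j. a < j \<and> w j < w a}"
  proof
    show "{j. a + 1 < j \<and> w j < w (a + 1)} \<subseteq> {j. a < j \<and> w j < w a}" using lt by auto
    have "a + 1 \<in> {j. a < j \<and> w j < w a}" "a + 1 \<notin> {j. a + 1 < j \<and> w j < w (a + 1)}" using lt by auto
    then show "{j. a + 1 < j \<and> w j < w (a + 1)} \<noteq> {j. a < j \<and> w j < w a}" by metis
  qed
  then have "code w (a + 1) < code w a"
    unfolding code_def using finite_code_set[OF assms(1)] by (intro psubset_card_mono)
  then show False using assms(2) by simp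
qed

text \<open>Count the values from \<open>- B\<close> up to, but excluding, \<open>w a\<close>: they
  occupy all positions from \<open>- B\<close> to \<open>a - 1\<close> and the
  \<open>code w a\<close> later ones.\<close>

lemma value_eq_add_code:
  assumes "permutation w" "\<And>x. x < a \<Longrightarrow> w x < w a"
  shows "w a = a + int (code w a)"
proof -
  obtain B where B: "\<bar>a\<bar> + \<bar>w a\<bar> + 1 \<le> B" "\<And>x. B \<le> \<bar>x\<bar> \<Longrightarrow> w x = x"
    using permutation_bound[OF assms(1)] by blast
  have bij: "bij w" using assms(1) by (simp add: permutation)
  have "w ` {x. - B \<le> x \<and> w x < w a} = {- B..<w a}"
  proof (intro equalityI subsetI)
    fix y assume y: "y \<in> w ` {x. - B \<le> x \<and> w x < w a}"
    then obtain x where x: "y = w x" "- B \<le> x" "w x < w a" by blast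
    have "- B \<le> y"
    proof (rule ccontr)
      assume "\<not> - B \<le> y"
      then have "w y = y" using B by auto
      then have "y = x" using x(1) bij by (metis bij_def injD)
      then show False using \<open>\<not> - B \<le> y\<close> x by simp
    qed
    then show "y \<in> {- B..<w a}" using x by simp
  next
    fix y assume y: "y \<in> {- B..<w a}"
    obtain x where x: "w x = y" using bij by (metis bij_pointE)
    have "- B \<le> x"
    proof (rule ccontr)
      assume n: "\<not> - B \<le> x"
      then have "w x = x" using B by auto
      then show False using n x y by simp
    qed
    then show "y \<in> w ` {x. - B \<le> x \<and> w x < w a}" using x y by auto
  qed
  moreover have "inj_on w {x. - B \<le> x \<and> w x < w a}"
    using bij by (simp add: bij_def inj_on_def inj_def)
  ultimately have "card {x. - B \<le> x \<and> w x < w a} = card {- B..<w a}"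
    by (metis card_image)
  moreover have "{x. - B \<le> x \<and> w x < w a} = {- B..<a} \<union> {j. a < j \<and> w j < w a}"
  proof (intro equalityI subsetI)
    fix x assume "x \<in> {x. - B \<le> x \<and> w x < w a}"
    then show "x \<in> {- B..<a} \<union> {j. a < j \<and> w j < w a}" by (cases x a rule: linorder_cases) auto
  next
    fix x assume "x \<in> {- B..<a} \<union> {j. a < j \<and> w j < w a}"
    then show "x \<in> {x. - B \<le> x \<and> w x < w a}" using assms(2) B(1) by auto
  qed
  moreover have "card ({- B..<a} \<union> {j. a < j \<and> w j < w a}) = card {- B..<a} + code w a"
    unfolding code_def by (rule card_Un_disjoint) (auto simp: finite_code_set[OF assms(1)])
  ultimately show ?thesis using B(1) by simp
qed

text \<open>A weakly increasing code has no descent inside its block and none after it, so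
  \<open>w\<close> is Grassmannian; its entries in the block are left-to-right maxima and can be
  read off the code.\<close>

lemma nred_sorted_code:
  assumes perm: "permutation w" and code: "code w = place p ys" and ys: "sorted ys"
    and n: "n = sum_list ys"
  defines "K \<equiv> length ys" and "l \<equiv> \<lambda>t. t + ys ! t"
  shows "nred n w = fact n * vdm K (\<lambda>t. real (l t)) / (\<Prod>t<K. fact (l t))"
proof -
  have step: "w a < w (a + 1)" if "a + 1 < p + int K" for a
  proof (rule code_le_imp_less[OF perm])
    show "code w a \<le> code w (a + 1)"
      using that ys by (auto simp: code place_def K_def intro!: sorted_nth_mono)
  qed
  have run: "x + 1 + int m < p + int K \<Longrightarrow> w x < w (x + 1 + int m)" for x m
  proof (induction m)
    case 0
    then show ?case using step[of x] by simp
  next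
    case (Suc m)
    then show ?case using step[of "x + 1 + int m"] by (simp add: algebra_simps)
  qed
  have incr: "w x < w y" if "x < y" "y < p + int K" for x y
    using run[of x "nat (y - x - 1)"] that by simp
  have val: "w a = a + int (code w a)" if "a < p + int K" for a
    using perm incr[OF _ that] by (rule value_eq_add_code)
  show ?thesis
  proof (rule nred_grassmannian[OF perm, of p])
    show "w x < w y" if "p + int K \<le> x" "x < y" for x y
      using that by (intro code_eq_0_imp_less[OF perm]) (auto simp: code place_def K_def)
    show "w x = x" if "x < p" for x using val[of x] that by (simp add: code place_def)
    show "w (p + int t) = p + int (l t)" if "t < K" for t
      using val[of "p + int t"] that by (simp add: code place_def l_def K_def)
    have "(\<Sum>t<K. t) = K choose 2"
      by (simp add: lessThan_atLeast0 Sum_Ico_nat choose_two)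
    then show "n + (K choose 2) = (\<Sum>t<K. l t)"
      by (simp add: l_def sum.distrib n sum_list_sum_nth K_def lessThan_atLeast0)
  qed (rule incr)
qed

lemma nred_dominant:
  assumes "permutation w" "avoids_2143 w" "code w = place p (rev ys)" "sorted ys" "n = sum_list ys"
  shows "nred n w = fact n * vdm (length ys) (\<lambda>t. real (t + ys ! t)) / (\<Prod>t<length ys. fact (t + ys ! t))"
proof -
  obtain w' p' where "permutation w'" "code w' = place p' ys" "nred n w' = nred n w"
    using sort_code[OF assms(1-3)] assms(4) by auto
  then show ?thesis using nred_sorted_code[of w' p' ys n] assms(4,5) by simp
qed

section \<open>Staircase codes and the ratio of their counts\<close>

definition int_reverse :: "nat \<Rightarrow> int \<Rightarrow> int" where
  "int_reverse n x = (if x \<in> {1..int n} then int n + 1 - x else x)"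

lemma permutation_int_reverse: "permutation (int_reverse n)"
proof -
  have "int_reverse n \<circ> int_reverse n = id" by (auto simp: int_reverse_def fun_eq_iff)
  then have "bij (int_reverse n)" by (rule o_bij) fact
  moreover have "finite {x. int_reverse n x \<noteq> x}"
    by (rule finite_subset[of _ "{1..int n}"]) (auto simp: int_reverse_def)
  ultimately show ?thesis by (simp add: permutation)
qed

lemma sum_list_upt_1: "sum_list [1..<n] = n choose 2"
proof (induction n)
  case (Suc n)
  then show ?case by (cases n) (simp_all add: numeral_2_eq_2)
qed simp

lemma nred_int_reverse:
  "nred (n choose 2) (int_reverse n)
    = fact (n choose 2) * vdm (n - 1) (\<lambda>t. real (2 * t + 1)) / (\<Prod>t<n - 1. fact (2 * t + 1))"
proof -
  let ?w = "int_reverse n" and ?ys = "[1..<n]"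
  have "{j. a < j \<and> ?w j < ?w a} = (if a \<in> {1..int n} then {a<..int n} else {})" for a
    by (auto simp: int_reverse_def)
  then have "code ?w a = place 1 (rev ?ys) a" for a
    by (auto simp: code_def place_def rev_nth)
  then have code: "code ?w = place 1 (rev ?ys)" by blast
  have "avoids_2143 ?w" unfolding avoids_2143_def
    by (auto simp: int_reverse_def)
  moreover have "n choose 2 = sum_list ?ys"
    by (rule sum_list_upt_1[symmetric])
  ultimately have "nred (n choose 2) ?w = fact (n choose 2) * vdm (length ?ys) (\<lambda>t. real (t + ?ys ! t))
      / (\<Prod>t<length ?ys. fact (t + ?ys ! t))"
    by (intro nred_dominant[OF permutation_int_reverse _ code]) auto
  also have "vdm (length ?ys) (\<lambda>t. real (t + ?ys ! t)) = vdm (n - 1) (\<lambda>t. real (2 * t + 1))"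
    unfolding length_upt by (rule vdm_cong) simp
  also have "(\<Prod>t<length ?ys. fact (t + ?ys ! t) :: real) = (\<Prod>t<n - 1. fact (2 * t + 1))"
    by (intro prod.cong arg_cong[of _ _ fact]) auto
  finally show ?thesis .
qed

text \<open>The exchange creates a single ascent inside \<open>{1..int n}\<close> and lowers the
  code entry \<open>k\<close> to \<open>k - 1\<close>. The staircase loses a corner, and its shifted
  part of index \<open>k - 1\<close> drops from \<open>2 * k - 1\<close> to
  \<open>2 * (k - 1)\<close>.\<close>

lemma nred_adj_int_reverse:
  assumes k: "1 \<le> k" "k < n"
  shows "nred ((n choose 2) - 1) (adj (int k) \<circ> int_reverse n)
    = fact ((n choose 2) - 1) * vdm (n - 1) ((\<lambda>t. real (2 * t + 1))(k - 1 := real (2 * (k - 1))))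
      / (\<Prod>t<n - 1. fact (if t = k - 1 then 2 * t else 2 * t + 1))"
proof -
  let ?w = "adj (int k) \<circ> int_reverse n" and ?ys = "[1..<n][k - 1 := k - 1]"
  \<comment> \<open>The position of \<open>k + 1\<close> in the reverse permutation, hence of
    \<open>k\<close> after the exchange.\<close>
  define q where "q = int n - int k"
  have w: "?w x = (if x = q then int k else if x = q + 1 then int k + 1 else int_reverse n x)" for x
    using k by (auto simp: int_reverse_def q_def Transposition.transpose_def)
  have "{j. a < j \<and> ?w j < ?w a} = (if a \<in> {1..int n} then {(if a = q then q + 1 else a)<..int n} else {})" for a
  proof (cases "a = q")
    case True
    then show ?thesis unfolding w using k by (auto simp: int_reverse_def q_def)
  next
    case False
    then show ?thesis unfolding w using k by (auto simp: int_reverse_def q_def split: if_splits)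
  qed
  then have code': "code ?w a = (if a \<in> {1..int n} then nat (int n - (if a = q then q + 1 else a)) else 0)" for a
    unfolding code_def by simp
  have "code ?w a = place 1 (rev ?ys) a" for a
  proof (cases "a \<in> {1..<int n}")
    case True
    define b where "b = nat (a - 1)"
    have b: "a = 1 + int b" "b < n - 1" using True by (auto simp: b_def)
    have "rev ?ys ! b = ?ys ! (n - 2 - b)" using b by (simp add: rev_nth numeral_2_eq_2)
    also have "\<dots> = (if n - 2 - b = k - 1 then k - 1 else n - 1 - b)"
      using b k by (auto simp: nth_list_update)
    finally show ?thesis unfolding code' using b k by (auto simp: place_def q_def)
  next
    case False
    then show ?thesis unfolding code' using k by (auto simp: place_def q_def)
  qed
  then have code: "code ?w = place 1 (rev ?ys)" by blast
  have "avoids_2143 ?w" unfolding avoids_2143_def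
  proof (intro allI impI notI)
    fix a b c d
    assume lt: "a < b" "b < c" "c < d" and pat: "?w b < ?w a \<and> ?w a < ?w d \<and> ?w d < ?w c"
    have desc: "x \<in> {1..int n} \<and> y \<in> {1..int n}" if "x < y" "?w y < ?w x" for x y
      using that k unfolding w by (auto simp: int_reverse_def q_def split: if_splits)
    \<comment> \<open>In a 2143 pattern all four positions belong to descents, hence to
      \<open>{1..int n}\<close>, and its outer two form an ascent; but the only ascent there is
      between adjacent positions.\<close>
    have asc: "x = q \<and> y = q + 1" if "x < y" "?w x < ?w y" "x \<in> {1..int n}" "y \<in> {1..int n}" for x y
      using that k unfolding w by (auto simp: int_reverse_def q_def split: if_splits)
    show False using desc[of a b] desc[of c d] asc[of a d] lt pat by (simp del: o_apply)
  qed
  moreover have "sorted ?ys"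
    unfolding sorted_iff_nth_mono using k by (auto simp: nth_list_update)
  moreover have "(n choose 2) - 1 = sum_list ?ys"
    using k by (subst sum_list_update) (simp_all add: sum_list_upt_1[unfolded One_nat_def] del: sum_list_upt)
  moreover have "permutation ?w"
    by (intro permutation_compose permutation_swap_id permutation_int_reverse)
  ultimately have "nred ((n choose 2) - 1) ?w
      = fact ((n choose 2) - 1) * vdm (length ?ys) (\<lambda>t. real (t + ?ys ! t)) / (\<Prod>t<length ?ys. fact (t + ?ys ! t))"
    by (intro nred_dominant[OF _ _ code])
  also have "vdm (length ?ys) (\<lambda>t. real (t + ?ys ! t)) = vdm (n - 1) ((\<lambda>t. real (2 * t + 1))(k - 1 := real (2 * (k - 1))))"
    unfolding length_list_update length_upt by (rule vdm_cong) (use k in \<open>auto simp: nth_list_update\<close>)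
  also have "(\<Prod>t<length ?ys. fact (t + ?ys ! t) :: real) = (\<Prod>t<n - 1. fact (if t = k - 1 then 2 * t else 2 * t + 1))"
    by (intro prod.cong arg_cong[of _ _ fact]) (use k in \<open>auto simp: nth_list_update\<close>)
  finally show ?thesis .
qed


text \<open>The coefficient of \<open>x\<^sup>r\<close> in \<open>(1 - x)\<close> to the power \<open>-3/2\<close>.\<close>

definition half_binom :: "nat \<Rightarrow> real" where
  "half_binom r = pochhammer (3 / 2) r / fact r"

lemma half_binom_prod: "half_binom r = (\<Prod>i<r. (2 * real i + 3) / (2 * real i + 2))"
proof (induction r)
  case (Suc r)
  have "half_binom (Suc r) = half_binom r * ((3 / 2 + real r) / (real r + 1))"
    by (simp add: half_binom_def pochhammer_Suc add_ac)
  also have "(3 / 2 + real r) / (real r + 1) = (2 * real r + 3) / (2 * real r + 2)"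
    by (simp add: divide_simps)
  finally show ?case using Suc by simp
qed (simp add: half_binom_def)

lemma half_binom_prod': "half_binom r = (2 * real r + 1) * (\<Prod>i<r. (2 * real i + 1) / (2 * real i + 2))"
proof (induction r)
  case (Suc r)
  have "half_binom (Suc r) = half_binom r * ((2 * real r + 3) / (2 * real r + 2))"
    by (simp add: half_binom_prod)
  then show ?case using Suc by (simp add: field_simps)
qed (simp add: half_binom_def)

text \<open>An entry at distance \<open>2 * d\<close> from \<open>l t\<close> gets distance
  \<open>2 * d - 1\<close> if it is below and \<open>2 * d + 1\<close> if it is above. The upper
  factors form one \<open>half_binom\<close>; the lower ones need the prefactor
  \<open>2 * t + 1\<close>, in the shape of \<open>half_binom_prod'\<close>.\<close>

lemma vdm_odd_upd:
  assumes "t < K"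
  defines "l \<equiv> \<lambda>t. real (2 * t + 1)"
  shows "real (2 * t + 1) * vdm K (l(t := real (2 * t))) = vdm K l * half_binom t * half_binom (K - t - 1)"
proof -
  have "{..<K} - {t} = {..<t} \<union> {t<..<K}" using assms(1) by auto
  then have "(\<Prod>b\<in>{..<K} - {t}. (real (2 * t) - l b) / (l t - l b))
      = (\<Prod>b<t. (real (2 * t) - l b) / (l t - l b)) * (\<Prod>b\<in>{t<..<K}. (real (2 * t) - l b) / (l t - l b))"
    by (simp add: prod.union_disjoint disjoint_iff)
  also have "(\<Prod>b<t. (real (2 * t) - l b) / (l t - l b)) = (\<Prod>i<t. (2 * real i + 1) / (2 * real i + 2))"
    by (rule prod.reindex_bij_witness[of _ "\<lambda>i. t - 1 - i" "\<lambda>i. t - 1 - i"])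
      (auto simp: l_def of_nat_diff)
  also have "(\<Prod>b\<in>{t<..<K}. (real (2 * t) - l b) / (l t - l b)) = half_binom (K - t - 1)"
    unfolding half_binom_prod
    by (rule prod.reindex_bij_witness[of _ "\<lambda>i. t + 1 + i" "\<lambda>i. i - t - 1"])
      (auto simp: l_def of_nat_diff divide_simps, simp add: algebra_simps)
  finally have "vdm K (l(t := real (2 * t)))
      = vdm K l * ((\<Prod>i<t. (2 * real i + 1) / (2 * real i + 2)) * half_binom (K - t - 1))"
    using assms(1) by (subst vdm_upd) (auto simp: l_def inj_on_def)
  then show ?thesis by (simp add: half_binom_prod'[of t])
qed

text \<open>Also yields the existence of sorting networks, needed for the uniform
  distribution.\<close>

lemma nred_int_reverse_pos: "0 < nred (n choose 2) (int_reverse n)"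
proof -
  have "0 < vdm (n - 1) (\<lambda>t. real (2 * t + 1))"
    unfolding vdm_def by (rule prod_pos) auto
  then show ?thesis unfolding nred_int_reverse by (simp add: prod_pos)
qed

text \<open>The factor \<open>n choose 2\<close> absorbs the quotient of the leading factorials, and
  lowering one factorial in the denominator supplies the \<open>2 * (k - 1) + 1\<close> wanted by
  \<open>vdm_odd_upd\<close>. Once all times are known to be alike, this is the expected number of
  swaps at \<open>k\<close> in the full network.\<close>

lemma nred_adj_int_reverse_ratio:
  assumes k: "1 \<le> k" "k < n"
  shows "real (n choose 2) * nred ((n choose 2) - 1) (adj (int k) \<circ> int_reverse n)
    = nred (n choose 2) (int_reverse n) * half_binom (k - 1) * half_binom (n - k - 1)"
proof -
  let ?N = "n choose 2" and ?t = "k - 1" and ?l = "\<lambda>t. real (2 * t + 1)"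
  let ?P = "\<Prod>t<n - 1. fact (2 * t + 1) :: real"
  let ?P' = "\<Prod>t<n - 1. fact (if t = ?t then 2 * t else 2 * t + 1) :: real"
  have t: "?t < n - 1" using k by simp
  have P: "?P = real (2 * ?t + 1) * ?P'"
  proof -
    have "?P = fact (2 * ?t + 1) * (\<Prod>t\<in>{..<n - 1} - {?t}. fact (2 * t + 1))"
      using t by (subst prod.remove[of _ ?t]) auto
    also have "(\<Prod>t\<in>{..<n - 1} - {?t}. fact (2 * t + 1) :: real)
        = (\<Prod>t\<in>{..<n - 1} - {?t}. fact (if t = ?t then 2 * t else 2 * t + 1))"
      by (rule prod.cong) auto
    also have "fact (2 * ?t + 1) * \<dots> = real (2 * ?t + 1) * ?P'"
      using t by (subst (2) prod.remove[of _ ?t]) (auto simp: fact_reduce)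
    finally show ?thesis .
  qed
  have cancel: "c \<noteq> 0 \<Longrightarrow> a * v / p = a * (c * v) / (c * p)" for a c v p :: real by simp
  have "0 < ?N" using k by simp
  then have N: "real ?N * fact (?N - 1) = fact ?N" by (simp add: fact_reduce)
  have "real ?N * nred (?N - 1) (adj (int k) \<circ> int_reverse n)
      = fact ?N * vdm (n - 1) (?l(?t := real (2 * ?t))) / ?P'"
    unfolding nred_adj_int_reverse[OF k] N[symmetric] by simp
  also have "\<dots> = fact ?N * (real (2 * ?t + 1) * vdm (n - 1) (?l(?t := real (2 * ?t)))) / ?P"
    unfolding P by (rule cancel) simp
  also have "real (2 * ?t + 1) * vdm (n - 1) (?l(?t := real (2 * ?t)))
      = vdm (n - 1) ?l * half_binom ?t * half_binom (n - 1 - ?t - 1)"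
    using t by (rule vdm_odd_upd)
  also have "n - 1 - ?t - 1 = n - k - 1" using k by simp
  finally show ?thesis unfolding nred_int_reverse by (simp only: mult.assoc times_divide_eq_left)
qed

subsection \<open>Sorting networks as reduced words\<close>

definition word_perm :: "nat list \<Rightarrow> nat \<Rightarrow> nat" where
  "word_perm \<omega> = foldr (\<lambda>s \<sigma>. adj_swap s \<circ> \<sigma>) \<omega> id"

lemma config_eq_word_perm: "config \<omega> t = word_perm (take t \<omega>)"
  by (simp add: config_def word_perm_def)

lemma word_perm_Nil [simp]: "word_perm [] = id"
  and word_perm_Cons: "word_perm (s # \<omega>) = adj_swap s \<circ> word_perm \<omega>"
  by (simp_all add: word_perm_def)

lemma word_perm_append: "word_perm (u @ v) = word_perm u \<circ> word_perm v"
  by (induction u) (simp_all add: word_perm_Cons o_assoc)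

lemma word_perm_snoc: "word_perm (\<omega> @ [s]) = word_perm \<omega> \<circ> adj_swap s"
  by (simp add: word_perm_append word_perm_Cons)

lemma adj_swap_adj_swap [simp]: "adj_swap s \<circ> adj_swap s = id"
  by (simp add: adj_swap_def)

lemma adj_swap_permutes: "s \<in> {1..n - 1} \<Longrightarrow> adj_swap s permutes {1..n}"
  unfolding adj_swap_def by (rule permutes_swap_id) auto

lemma word_perm_permutes: "set \<omega> \<subseteq> {1..n - 1} \<Longrightarrow> word_perm \<omega> permutes {1..n}"
proof (induction \<omega>)
  case Nil
  show ?case unfolding word_perm_Nil by (rule permutes_id)
next
  case (Cons s \<omega>)
  then show ?case
    unfolding word_perm_Cons by (intro permutes_compose adj_swap_permutes) auto
qed

lemma bij_word_perm: "bij (word_perm \<omega>)"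
proof (induction \<omega>)
  case Nil
  then show ?case unfolding word_perm_Nil by (rule bij_id)
next
  case (Cons s \<omega>)
  then show ?case unfolding word_perm_Cons by (rule bij_comp) (simp add: adj_swap_def)
qed

section \<open>Inversions and reduced words\<close>

definition value_invs :: "(nat \<Rightarrow> nat) \<Rightarrow> (nat \<times> nat) set" where
  "value_invs \<sigma> = {(a, b). a < b \<and> inv \<sigma> b < inv \<sigma> a}"

text \<open>Inversions are recorded by particles instead of positions, so a swap leaves all pairs
  alone except the one it exchanges, and the sets grow along a network.\<close>

lemma value_invs_asc:
  assumes bij: "bij \<sigma>" and asc: "\<sigma> s < \<sigma> (Suc s)"
  shows "value_invs (\<sigma> \<circ> adj_swap s) = insert (\<sigma> s, \<sigma> (Suc s)) (value_invs \<sigma>)"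
    and "(\<sigma> s, \<sigma> (Suc s)) \<notin> value_invs \<sigma>"
proof -
  have iv: "inv \<sigma> (\<sigma> x) = x" for x using bij by (simp add: bij_def)
  have vi: "\<sigma> (inv \<sigma> x) = x" for x using bij by (simp add: bij_def surj_f_inv_f)
  show "(\<sigma> s, \<sigma> (Suc s)) \<notin> value_invs \<sigma>" by (simp add: value_invs_def iv)
  have inv: "inv (\<sigma> \<circ> adj_swap s) = adj_swap s \<circ> inv \<sigma>"
    using bij by (simp add: adj_swap_def o_inv_distrib)
  have less: "adj_swap s x < adj_swap s y \<longleftrightarrow> (if x = s \<and> y = Suc s then False else if x = Suc s \<and> y = s then True else x < y)"
    for x y by (auto simp: adj_swap_def Transposition.transpose_def)
  have "(a, b) \<in> value_invs (\<sigma> \<circ> adj_swap s) \<longleftrightarrow> (a, b) \<in> insert (\<sigma> s, \<sigma> (Suc s)) (value_invs \<sigma>)" for a b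
  proof -
    obtain x y where xy: "a = \<sigma> x" "b = \<sigma> y" using vi by metis
    have "\<sigma> x = \<sigma> z \<longleftrightarrow> x = z" "\<sigma> y = \<sigma> z \<longleftrightarrow> y = z" for z using iv by metis+
    then show ?thesis using asc by (auto simp: value_invs_def inv xy iv less)
  qed
  then show "value_invs (\<sigma> \<circ> adj_swap s) = insert (\<sigma> s, \<sigma> (Suc s)) (value_invs \<sigma>)" by auto
qed

lemma value_invs_subset:
  assumes "\<sigma> permutes {1..n}"
  shows "value_invs \<sigma> \<subseteq> {(a, b). 1 \<le> a \<and> a < b \<and> b \<le> n}"
proof safe
  fix a b assume ab: "(a, b) \<in> value_invs \<sigma>"
  then show "a < b" by (simp add: value_invs_def)
  have p: "inv \<sigma> permutes {1..n}" using assms by (rule permutes_inv)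
  show "1 \<le> a"
  proof (rule ccontr)
    assume "\<not> 1 \<le> a"
    then have "inv \<sigma> a = a" "a = 0" using p by (auto simp: permutes_def)
    then show False using ab by (simp add: value_invs_def)
  qed
  show "b \<le> n"
  proof (rule ccontr)
    assume n: "\<not> b \<le> n"
    then have b: "inv \<sigma> b = b" using p by (auto simp: permutes_def)
    then have "b < inv \<sigma> a" using ab by (simp add: value_invs_def)
    then have "inv \<sigma> a \<notin> {1..n}" using n by auto
    then have "a \<notin> {1..n}" using permutes_in_image[OF p] by blast
    then have "inv \<sigma> a = a" using p by (auto simp: permutes_def)
    then show False using ab b by (auto simp: value_invs_def)
  qed
qed

lemma finite_pairs: "finite {(a, b). 1 \<le> a \<and> a < b \<and> b \<le> (n :: nat)}"
  by (rule finite_subset[of _ "{..n} \<times> {..n}"]) auto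

lemma card_pairs: "card {(a, b). 1 \<le> a \<and> a < b \<and> b \<le> n} = n choose 2"
proof (induction n)
  case 0
  have "{(a, b). 1 \<le> a \<and> a < b \<and> b \<le> (0 :: nat)} = {}" by auto
  then show ?case by (metis binomial_eq_0_iff card.empty pos2)
next
  case (Suc n)
  have "(a, b) \<in> {(a, b). 1 \<le> a \<and> a < b \<and> b \<le> Suc n}
      \<longleftrightarrow> (a, b) \<in> {(a, b). 1 \<le> a \<and> a < b \<and> b \<le> n} \<union> (\<lambda>a. (a, Suc n)) ` {1..n}" for a b
    by (cases "b = Suc n") auto
  then have "{(a, b). 1 \<le> a \<and> a < b \<and> b \<le> Suc n}
      = {(a, b). 1 \<le> a \<and> a < b \<and> b \<le> n} \<union> (\<lambda>a. (a, Suc n)) ` {1..n}"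
    by (simp add: set_eq_iff del: insert_iff)
  moreover have "{(a, b). 1 \<le> a \<and> a < b \<and> b \<le> n} \<inter> (\<lambda>a. (a, Suc n)) ` {1..n} = {}" by auto
  ultimately have "card {(a, b). 1 \<le> a \<and> a < b \<and> b \<le> Suc n}
      = card {(a, b). 1 \<le> a \<and> a < b \<and> b \<le> n} + card ((\<lambda>a. (a, Suc n)) ` {1..n})"
    using finite_pairs by (simp add: card_Un_disjoint)
  then show ?case using Suc by (simp add: card_image inj_on_def numeral_2_eq_2)
qed

lemma finite_value_invs: "\<sigma> permutes {1..n} \<Longrightarrow> finite (value_invs \<sigma>)"
  by (rule finite_subset[OF value_invs_subset finite_pairs])

lemma value_invs_id: "value_invs id = {}"
  by (auto simp: value_invs_def simp flip: id_def)

lemma card_value_invs_asc: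
  assumes "\<sigma> permutes {1..n}" "\<sigma> s < \<sigma> (Suc s)"
  shows "card (value_invs (\<sigma> \<circ> adj_swap s)) = Suc (card (value_invs \<sigma>))"
  using value_invs_asc[OF permutes_bij[OF assms(1)] assms(2)] finite_value_invs[OF assms(1)] by simp

lemma card_value_invs_desc:
  assumes "\<sigma> permutes {1..n}" "\<sigma> (Suc s) < \<sigma> s" "s \<in> {1..n - 1}"
  shows "card (value_invs \<sigma>) = Suc (card (value_invs (\<sigma> \<circ> adj_swap s)))"
proof -
  have "\<sigma> \<circ> adj_swap s permutes {1..n}"
    using adj_swap_permutes assms by (intro permutes_compose) auto
  from card_value_invs_asc[OF this, of s] show ?thesis
    using assms(2) by (simp add: o_assoc[symmetric]) (simp add: adj_swap_def)
qed

lemma card_value_invs_le: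
  "set \<omega> \<subseteq> {1..n - 1} \<Longrightarrow> card (value_invs (word_perm \<omega>)) \<le> length \<omega>"
proof (induction \<omega> rule: rev_induct)
  case Nil
  then show ?case unfolding word_perm_Nil value_invs_id by simp
next
  case (snoc s \<omega>)
  let ?\<sigma> = "word_perm \<omega>"
  have p: "?\<sigma> permutes {1..n}" using snoc.prems by (intro word_perm_permutes) auto
  have "?\<sigma> s \<noteq> ?\<sigma> (Suc s)" using bij_word_perm by (metis bij_def injD n_not_Suc_n)
  then have "card (value_invs (?\<sigma> \<circ> adj_swap s)) \<le> Suc (card (value_invs ?\<sigma>))"
    using card_value_invs_asc[OF p, of s] card_value_invs_desc[OF p, of s] snoc.prems
    by (cases "?\<sigma> s < ?\<sigma> (Suc s)") auto
  then show ?case using snoc by (simp add: word_perm_snoc del: o_apply)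
qed

text \<open>A descending last swap would lose an inversion, although the letters before it create at
  most \<open>length \<omega>\<close> of them.\<close>

lemma reduced_snoc:
  assumes "set (\<omega> @ [s]) \<subseteq> {1..n - 1}"
    and "card (value_invs (word_perm (\<omega> @ [s]))) = length (\<omega> @ [s])"
  shows "card (value_invs (word_perm \<omega>)) = length \<omega>" "word_perm \<omega> s < word_perm \<omega> (Suc s)"
proof -
  let ?\<sigma> = "word_perm \<omega>"
  have p: "?\<sigma> permutes {1..n}" using assms by (intro word_perm_permutes) auto
  have le: "card (value_invs ?\<sigma>) \<le> length \<omega>" using assms by (intro card_value_invs_le) auto
  show asc: "?\<sigma> s < ?\<sigma> (Suc s)"
  proof (rule ccontr)
    assume "\<not> ?\<sigma> s < ?\<sigma> (Suc s)"
    moreover have "?\<sigma> s \<noteq> ?\<sigma> (Suc s)" using bij_word_perm by (metis bij_def injD n_not_Suc_n)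
    ultimately have "?\<sigma> (Suc s) < ?\<sigma> s" by simp
    from card_value_invs_desc[OF p this] le assms show False by (simp add: word_perm_snoc)
  qed
  show "card (value_invs ?\<sigma>) = length \<omega>"
    using card_value_invs_asc[OF p asc] assms by (simp add: word_perm_snoc)
qed

lemma reduced_take:
  assumes "set \<omega> \<subseteq> {1..n - 1}" "card (value_invs (word_perm \<omega>)) = length \<omega>" "t < length \<omega>"
  shows "word_perm (take t \<omega>) (\<omega> ! t) < word_perm (take t \<omega>) (Suc (\<omega> ! t))"
  using assms
proof (induction \<omega> rule: rev_induct)
  case (snoc s \<omega>)
  note r = reduced_snoc[OF snoc.prems(1,2)]
  show ?case
  proof (cases "t = length \<omega>")
    case False
    then show ?thesis using snoc r(1) by (simp add: nth_append)
  qed (use r in simp)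
qed simp

section \<open>Counting words with a prescribed product\<close>

definition words :: "nat \<Rightarrow> nat \<Rightarrow> (nat \<Rightarrow> nat) \<Rightarrow> nat list set" where
  "words n N \<pi> = {\<omega>. length \<omega> = N \<and> set \<omega> \<subseteq> {1..n - 1} \<and> word_perm \<omega> = \<pi>}"

lemma finite_words: "finite (words n N \<pi>)"
  by (rule finite_subset[OF _ finite_lists_length_eq[of "{1..n - 1}" N]]) (auto simp: words_def)

lemma words_Suc: "words n (Suc N) \<pi> = (\<Union>s\<in>{1..n - 1}. (\<lambda>\<omega>. \<omega> @ [s]) ` words n N (\<pi> \<circ> adj_swap s))"
proof (intro equalityI subsetI)
  fix \<omega> assume w: "\<omega> \<in> words n (Suc N) \<pi>"
  then obtain \<omega>' s where \<omega>: "\<omega> = \<omega>' @ [s]" by (cases \<omega> rule: rev_cases) (auto simp: words_def)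
  have "word_perm \<omega>' = \<pi> \<circ> adj_swap s"
    using w by (auto simp: words_def \<omega> word_perm_snoc o_assoc[symmetric])
  then show "\<omega> \<in> (\<Union>s\<in>{1..n - 1}. (\<lambda>\<omega>. \<omega> @ [s]) ` words n N (\<pi> \<circ> adj_swap s))"
    using w by (auto simp: words_def \<omega>)
next
  fix \<omega> assume "\<omega> \<in> (\<Union>s\<in>{1..n - 1}. (\<lambda>\<omega>. \<omega> @ [s]) ` words n N (\<pi> \<circ> adj_swap s))"
  then show "\<omega> \<in> words n (Suc N) \<pi>"
    by (auto simp: words_def word_perm_snoc o_assoc[symmetric])
qed

text \<open>Moves permutations to the integers, where \<open>nred\<close> lives; it respects
  composition and inverses.\<close>

definition lift_int :: "(nat \<Rightarrow> nat) \<Rightarrow> int \<Rightarrow> int" where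
  "lift_int \<sigma> x = (if 0 \<le> x then int (\<sigma> (nat x)) else x)"

lemma lift_int_comp: "lift_int (\<sigma> \<circ> \<tau>) = lift_int \<sigma> \<circ> lift_int \<tau>"
  by (auto simp: lift_int_def fun_eq_iff)

lemma lift_int_id: "lift_int id = id"
  by (auto simp: lift_int_def fun_eq_iff)

lemma lift_int_eq_id_iff: "lift_int \<sigma> = id \<longleftrightarrow> \<sigma> = id"
proof
  assume "lift_int \<sigma> = id"
  then have "int (\<sigma> x) = int x" for x by (metis id_apply lift_int_def nat_int of_nat_0_le_iff)
  then show "\<sigma> = id" by auto
qed (simp add: lift_int_id)

lemma inv_lift_int:
  assumes "bij \<sigma>"
  shows "inv (lift_int \<sigma>) = lift_int (inv \<sigma>)"
proof (rule inv_unique_comp)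
  have "\<sigma> \<circ> inv \<sigma> = id" "inv \<sigma> \<circ> \<sigma> = id" using assms by (auto simp: bij_def surj_iff)
  then show "lift_int \<sigma> \<circ> lift_int (inv \<sigma>) = id" "lift_int (inv \<sigma>) \<circ> lift_int \<sigma> = id"
    by (simp_all add: lift_int_comp[symmetric] lift_int_id)
qed

lemma lift_int_adj_swap: "lift_int (adj_swap k) = adj (int k)"
  by (auto simp: lift_int_def adj_swap_def Transposition.transpose_def fun_eq_iff)

lemma left_desc_lift_int:
  assumes "\<pi> permutes {1..n}"
  shows "left_desc (lift_int (inv \<pi>)) = int ` {s \<in> {1..n - 1}. \<pi> (Suc s) < \<pi> s}"
proof -
  have "inv (lift_int (inv \<pi>)) = lift_int \<pi>"
    using permutes_bij[OF assms] by (simp add: inv_lift_int bij_imp_bij_inv inv_inv_eq)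
  then have k: "k \<in> left_desc (lift_int (inv \<pi>)) \<longleftrightarrow> lift_int \<pi> (k + 1) < lift_int \<pi> k" for k
    by (simp add: left_desc_def)
  have fixed: "\<pi> x = x" if "x = 0 \<or> n < x" for x using that assms by (auto simp: permutes_def)
  show ?thesis
  proof (intro equalityI subsetI)
    fix k assume "k \<in> left_desc (lift_int (inv \<pi>))"
    then have lt: "lift_int \<pi> (k + 1) < lift_int \<pi> k" by (simp add: k)
    have "0 \<le> k"
    proof (rule ccontr)
      assume "\<not> 0 \<le> k"
      then show False using lt fixed[of 0] by (cases "k = - 1") (auto simp: lift_int_def)
    qed
    then obtain s where s: "k = int s" by (metis zero_le_imp_eq_int)
    then have desc: "\<pi> (Suc s) < \<pi> s" using lt by (simp add: lift_int_def nat_add_distrib)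
    have "s \<noteq> 0" using desc fixed[of 0] by (metis not_less0)
    moreover have "s < n"
    proof (rule ccontr)
      assume "\<not> s < n"
      then have "\<pi> (Suc s) = Suc s" using fixed by auto
      then have "\<pi> s \<notin> {1..n}" using desc \<open>\<not> s < n\<close> by auto
      then have "\<pi> s = s" using permutes_in_image[OF assms, of s] assms by (auto simp: permutes_def)
      then show False using desc \<open>\<pi> (Suc s) = Suc s\<close> by simp
    qed
    ultimately show "k \<in> int ` {s \<in> {1..n - 1}. \<pi> (Suc s) < \<pi> s}" using desc s by auto
  next
    fix k assume "k \<in> int ` {s \<in> {1..n - 1}. \<pi> (Suc s) < \<pi> s}"
    then show "k \<in> left_desc (lift_int (inv \<pi>))" by (auto simp: k lift_int_def nat_add_distrib)
  qed
qed

text \<open>Words are peeled off from the right while \<^const>\<open>nred\<close> removes letters on the left, hence the inverse.\<close>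

lemma card_words:
  assumes "\<pi> permutes {1..n}" "card (value_invs \<pi>) = N"
  shows "real (card (words n N \<pi>)) = nred N (lift_int (inv \<pi>))"
  using assms
proof (induction N arbitrary: \<pi>)
  case 0
  have "words n 0 \<pi> = (if \<pi> = id then {[]} else {})" by (auto simp: words_def)
  moreover have "inv \<pi> = id \<longleftrightarrow> \<pi> = id"
    using permutes_bij[OF 0(1)] by (metis inv_id inv_inv_eq)
  ultimately show ?case by (simp add: lift_int_eq_id_iff)
next
  case (Suc N)
  let ?D = "{s \<in> {1..n - 1}. \<pi> (Suc s) < \<pi> s}"
  have p: "\<pi> \<circ> adj_swap s permutes {1..n}" if "s \<in> {1..n - 1}" for s
    using that Suc.prems(1) by (intro permutes_compose adj_swap_permutes)
  \<comment> \<open>If \<open>s\<close> is an ascent, \<open>\<pi> \<circ> adj_swap s\<close> has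
    \<open>N + 2\<close> inversions, too many for \<open>N\<close> letters.\<close>
  have empty: "words n N (\<pi> \<circ> adj_swap s) = {}" if "s \<in> {1..n - 1} - ?D" for s
  proof (rule ccontr)
    assume "words n N (\<pi> \<circ> adj_swap s) \<noteq> {}"
    then obtain \<omega> where \<omega>: "length \<omega> = N" "set \<omega> \<subseteq> {1..n - 1}" "word_perm \<omega> = \<pi> \<circ> adj_swap s"
      by (auto simp: words_def)
    have "\<pi> s \<noteq> \<pi> (Suc s)" using permutes_inj[OF Suc.prems(1)] by (metis injD n_not_Suc_n)
    then have "\<pi> s < \<pi> (Suc s)" using that by auto
    from card_value_invs_asc[OF Suc.prems(1) this] card_value_invs_le[OF \<omega>(2)] \<omega> Suc.prems(2)
    show False by simp
  qed
  have "card (words n (Suc N) \<pi>) = (\<Sum>s\<in>{1..n - 1}. card ((\<lambda>\<omega>. \<omega> @ [s]) ` words n N (\<pi> \<circ> adj_swap s)))"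
    unfolding words_Suc by (rule card_UN_disjoint) (auto simp: finite_words)
  also have "\<dots> = (\<Sum>s\<in>{1..n - 1}. card (words n N (\<pi> \<circ> adj_swap s)))"
    by (simp add: card_image inj_on_def)
  also have "\<dots> = (\<Sum>s\<in>?D. card (words n N (\<pi> \<circ> adj_swap s)))"
    by (rule sum.mono_neutral_right) (auto simp: empty)
  finally have "real (card (words n (Suc N) \<pi>)) = (\<Sum>s\<in>?D. real (card (words n N (\<pi> \<circ> adj_swap s))))"
    by simp
  also have "\<dots> = (\<Sum>s\<in>?D. nred N (adj (int s) \<circ> lift_int (inv \<pi>)))"
  proof (rule sum.cong)
    fix s assume s: "s \<in> ?D"
    have "inv (\<pi> \<circ> adj_swap s) = adj_swap s \<circ> inv \<pi>"
      using permutes_bij[OF Suc.prems(1)] by (simp add: adj_swap_def o_inv_distrib)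
    moreover have "card (value_invs (\<pi> \<circ> adj_swap s)) = N"
      using card_value_invs_desc[OF Suc.prems(1), of s] s Suc.prems(2) by simp
    ultimately show "real (card (words n N (\<pi> \<circ> adj_swap s))) = nred N (adj (int s) \<circ> lift_int (inv \<pi>))"
      using Suc.IH[OF p, of s] s lift_int_comp[of "adj_swap s" "inv \<pi>"] lift_int_adj_swap[of s]
      by (simp del: o_apply)
  qed simp
  also have "\<dots> = nred (Suc N) (lift_int (inv \<pi>))"
    by (simp add: left_desc_lift_int[OF Suc.prems(1)] sum.reindex)
  finally show ?case .
qed


lemma reverse_perm_permutes: "reverse_perm n permutes {1..n}"
proof -
  have "bij_betw (reverse_perm n) {1..n} {1..n}"
    by (rule bij_betw_byWitness[where f' = "reverse_perm n"]) (auto simp: reverse_perm_def)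
  then show ?thesis by (rule bij_imp_permutes) (auto simp: reverse_perm_def)
qed

lemma inv_reverse_perm: "inv (reverse_perm n) = reverse_perm n"
  by (rule inv_unique_comp) (auto simp: reverse_perm_def fun_eq_iff)

lemma lift_int_reverse_perm: "lift_int (reverse_perm n) = int_reverse n"
  by (auto simp: lift_int_def reverse_perm_def int_reverse_def fun_eq_iff)

lemma card_value_invs_reverse_perm: "card (value_invs (reverse_perm n)) = n choose 2"
proof -
  have "(a, b) \<in> value_invs (reverse_perm n)" if "1 \<le> a" "a < b" "b \<le> n" for a b
    using that by (simp add: value_invs_def inv_reverse_perm) (simp add: reverse_perm_def)
  then have "{(a, b). 1 \<le> a \<and> a < b \<and> b \<le> n} \<subseteq> value_invs (reverse_perm n)" by blast
  then have "value_invs (reverse_perm n) = {(a, b). 1 \<le> a \<and> a < b \<and> b \<le> n}"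
    by (intro subset_antisym value_invs_subset reverse_perm_permutes)
  then show ?thesis by (simp only: card_pairs)
qed

lemma sorting_networks_eq_words: "sorting_networks n = words n (n choose 2) (reverse_perm n)"
  by (auto simp: sorting_networks_def words_def config_eq_word_perm)

lemma card_sorting_networks: "real (card (sorting_networks n)) = nred (n choose 2) (int_reverse n)"
  unfolding sorting_networks_eq_words
  using card_words[OF reverse_perm_permutes card_value_invs_reverse_perm]
  by (simp add: inv_reverse_perm lift_int_reverse_perm)

lemma card_sorting_networks_pos: "0 < card (sorting_networks n)"
  using nred_int_reverse_pos[of n] by (simp flip: card_sorting_networks)

lemma finite_sorting_networks: "finite (sorting_networks n)"
  unfolding sorting_networks_eq_words by (rule finite_words)

text \<open>Removing the last letter leaves the words of
  \<open>reverse_perm n \<circ> adj_swap k\<close>. The inverse in \<open>card_words\<close>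
  reverses this product, and both factors are involutions.\<close>

lemma card_sorting_networks_last:
  assumes k: "1 \<le> k" "k < n"
  shows "real (card {\<omega> \<in> sorting_networks n. \<omega> ! ((n choose 2) - 1) = k})
    = nred ((n choose 2) - 1) (adj (int k) \<circ> int_reverse n)"
proof -
  let ?N = "n choose 2" and ?\<pi> = "reverse_perm n \<circ> adj_swap k"
  have k': "k \<in> {1..n - 1}" using k by auto
  have N: "?N = Suc (?N - 1)" using k by simp
  have "{\<omega> \<in> sorting_networks n. \<omega> ! (?N - 1) = k} = (\<lambda>\<omega>. \<omega> @ [k]) ` words n (?N - 1) ?\<pi>"
  proof (intro equalityI subsetI)
    fix \<omega> assume w: "\<omega> \<in> {\<omega> \<in> sorting_networks n. \<omega> ! (?N - 1) = k}"
    then have "\<omega> \<in> words n (Suc (?N - 1)) (reverse_perm n)" using N sorting_networks_eq_words by auto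
    then obtain s \<omega>' where "\<omega> = \<omega>' @ [s]" "\<omega>' \<in> words n (?N - 1) (reverse_perm n \<circ> adj_swap s)"
      unfolding words_Suc by blast
    moreover then have "s = k" using w by (auto simp: words_def nth_append)
    ultimately show "\<omega> \<in> (\<lambda>\<omega>. \<omega> @ [k]) ` words n (?N - 1) ?\<pi>" by blast
  next
    fix \<omega> assume "\<omega> \<in> (\<lambda>\<omega>. \<omega> @ [k]) ` words n (?N - 1) ?\<pi>"
    then obtain \<omega>' where w: "\<omega> = \<omega>' @ [k]" "\<omega>' \<in> words n (?N - 1) ?\<pi>" by blast
    then have "\<omega> \<in> words n (Suc (?N - 1)) (reverse_perm n)" unfolding words_Suc using k' by blast
    then show "\<omega> \<in> {\<omega> \<in> sorting_networks n. \<omega> ! (?N - 1) = k}"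
      using w N by (auto simp: sorting_networks_eq_words words_def nth_append)
  qed
  then have "card {\<omega> \<in> sorting_networks n. \<omega> ! (?N - 1) = k} = card (words n (?N - 1) ?\<pi>)"
    by (simp add: card_image inj_on_def)
  moreover have "?\<pi> permutes {1..n}"
    using reverse_perm_permutes adj_swap_permutes[OF k'] by (intro permutes_compose)
  moreover have "card (value_invs ?\<pi>) = ?N - 1"
  proof -
    have "reverse_perm n (Suc k) < reverse_perm n k" using k by (auto simp: reverse_perm_def)
    from card_value_invs_desc[OF reverse_perm_permutes this k'] show ?thesis
      by (simp add: card_value_invs_reverse_perm del: o_apply)
  qed
  moreover have "inv ?\<pi> = adj_swap k \<circ> reverse_perm n"
    using permutes_bij[OF reverse_perm_permutes[of n]]
    by (simp add: adj_swap_def o_inv_distrib inv_reverse_perm)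
  ultimately show ?thesis
    using card_words[of ?\<pi> n "?N - 1"] lift_int_comp[of "adj_swap k" "reverse_perm n"]
    by (simp add: lift_int_adj_swap lift_int_reverse_perm del: o_apply)
qed

section \<open>Rotation symmetry of sorting networks\<close>

definition rotate_network :: "nat \<Rightarrow> nat list \<Rightarrow> nat list" where
  "rotate_network n \<omega> = tl \<omega> @ [n - hd \<omega>]"

text \<open>Conjugation by the reverse permutation turns \<open>adj_swap s\<close> into
  \<open>adj_swap (n - s)\<close>, so a letter taken from the front may be appended in reflected
  form.\<close>

lemma rotate_network_in:
  assumes n: "2 \<le> n" and w: "\<omega> \<in> sorting_networks n"
  shows "rotate_network n \<omega> \<in> sorting_networks n"
proof -
  have "0 < n choose 2" using n by simp
  then obtain s \<omega>' where \<omega>: "\<omega> = s # \<omega>'" using w by (cases \<omega>) (auto simp: sorting_networks_def)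
  have s: "1 \<le> s" "s < n" using w n by (auto simp: sorting_networks_def \<omega>)
  have "adj_swap s \<circ> (adj_swap s \<circ> word_perm \<omega>') = adj_swap s \<circ> reverse_perm n"
    using w by (simp add: sorting_networks_eq_words words_def \<omega> word_perm_Cons del: o_apply)
  then have "word_perm \<omega>' = adj_swap s \<circ> reverse_perm n"
    by (simp add: o_assoc del: o_apply)
  moreover have "adj_swap s \<circ> reverse_perm n \<circ> adj_swap (n - s) = reverse_perm n"
  proof
    fix x
    consider "x = n - s" | "x = Suc (n - s)" | "x \<noteq> n - s" "x \<noteq> Suc (n - s)" by blast
    then show "(adj_swap s \<circ> reverse_perm n \<circ> adj_swap (n - s)) x = reverse_perm n x"
      using s by cases (auto simp: adj_swap_def reverse_perm_def Transposition.transpose_def)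
  qed
  ultimately show ?thesis
    using w s by (auto simp: sorting_networks_eq_words words_def \<omega> rotate_network_def word_perm_snoc)
qed

text \<open>Rotation is an injective self-map of a finite set, hence bijective, and moves the letter
  at \<open>Suc t\<close> to \<open>t\<close>.\<close>

lemma card_sorting_networks_nth_Suc:
  assumes n: "2 \<le> n" and t: "Suc t < n choose 2"
  shows "card {\<omega> \<in> sorting_networks n. \<omega> ! t = k} = card {\<omega> \<in> sorting_networks n. \<omega> ! Suc t = k}"
proof -
  let ?R = "rotate_network n" and ?S = "sorting_networks n"
  have ne: "\<omega> \<noteq> []" "length \<omega> = n choose 2" "set \<omega> \<subseteq> {1..n - 1}" if "\<omega> \<in> ?S" for \<omega>
  proof -
    show len: "length \<omega> = n choose 2" and "set \<omega> \<subseteq> {1..n - 1}"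
      using that by (simp_all add: sorting_networks_def)
    show "\<omega> \<noteq> []" using len t by (metis less_nat_zero_code list.size(3))
  qed
  have inj: "inj_on ?R ?S"
  proof (rule inj_onI)
    fix u v assume uv: "u \<in> ?S" "v \<in> ?S" "?R u = ?R v"
    then have "tl u = tl v" "n - hd u = n - hd v" by (auto simp: rotate_network_def)
    moreover have "hd u \<in> {1..n - 1}" "hd v \<in> {1..n - 1}"
      using ne[OF uv(1)] ne[OF uv(2)] by (meson hd_in_set subsetD)+
    ultimately have "hd u = hd v" by auto
    then show "u = v" using \<open>tl u = tl v\<close> ne(1)[OF uv(1)] ne(1)[OF uv(2)] by (metis list.collapse)
  qed
  have surj: "?R ` ?S = ?S"
    using rotate_network_in[OF n] inj by (intro endo_inj_surj finite_sorting_networks) auto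
  have nth: "?R \<omega> ! t = \<omega> ! Suc t" if "\<omega> \<in> ?S" for \<omega>
  proof -
    have "t < (n choose 2) - 1" using t by linarith
    then show ?thesis using ne[OF that] by (simp add: rotate_network_def nth_append nth_tl)
  qed
  have img: "?R ` {\<omega> \<in> ?S. \<omega> ! Suc t = k} = {\<omega> \<in> ?S. \<omega> ! t = k}"
  proof (intro equalityI subsetI)
    fix \<omega> assume "\<omega> \<in> {\<omega> \<in> ?S. \<omega> ! t = k}"
    then have "\<omega> \<in> ?R ` ?S" "\<omega> ! t = k" using surj by auto
    then show "\<omega> \<in> ?R ` {\<omega> \<in> ?S. \<omega> ! Suc t = k}" using nth by auto
  qed (auto simp: nth rotate_network_in[OF n])
  have "inj_on ?R {\<omega> \<in> ?S. \<omega> ! Suc t = k}" using inj by (rule inj_on_subset) auto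
  then show ?thesis unfolding img[symmetric] by (rule card_image)
qed

lemma card_sorting_networks_nth:
  assumes k: "1 \<le> k" "k < n" and t: "t < n choose 2"
  shows "real (n choose 2) * real (card {\<omega> \<in> sorting_networks n. \<omega> ! t = k})
    = real (card (sorting_networks n)) * half_binom (k - 1) * half_binom (n - k - 1)"
proof -
  let ?c = "\<lambda>t. card {\<omega> \<in> sorting_networks n. \<omega> ! t = k}"
  have "m < n choose 2 \<Longrightarrow> ?c 0 = ?c m" for m
    using card_sorting_networks_nth_Suc[of n _ k] k by (induction m) auto
  note eq = this
  have "(n choose 2) - 1 < n choose 2" using t by simp
  then have "?c t = ?c ((n choose 2) - 1)" by (rule trans[OF eq[OF t, symmetric] eq])
  then show ?thesis
    using nred_adj_int_reverse_ratio[OF k] by (simp only: card_sorting_networks_last[OF k] card_sorting_networks)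
qed

subsection \<open>Subnetworks\<close>

abbreviation index_in :: "nat set \<Rightarrow> nat \<Rightarrow> nat" where
  "index_in A a \<equiv> card {b \<in> A. b \<le> a}"

lemma rank_less_iff:
  assumes "finite A" "a \<in> A" "b \<in> A"
  shows "index_in A a < index_in A b \<longleftrightarrow> a < b"
proof -
  have less: "index_in A a < index_in A b" if "a < b" "b \<in> A" for a b
  proof (rule psubset_card_mono)
    show "finite {c \<in> A. c \<le> b}" using assms(1) by simp
    have "b \<in> {c \<in> A. c \<le> b}" "b \<notin> {c \<in> A. c \<le> a}" using that by auto
    moreover have "{c \<in> A. c \<le> a} \<subseteq> {c \<in> A. c \<le> b}" using that by auto
    ultimately show "{c \<in> A. c \<le> a} \<subset> {c \<in> A. c \<le> b}" by (metis psubsetI)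
  qed
  show ?thesis
  proof (cases "a < b")
    case True
    then show ?thesis using less assms by blast
  next
    case False
    then have "a = b \<or> index_in A b < index_in A a" using less[of b a] assms by linarith
    then show ?thesis using False by auto
  qed
qed

lemma inj_on_rank:
  assumes "finite A"
  shows "inj_on (index_in A) A"
proof (rule inj_onI)
  fix a b assume "a \<in> A" "b \<in> A" "index_in A a = index_in A b"
  then show "a = b"
    using rank_less_iff[OF assms, of a b] rank_less_iff[OF assms, of b a] by linarith
qed

lemma rank_image:
  assumes "finite A"
  shows "index_in A ` A = {1..card A}"
proof (rule card_subset_eq)
  show "index_in A ` A \<subseteq> {1..card A}"
  proof safe
    fix a assume "a \<in> A"
    then have "{b \<in> A. b \<le> a} \<noteq> {}" "{b \<in> A. b \<le> a} \<subseteq> A" by auto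
    then show "index_in A a \<in> {1..card A}"
      using assms by (simp add: card_mono card_gt_0_iff Suc_le_eq)
  qed
  show "card (index_in A ` A) = card {1..card A}" using inj_on_rank[OF assms] by (simp add: card_image)
qed simp

section \<open>One-line words and sequences of configurations\<close>

lemma upt_append: "i \<le> j \<Longrightarrow> j \<le> k \<Longrightarrow> [i..<k] = [i..<j] @ [j..<k]"
  using upt_add_eq_append[of i j "k - j"] by simp

lemma length_one_line: "length (one_line n \<sigma>) = n"
  by (simp add: one_line_def)

lemma one_line_eqD: "one_line n \<sigma> = one_line n \<tau> \<Longrightarrow> i \<in> {1..n} \<Longrightarrow> \<sigma> i = \<tau> i"
  by (auto simp: one_line_def simp del: upt_Suc)

lemma one_line_split:
  assumes "s \<in> {1..n - 1}"
  shows "one_line n \<sigma> = map \<sigma> [1..<s] @ \<sigma> s # \<sigma> (Suc s) # map \<sigma> [Suc (Suc s)..<Suc n]"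
proof -
  have "[1..<Suc n] = [1..<s] @ [s..<Suc n]"
    using assms by (intro upt_append) auto
  also have "s < n" using assms by auto
  then have "[s..<Suc n] = s # Suc s # [Suc (Suc s)..<Suc n]"
    by (simp add: upt_conv_Cons del: upt_Suc)
  finally show ?thesis by (simp add: one_line_def del: upt_Suc)
qed

lemma one_line_adj_swap:
  assumes "s \<in> {1..n - 1}"
  shows "one_line n (\<sigma> \<circ> adj_swap s) = map \<sigma> [1..<s] @ \<sigma> (Suc s) # \<sigma> s # map \<sigma> [Suc (Suc s)..<Suc n]"
  unfolding one_line_split[OF assms]
  by (auto simp: adj_swap_def Transposition.transpose_def simp del: upt_Suc)

text \<open>\<open>configs\<close> from an arbitrary start, because inductions that peel off the
  first swap change the start.\<close>

definition confs :: "nat \<Rightarrow> (nat \<Rightarrow> nat) \<Rightarrow> nat list \<Rightarrow> nat list list" where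
  "confs n \<sigma> \<omega> = map (\<lambda>t. one_line n (\<sigma> \<circ> config \<omega> t)) [0..<Suc (length \<omega>)]"

lemma configs_eq_confs: "configs n \<omega> = confs n id \<omega>"
  by (simp add: configs_def confs_def)

lemma confs_Nil: "confs n \<sigma> [] = [one_line n \<sigma>]"
  by (simp add: confs_def config_eq_word_perm)

lemma confs_Cons: "confs n \<sigma> (s # \<omega>) = one_line n \<sigma> # confs n (\<sigma> \<circ> adj_swap s) \<omega>"
proof -
  have "[0..<Suc (length (s # \<omega>))] = 0 # map Suc [0..<Suc (length \<omega>)]"
    by (simp add: map_Suc_upt upt_conv_Cons del: upt_Suc)
  then show ?thesis
    by (simp add: confs_def config_eq_word_perm word_perm_Cons o_def del: upt_Suc)
qed

lemma confs_neq_Nil: "confs n \<sigma> \<omega> \<noteq> []" and hd_confs: "hd (confs n \<sigma> \<omega>) = one_line n \<sigma>"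
  by (cases \<omega>; simp add: confs_Nil confs_Cons)+

text \<open>Consecutive configurations reveal the swap between them. This gives the uniqueness
  required by the definite description in \<open>subnetwork\<close>.\<close>

lemma confs_inject:
  assumes "inj \<sigma>" "confs n \<sigma> \<omega> = confs n \<sigma> \<omega>'" "set \<omega> \<subseteq> {1..n - 1}" "set \<omega>' \<subseteq> {1..n - 1}"
  shows "\<omega> = \<omega>'"
  using assms
proof (induction \<omega> arbitrary: \<sigma> \<omega>')
  case Nil
  then show ?case using confs_neq_Nil[symmetric] by (cases \<omega>') (auto simp: confs_Nil confs_Cons)
next
  case (Cons s \<omega>)
  obtain s' \<omega>'' where \<omega>': "\<omega>' = s' # \<omega>''"
    using Cons.prems(2) confs_neq_Nil by (cases \<omega>') (auto simp: confs_Nil confs_Cons)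
  have eq: "confs n (\<sigma> \<circ> adj_swap s) \<omega> = confs n (\<sigma> \<circ> adj_swap s') \<omega>''"
    using Cons.prems(2) by (simp add: confs_Cons \<omega>' del: o_apply)
  then have "one_line n (\<sigma> \<circ> adj_swap s) = one_line n (\<sigma> \<circ> adj_swap s')" by (metis hd_confs)
  then have "(\<sigma> \<circ> adj_swap s) s = (\<sigma> \<circ> adj_swap s') s"
    by (rule one_line_eqD) (use Cons.prems(3) in auto)
  then have "Suc s = adj_swap s' s"
    using Cons.prems(1) by (simp add: adj_swap_def inj_eq)
  then have "s' = s" by (auto simp: adj_swap_def Transposition.transpose_def split: if_splits)
  moreover have "inj (\<sigma> \<circ> adj_swap s)" using Cons.prems(1) by (simp add: inj_compose adj_swap_def)
  ultimately show ?case using Cons.IH[of "\<sigma> \<circ> adj_swap s" \<omega>''] eq Cons.prems \<omega>'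
    by (simp del: o_apply)
qed

text \<open>Reducedness, swap by swap. This form passes to subnetworks directly, since relabelling
  by rank preserves the order of particles.\<close>

primrec ascending :: "(nat \<Rightarrow> nat) \<Rightarrow> nat list \<Rightarrow> bool" where
  "ascending \<sigma> [] = True"
| "ascending \<sigma> (s # \<omega>) = (\<sigma> s < \<sigma> (Suc s) \<and> ascending (\<sigma> \<circ> adj_swap s) \<omega>)"

lemma ascendingI:
  assumes "\<And>t. t < length \<omega> \<Longrightarrow>
    (\<sigma> \<circ> word_perm (take t \<omega>)) (\<omega> ! t) < (\<sigma> \<circ> word_perm (take t \<omega>)) (Suc (\<omega> ! t))"
  shows "ascending \<sigma> \<omega>"
  using assms
proof (induction \<omega> arbitrary: \<sigma>)
  case (Cons s \<omega>)
  have "ascending (\<sigma> \<circ> adj_swap s) \<omega>"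
  proof (rule Cons.IH)
    fix t assume "t < length \<omega>"
    then show "(\<sigma> \<circ> adj_swap s \<circ> word_perm (take t \<omega>)) (\<omega> ! t) < (\<sigma> \<circ> adj_swap s \<circ> word_perm (take t \<omega>)) (Suc (\<omega> ! t))"
      using Cons.prems[of "Suc t"] by (simp add: word_perm_Cons)
  qed
  then show ?case using Cons.prems[of 0] by simp
qed simp

lemma sorting_network_ascending:
  assumes "\<omega> \<in> sorting_networks n"
  shows "ascending id \<omega>"
proof (rule ascendingI)
  fix t assume t: "t < length \<omega>"
  have "set \<omega> \<subseteq> {1..n - 1}" "card (value_invs (word_perm \<omega>)) = length \<omega>"
    using assms by (auto simp: sorting_networks_eq_words words_def card_value_invs_reverse_perm)
  from reduced_take[OF this t]
  show "(id \<circ> word_perm (take t \<omega>)) (\<omega> ! t) < (id \<circ> word_perm (take t \<omega>)) (Suc (\<omega> ! t))" by simp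
qed

lemma card_value_invs_ascending:
  assumes "ascending \<sigma> \<omega>" "\<sigma> permutes {1..n}" "set \<omega> \<subseteq> {1..n - 1}"
  shows "card (value_invs (\<sigma> \<circ> word_perm \<omega>)) = card (value_invs \<sigma>) + length \<omega>"
  using assms
proof (induction \<omega> arbitrary: \<sigma>)
  case (Cons s \<omega>)
  have "\<sigma> \<circ> adj_swap s permutes {1..n}"
    using Cons.prems by (intro permutes_compose adj_swap_permutes) auto
  then show ?case
    using Cons.IH[of "\<sigma> \<circ> adj_swap s"] card_value_invs_asc[OF Cons.prems(2), of s] Cons.prems
    by (simp add: word_perm_Cons o_assoc del: o_apply)
qed simp

text \<open>Inversions are never undone; hence a restricted word cannot return after one of its
  pairs has been swapped.\<close>

lemma confs_ascending:
  assumes "ascending \<sigma> \<omega>" "\<sigma> permutes {1..n}" "set \<omega> \<subseteq> {1..n - 1}" "w \<in> set (confs n \<sigma> \<omega>)"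
  shows "\<exists>\<sigma>'. w = one_line n \<sigma>' \<and> \<sigma>' permutes {1..n} \<and> value_invs \<sigma> \<subseteq> value_invs \<sigma>'"
  using assms
proof (induction \<omega> arbitrary: \<sigma>)
  case (Cons s \<omega>)
  have p: "\<sigma> \<circ> adj_swap s permutes {1..n}"
    using Cons.prems by (intro permutes_compose adj_swap_permutes) auto
  have "value_invs \<sigma> \<subseteq> value_invs (\<sigma> \<circ> adj_swap s)"
    using value_invs_asc(1)[of \<sigma> s] permutes_bij[OF Cons.prems(2)] Cons.prems(1) by auto
  then show ?case
    using Cons.IH[OF _ p] Cons.prems by (auto simp: confs_Cons simp del: o_apply) blast
qed (auto simp: confs_Nil)

lemma filter_one_line_pair:
  assumes "inj \<sigma>" "1 \<le> p" "p < q" "q \<le> n"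
  shows "filter (\<lambda>a. a = \<sigma> p \<or> a = \<sigma> q) (one_line n \<sigma>) = [\<sigma> p, \<sigma> q]"
proof -
  have "[1..<Suc n] = [1..<p] @ [p..<q] @ [q..<Suc n]"
    using upt_append[of 1 p "Suc n"] upt_append[of p q "Suc n"] assms by simp
  also have "[p..<q] = p # [Suc p..<q]" using assms by (simp add: upt_conv_Cons)
  also have "[q..<Suc n] = q # [Suc q..<Suc n]" using assms by (simp add: upt_conv_Cons)
  finally have "one_line n \<sigma> = map \<sigma> [1..<p] @ \<sigma> p # map \<sigma> [Suc p..<q] @ \<sigma> q # map \<sigma> [Suc q..<Suc n]"
    by (simp add: one_line_def del: upt_Suc)
  moreover have empty: "filter (\<lambda>a. a = \<sigma> p \<or> a = \<sigma> q) (map \<sigma> xs) = []" if "p \<notin> set xs" "q \<notin> set xs" for xs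
    using that assms(1) by (auto simp: filter_empty_conv inj_eq)
  ultimately show ?thesis using assms(3) by (simp add: empty del: upt_Suc filter_map)
qed

text \<open>Relabelling is injective on \<open>A\<close>, so equal restricted words list
  \<open>A\<close> in the same order; filtering down to \<open>x\<close> and \<open>y\<close> shows
  which of them comes first.\<close>

lemma restrict_word_value_invs:
  assumes A: "finite A" "x \<in> A" "y \<in> A" "A \<subseteq> {1..n}"
    and \<sigma>: "\<sigma> permutes {1..n}" and \<tau>: "\<tau> permutes {1..n}"
    and eq: "restrict_word A (one_line n \<sigma>) = restrict_word A (one_line n \<tau>)"
    and xy: "(x, y) \<in> value_invs \<tau>"
  shows "(x, y) \<in> value_invs \<sigma>"
proof -
  have "filter (\<lambda>a. a \<in> A) (one_line n \<sigma>) = filter (\<lambda>a. a \<in> A) (one_line n \<tau>)"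
    using eq unfolding restrict_word_def
    by (rule map_inj_on) (rule inj_on_subset[OF inj_on_rank[OF A(1)]], auto)
  then have "filter (\<lambda>a. a = x \<or> a = y) (filter (\<lambda>a. a \<in> A) (one_line n \<sigma>))
      = filter (\<lambda>a. a = x \<or> a = y) (filter (\<lambda>a. a \<in> A) (one_line n \<tau>))" by simp
  moreover have "(a = x \<or> a = y) \<and> a \<in> A \<longleftrightarrow> a = x \<or> a = y" for a using A by auto
  ultimately have eq': "filter (\<lambda>a. a = x \<or> a = y) (one_line n \<sigma>) = filter (\<lambda>a. a = x \<or> a = y) (one_line n \<tau>)"
    by (simp add: conj_commute)
  have lt: "x < y" "inv \<tau> y < inv \<tau> x" using xy by (auto simp: value_invs_def)
  have val: "\<pi> (inv \<pi> z) = z" if "\<pi> permutes {1..n}" for \<pi> z using that by (simp add: permutes_inverses)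
  have pos: "inv \<pi> z \<in> {1..n}" if "\<pi> permutes {1..n}" "z \<in> A" for \<pi> z
    using that A permutes_in_image[OF permutes_inv[OF that(1)]] by blast
  have yx: "filter (\<lambda>a. a = x \<or> a = y) (one_line n \<tau>) = [y, x]"
    using filter_one_line_pair[OF permutes_inj[OF \<tau>] _ lt(2), of n] pos[OF \<tau>] A val[OF \<tau>]
    by (simp add: disj_commute)
  have "\<not> inv \<sigma> x < inv \<sigma> y"
  proof
    assume "inv \<sigma> x < inv \<sigma> y"
    then have "filter (\<lambda>a. a = x \<or> a = y) (one_line n \<sigma>) = [x, y]"
      using filter_one_line_pair[OF permutes_inj[OF \<sigma>], of "inv \<sigma> x" "inv \<sigma> y" n] pos[OF \<sigma>] A val[OF \<sigma>]
      by simp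
    then show False using eq' yx lt(1) by simp
  qed
  moreover have "inv \<sigma> x \<noteq> inv \<sigma> y" using val[OF \<sigma>] lt(1) by (metis less_irrefl)
  ultimately show ?thesis using lt(1) by (simp add: value_invs_def)
qed


text \<open>The explicit form of \<open>subnetwork\<close>. The letter counts the chosen particles
  at positions up to \<open>s\<close>, including the left partner of the swap, and so is the swap
  location after deletion.\<close>

primrec induced :: "nat set \<Rightarrow> (nat \<Rightarrow> nat) \<Rightarrow> nat list \<Rightarrow> nat list" where
  "induced A \<sigma> [] = []"
| "induced A \<sigma> (s # \<omega>) =
    (if \<sigma> s \<in> A \<and> \<sigma> (Suc s) \<in> A then [card {i \<in> {1..s}. \<sigma> i \<in> A}] else []) @ induced A (\<sigma> \<circ> adj_swap s) \<omega>"

lemma restrict_word_append: "restrict_word A (u @ v) = restrict_word A u @ restrict_word A v"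
  by (simp add: restrict_word_def)

lemma restrict_word_Cons:
  "restrict_word A (a # v) = (if a \<in> A then index_in A a # restrict_word A v else restrict_word A v)"
  by (simp add: restrict_word_def)

lemma length_restrict_word_map: "length (restrict_word A (map \<sigma> [Suc 0..<s])) = card {i. Suc 0 \<le> i \<and> i < s \<and> \<sigma> i \<in> A}"
proof -
  have "length (restrict_word A (map \<sigma> [Suc 0..<s])) = length (filter (\<lambda>i. \<sigma> i \<in> A) [Suc 0..<s])"
    by (simp add: restrict_word_def filter_map o_def)
  also have "\<dots> = card (set (filter (\<lambda>i. \<sigma> i \<in> A) [Suc 0..<s]))"
    by (rule distinct_card[symmetric]) simp
  also have "set (filter (\<lambda>i. \<sigma> i \<in> A) [Suc 0..<s]) = {i. Suc 0 \<le> i \<and> i < s \<and> \<sigma> i \<in> A}" by auto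
  finally show ?thesis .
qed

lemma restrict_word_skip:
  assumes "s \<in> {1..n - 1}" "\<not> (\<sigma> s \<in> A \<and> \<sigma> (Suc s) \<in> A)"
  shows "restrict_word A (one_line n (\<sigma> \<circ> adj_swap s)) = restrict_word A (one_line n \<sigma>)"
  using assms(2) one_line_adj_swap[OF assms(1), of \<sigma>] one_line_split[OF assms(1), of \<sigma>]
  by (simp add: restrict_word_append restrict_word_Cons del: upt_Suc)

text \<open>Around the swapped pair the restricted word reads \<open>?u @ ?x # ?y # ?v\<close>;
  comparing lengths with \<open>one_line m \<pi>\<close> finds the pair at \<open>j\<close>, one
  past \<open>?u\<close>.\<close>

lemma restrict_word_swap:
  assumes s: "s \<in> {1..n - 1}" and A: "\<sigma> s \<in> A" "\<sigma> (Suc s) \<in> A"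
    and eq: "restrict_word A (one_line n \<sigma>) = one_line m \<pi>"
  defines "j \<equiv> card {i \<in> {1..s}. \<sigma> i \<in> A}"
  shows "j \<in> {1..m - 1}" "\<pi> j = index_in A (\<sigma> s)" "\<pi> (Suc j) = index_in A (\<sigma> (Suc s))"
    "restrict_word A (one_line n (\<sigma> \<circ> adj_swap s)) = one_line m (\<pi> \<circ> adj_swap j)"
proof -
  let ?u = "restrict_word A (map \<sigma> [1..<s])"
  let ?v = "restrict_word A (map \<sigma> [Suc (Suc s)..<Suc n])"
  let ?x = "index_in A (\<sigma> s)" and ?y = "index_in A (\<sigma> (Suc s))"
  have "{i \<in> {1..s}. \<sigma> i \<in> A} = insert s {i \<in> {1..<s}. \<sigma> i \<in> A}" using s A by auto
  then have j: "j = Suc (length ?u)" by (simp add: j_def length_restrict_word_map)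
  have line: "one_line m \<pi> = ?u @ ?x # ?y # ?v"
    unfolding eq[symmetric] one_line_split[OF s]
    using A by (simp add: restrict_word_append restrict_word_Cons del: upt_Suc)
  then have "m = length (?u @ ?x # ?y # ?v)" using length_one_line by metis
  then show jm: "j \<in> {1..m - 1}" by (simp add: j)
  have "length (map \<pi> [1..<j]) = length ?u" by (simp add: j del: upt_Suc)
  then have split: "?u = map \<pi> [1..<j]" "?x = \<pi> j" "?y = \<pi> (Suc j)" "?v = map \<pi> [Suc (Suc j)..<Suc m]"
    using line unfolding one_line_split[OF jm] by (auto simp del: upt_Suc)
  then show "\<pi> j = ?x" "\<pi> (Suc j) = ?y" by simp_all
  show "restrict_word A (one_line n (\<sigma> \<circ> adj_swap s)) = one_line m (\<pi> \<circ> adj_swap j)"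
    unfolding one_line_adj_swap[OF s] one_line_adj_swap[OF jm]
    using A split by (simp add: restrict_word_append restrict_word_Cons del: upt_Suc)
qed

lemma induced_properties:
  assumes "finite A" "restrict_word A (one_line n \<sigma>) = one_line m \<pi>" "ascending \<sigma> \<omega>" "set \<omega> \<subseteq> {1..n - 1}"
  shows "set (induced A \<sigma> \<omega>) \<subseteq> {1..m - 1} \<and> ascending \<pi> (induced A \<sigma> \<omega>) \<and>
    restrict_word A (one_line n (\<sigma> \<circ> word_perm \<omega>)) = one_line m (\<pi> \<circ> word_perm (induced A \<sigma> \<omega>))"
  using assms(2-)
proof (induction \<omega> arbitrary: \<sigma> \<pi>)
  case (Cons s \<omega>)
  have s: "s \<in> {1..n - 1}" using Cons.prems by simp
  show ?case
  proof (cases "\<sigma> s \<in> A \<and> \<sigma> (Suc s) \<in> A")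
    case True
    define j where "j = card {i \<in> {1..s}. \<sigma> i \<in> A}"
    note sw = restrict_word_swap[OF s conjunct1[OF True] conjunct2[OF True] Cons.prems(1), folded j_def]
    have "\<pi> j < \<pi> (Suc j)"
      using sw(2,3) rank_less_iff[OF assms(1)] True Cons.prems(2) by simp
    moreover have "induced A \<sigma> (s # \<omega>) = j # induced A (\<sigma> \<circ> adj_swap s) \<omega>"
      using True by (simp add: j_def)
    ultimately show ?thesis
      using Cons.IH[OF sw(4)] Cons.prems sw(1)
      by (simp add: word_perm_Cons o_assoc del: o_apply induced.simps)
  next
    case False
    then have "induced A \<sigma> (s # \<omega>) = induced A (\<sigma> \<circ> adj_swap s) \<omega>" by auto
    then show ?thesis
      using Cons.IH[of "\<sigma> \<circ> adj_swap s" \<pi>] restrict_word_skip[OF s False] Cons.prems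
      by (simp add: word_perm_Cons o_assoc del: o_apply induced.simps)
  qed
qed simp

lemma remdups_restrict_confs:
  assumes A: "A \<subseteq> {1..n}" and "restrict_word A (one_line n \<sigma>) = one_line m \<pi>" "ascending \<sigma> \<omega>"
    "set \<omega> \<subseteq> {1..n - 1}" "\<sigma> permutes {1..n}"
  shows "remdups (map (restrict_word A) (confs n \<sigma> \<omega>)) = confs m \<pi> (induced A \<sigma> \<omega>)"
  using assms(2-)
proof (induction \<omega> arbitrary: \<sigma> \<pi>)
  case Nil
  then show ?case by (simp add: confs_Nil)
next
  case (Cons s \<omega>)
  let ?\<sigma> = "\<sigma> \<circ> adj_swap s"
  have s: "s \<in> {1..n - 1}" using Cons.prems by simp
  have finA: "finite A" using A finite_subset by blast
  have p: "?\<sigma> permutes {1..n}" using s Cons.prems by (intro permutes_compose adj_swap_permutes)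
  have asc: "\<sigma> s < \<sigma> (Suc s)" "ascending ?\<sigma> \<omega>" using Cons.prems by simp_all
  show ?case
  proof (cases "\<sigma> s \<in> A \<and> \<sigma> (Suc s) \<in> A")
    case True
    define j where "j = card {i \<in> {1..s}. \<sigma> i \<in> A}"
    note sw = restrict_word_swap[OF s conjunct1[OF True] conjunct2[OF True] Cons.prems(1), folded j_def]
    \<comment> \<open>All later configurations invert the swapped pair and the present one does not,
      so \<open>remdups\<close> keeps the present word.\<close>
    have "restrict_word A (one_line n \<sigma>) \<notin> restrict_word A ` set (confs n ?\<sigma> \<omega>)"
    proof
      assume "restrict_word A (one_line n \<sigma>) \<in> restrict_word A ` set (confs n ?\<sigma> \<omega>)"
      then obtain w where w: "w \<in> set (confs n ?\<sigma> \<omega>)" "restrict_word A (one_line n \<sigma>) = restrict_word A w" by blast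
      obtain \<tau> where \<tau>: "w = one_line n \<tau>" "\<tau> permutes {1..n}" "value_invs ?\<sigma> \<subseteq> value_invs \<tau>"
        using confs_ascending[OF asc(2) p _ w(1)] Cons.prems by auto
      have "(\<sigma> s, \<sigma> (Suc s)) \<in> value_invs \<tau>"
        using \<tau>(3) value_invs_asc(1)[OF permutes_bij[OF Cons.prems(4)] asc(1)] by auto
      then have "(\<sigma> s, \<sigma> (Suc s)) \<in> value_invs \<sigma>"
        using restrict_word_value_invs[OF finA _ _ A Cons.prems(4) \<tau>(2)] w(2) \<tau>(1) True by auto
      then show False using value_invs_asc(2)[OF permutes_bij[OF Cons.prems(4)] asc(1)] by simp
    qed
    moreover have "induced A \<sigma> (s # \<omega>) = j # induced A ?\<sigma> \<omega>"
      using True by (simp add: j_def)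
    ultimately show ?thesis
      using Cons.IH[OF sw(4) asc(2) _ p] Cons.prems
      by (simp add: confs_Cons del: o_apply induced.simps)
  next
    case False
    then have i: "induced A \<sigma> (s # \<omega>) = induced A ?\<sigma> \<omega>" by auto
    have eq: "restrict_word A (one_line n ?\<sigma>) = restrict_word A (one_line n \<sigma>)"
      by (rule restrict_word_skip[OF s False])
    \<comment> \<open>A swap that does not survive leaves the word unchanged; its copy at the next
      time makes \<open>remdups\<close> drop the present one.\<close>
    have "one_line n ?\<sigma> \<in> set (confs n ?\<sigma> \<omega>)"
      using hd_in_set[OF confs_neq_Nil] by (simp add: hd_confs)
    then have "restrict_word A (one_line n \<sigma>) \<in> restrict_word A ` set (confs n ?\<sigma> \<omega>)"
      unfolding eq[symmetric] by (rule imageI)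
    then show ?thesis
      using Cons.IH[OF _ asc(2) _ p] eq Cons.prems i
      by (simp add: confs_Cons del: o_apply induced.simps)
  qed
qed

lemma one_line_id: "one_line n id = [1..<Suc n]"
  by (simp add: one_line_def del: upt_Suc)

lemma one_line_reverse_perm: "one_line n (reverse_perm n) = rev [1..<Suc n]"
  by (rule nth_equalityI) (auto simp: one_line_def reverse_perm_def rev_nth simp del: upt_Suc)

lemma restrict_word_upt:
  assumes "A \<subseteq> {1..n}"
  shows "restrict_word A [Suc 0..<Suc n] = [Suc 0..<Suc (card A)]"
proof (rule sorted_distinct_set_unique)
  have finA: "finite A" using assms finite_subset by blast
  have set: "set (filter (\<lambda>a. a \<in> A) [Suc 0..<Suc n]) = A" using assms by auto
  have mono: "index_in A a \<le> index_in A b" if "a \<le> b" for a b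
    using that finA by (intro card_mono) auto
  have "sorted (map (index_in A) xs)" if "sorted xs" for xs
    using that mono by (induction xs) auto
  then show "sorted (restrict_word A [Suc 0..<Suc n])"
    unfolding restrict_word_def by (simp add: sorted_wrt_filter del: upt_Suc)
  show "distinct (restrict_word A [Suc 0..<Suc n])"
    unfolding restrict_word_def distinct_map set using inj_on_rank[OF finA] by simp
  show "set (restrict_word A [Suc 0..<Suc n]) = set [Suc 0..<Suc (card A)]"
    unfolding restrict_word_def set_map set rank_image[OF finA] by auto
qed (auto simp del: upt_Suc)

lemma restrict_word_rev: "restrict_word A (rev w) = rev (restrict_word A w)"
  by (simp add: restrict_word_def rev_filter rev_map)

text \<open>The last configuration restricts to the decreasing word, which determines the product.
  Every letter creates one inversion, so the length is determined as well.\<close>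

lemma induced_in_sorting_networks:
  assumes w: "\<omega> \<in> sorting_networks n" and A: "A \<subseteq> {1..n}"
  shows "induced A id \<omega> \<in> sorting_networks (card A)"
proof -
  let ?m = "card A" and ?\<eta> = "induced A id \<omega>"
  have finA: "finite A" using A finite_subset by blast
  have "set \<omega> \<subseteq> {1..n - 1}" "word_perm \<omega> = reverse_perm n"
    using w by (auto simp: sorting_networks_eq_words words_def)
  then have \<eta>: "set ?\<eta> \<subseteq> {1..?m - 1}" "ascending id ?\<eta>"
    "restrict_word A (one_line n (reverse_perm n)) = one_line ?m (word_perm ?\<eta>)"
    using induced_properties[OF finA _ sorting_network_ascending[OF w], of n ?m id] A
    by (simp_all add: one_line_id restrict_word_upt del: upt_Suc)
  have p: "word_perm ?\<eta> permutes {1..?m}" using \<eta>(1) by (rule word_perm_permutes)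
  have "word_perm ?\<eta> i = reverse_perm ?m i" for i
  proof (cases "i \<in> {1..?m}")
    case True
    have "one_line ?m (word_perm ?\<eta>) = one_line ?m (reverse_perm ?m)"
      using \<eta>(3) A by (simp add: one_line_reverse_perm restrict_word_rev restrict_word_upt del: upt_Suc)
    then show ?thesis using True by (rule one_line_eqD)
  next
    case False
    then show ?thesis using p reverse_perm_permutes[of ?m] by (simp add: permutes_def)
  qed
  then have perm: "word_perm ?\<eta> = reverse_perm ?m" by blast
  have "card (value_invs (id \<circ> word_perm ?\<eta>)) = card (value_invs id) + length ?\<eta>"
    using \<eta>(1,2) by (intro card_value_invs_ascending permutes_id)
  then have "length ?\<eta> = ?m choose 2"
    unfolding id_comp perm card_value_invs_reverse_perm value_invs_id by simp
  then show ?thesis using \<eta>(1) perm by (simp add: sorting_networks_eq_words words_def)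
qed

lemma subnetwork_eq_induced:
  assumes w: "\<omega> \<in> sorting_networks n" and A: "A \<subseteq> {1..n}"
  shows "subnetwork n \<omega> A = induced A id \<omega>"
  unfolding subnetwork_def
proof (rule the_equality)
  have "set \<omega> \<subseteq> {1..n - 1}" using w by (simp add: sorting_networks_def)
  then have "remdups (map (restrict_word A) (configs n \<omega>)) = configs (card A) (induced A id \<omega>)"
    unfolding configs_eq_confs using A sorting_network_ascending[OF w]
    by (intro remdups_restrict_confs permutes_id) (simp_all add: one_line_id restrict_word_upt del: upt_Suc)
  then show *: "induced A id \<omega> \<in> sorting_networks (card A) \<and>
      configs (card A) (induced A id \<omega>) = remdups (map (restrict_word A) (configs n \<omega>))"
    using induced_in_sorting_networks[OF w A] by simp
  fix \<eta> assume "\<eta> \<in> sorting_networks (card A) \<and>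
    configs (card A) \<eta> = remdups (map (restrict_word A) (configs n \<omega>))"
  with * show "\<eta> = induced A id \<omega>"
    unfolding configs_eq_confs sorting_networks_def by (intro confs_inject[of id]) auto
qed

definition swapped_at :: "nat set \<Rightarrow> nat \<Rightarrow> (nat \<Rightarrow> nat) \<Rightarrow> nat \<Rightarrow> bool" where
  "swapped_at A j \<sigma> s \<longleftrightarrow> \<sigma> s \<in> A \<and> \<sigma> (Suc s) \<in> A \<and> card {i \<in> {1..s}. \<sigma> i \<in> A} = j"

lemma count_list_induced:
  "count_list (induced A \<sigma> \<omega>) j
    = (\<Sum>t<length \<omega>. of_bool (swapped_at A j (\<sigma> \<circ> word_perm (take t \<omega>)) (\<omega> ! t)))"
proof (induction \<omega> arbitrary: \<sigma>)
  case (Cons s \<omega>)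
  have "count_list (induced A \<sigma> (s # \<omega>)) j
      = of_bool (swapped_at A j \<sigma> s) + count_list (induced A (\<sigma> \<circ> adj_swap s) \<omega>) j"
    by (auto simp: swapped_at_def)
  also have "count_list (induced A (\<sigma> \<circ> adj_swap s) \<omega>) j
      = (\<Sum>t<length \<omega>. of_bool (swapped_at A j (\<sigma> \<circ> word_perm (take (Suc t) (s # \<omega>))) ((s # \<omega>) ! Suc t)))"
    unfolding Cons.IH by (simp add: word_perm_Cons o_assoc del: o_apply)
  finally show ?case
    unfolding list.size add_Suc_right add_0_right sum.lessThan_Suc_shift by simp
qed simp

lemma card_swap_loc: "card {t \<in> {1..length \<eta>}. swap_loc \<eta> t = j} = count_list \<eta> j"
proof -
  have "t \<in> {t \<in> {1..length \<eta>}. swap_loc \<eta> t = j} \<longleftrightarrow> t \<in> Suc ` {i. i < length \<eta> \<and> j = \<eta> ! i}" for t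
    by (cases t) (auto simp: swap_loc_def)
  then have "{t \<in> {1..length \<eta>}. swap_loc \<eta> t = j} = Suc ` {i. i < length \<eta> \<and> j = \<eta> ! i}" by blast
  then show ?thesis
    by (simp add: card_image count_list_eq_length_filter length_filter_conv_card)
qed

subsection \<open>Expected number of swaps\<close>

lemma half_binom_times_choose:
  "half_binom (p + i) * real ((p + i) choose p) = half_binom p * (pochhammer (3 / 2 + real p) i / fact i)"
proof -
  have "real ((p + i) choose p) = fact (p + i) / (fact p * fact i)"
    by (simp add: binomial_fact)
  then show ?thesis
    by (simp add: half_binom_def pochhammer_product'[of _ p i])
qed

lemma fact_times_pochhammer: "fact m * pochhammer (real m + 1) M = fact (m + M)"
proof (induction M)
  case (Suc M)
  have "fact m * pochhammer (real m + 1) (Suc M) = fact m * pochhammer (real m + 1) M * (real m + 1 + real M)"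
    by (simp add: pochhammer_Suc)
  then show ?case unfolding Suc.IH by (simp add: algebra_simps)
qed simp

text \<open>In generating functions, \<open>half_binom r * real (r choose p)\<close> belongs to
  \<open>half_binom p\<close> times \<open>x ^ p\<close> times \<open>(1 - x)\<close> to the power
  \<open>- (3 / 2 + p)\<close>. The product of two such series has the integer exponent
  \<open>- (p + q + 3)\<close>, whose coefficients are binomial.\<close>

lemma sum_half_binom:
  assumes "p + q + M = L"
  shows "(\<Sum>r\<le>L. half_binom r * real (r choose p) * (half_binom (L - r) * real ((L - r) choose q)))
    = half_binom p * half_binom q * real ((L + 2) choose (p + q + 2))"
proof -
  let ?f = "\<lambda>r. half_binom r * real (r choose p) * (half_binom (L - r) * real ((L - r) choose q))"
  let ?a = "3 / 2 + real p" and ?b = "3 / 2 + real q"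
  have "(\<Sum>r\<le>L. ?f r) = (\<Sum>r\<in>(\<lambda>i. p + i) ` {..M}. ?f r)"
  proof (rule sum.mono_neutral_right)
    show "\<forall>r\<in>{..L} - (\<lambda>i. p + i) ` {..M}. ?f r = 0"
    proof
      fix r assume r: "r \<in> {..L} - (\<lambda>i. p + i) ` {..M}"
      have "r < p \<or> L - r < q"
      proof (rule ccontr)
        assume n: "\<not> ?thesis"
        then have "r = p + (r - p)" "r - p \<le> M" using assms r by auto
        then show False using r by blast
      qed
      then show "?f r = 0" by (auto simp: binomial_eq_0)
    qed
  qed (use assms in auto)
  also have "\<dots> = (\<Sum>i\<le>M. ?f (p + i))"
    by (simp add: sum.reindex)
  also have "\<dots> = (\<Sum>i\<le>M. half_binom p * half_binom q / fact M *
      (real (M choose i) * pochhammer ?a i * pochhammer ?b (M - i)))"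
  proof (rule sum.cong)
    fix i assume i: "i \<in> {..M}"
    have L: "L - (p + i) = q + (M - i)" using assms i by auto
    have "real (M choose i) = fact M / (fact i * fact (M - i))"
      using i by (simp add: binomial_fact)
    then show "?f (p + i) = half_binom p * half_binom q / fact M *
        (real (M choose i) * pochhammer ?a i * pochhammer ?b (M - i))"
      unfolding L half_binom_times_choose by simp
  qed simp
  \<comment> \<open>Chu-Vandermonde for rising factorials; the halves add up to the integer
    \<open>p + q + 3\<close>.\<close>
  also have "\<dots> = half_binom p * half_binom q / fact M * pochhammer (?a + ?b) M"
    by (simp only: pochhammer_binomial_sum[of ?a ?b M] sum_distrib_left)
  also have "pochhammer (?a + ?b) M = fact (L + 2) / fact (p + q + 2)"
  proof -
    have "?a + ?b = real (p + q + 2) + 1" by simp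
    moreover have "p + q + 2 + M = L + 2" using assms by simp
    ultimately have "fact (p + q + 2) * pochhammer (?a + ?b) M = fact (L + 2)"
      using fact_times_pochhammer[of "p + q + 2" M] by metis
    then show ?thesis by (simp only: nonzero_eq_divide_eq fact_nonzero not_False_eq_True mult.commute)
  qed
  also have "half_binom p * half_binom q / fact M * (fact (L + 2) / fact (p + q + 2))
      = half_binom p * half_binom q * real ((L + 2) choose (p + q + 2))"
  proof -
    have "L + 2 - (p + q + 2) = M" "p + q + 2 \<le> L + 2" using assms by auto
    then have choose: "real ((L + 2) choose (p + q + 2)) = fact (L + 2) / (fact (p + q + 2) * fact M)"
      using binomial_fact[of "p + q + 2" "L + 2", where ?'a = real] by metis
    have frac: "a / b * (c / d) = a * (c / (d * b))" for a b c d :: real by simp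
    show ?thesis unfolding choose by (rule frac)
  qed
  finally show ?thesis .
qed

text \<open>Read backwards, the falling product from \<open>r + 1/2\<close> down to
  \<open>3/2\<close> is a rising one.\<close>

lemma falling_fact_half: "falling_fact (real r + 1 / 2) r / fact r = half_binom r"
proof -
  have "falling_fact (real r + 1 / 2) r = (\<Prod>i<r. 3 / 2 + real i)"
    unfolding falling_fact_def
    by (rule prod.reindex_bij_witness[of _ "\<lambda>i. r - 1 - i" "\<lambda>i. r - 1 - i"]) (auto simp: of_nat_diff)
  then show ?thesis by (simp add: half_binom_def pochhammer_prod lessThan_atLeast0)
qed

lemma pair_pmf_of_set:
  assumes "finite A" "A \<noteq> {}" "finite B" "B \<noteq> {}"
  shows "pair_pmf (pmf_of_set A) (pmf_of_set B) = pmf_of_set (A \<times> B)"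
proof (rule pmf_eqI)
  fix x :: "'a \<times> 'b"
  show "pmf (pair_pmf (pmf_of_set A) (pmf_of_set B)) x = pmf (pmf_of_set (A \<times> B)) x"
    using assms by (cases x) (auto simp: pmf_pair card_cartesian_product indicator_def)
qed

text \<open>Pulled back along \<open>\<sigma>\<close>, such a set consists of \<open>s\<close>,
  \<open>Suc s\<close>, of \<open>j - 1\<close> positions to their left and of
  \<open>m - j - 1\<close> to their right. The count depends on \<open>s\<close> alone.\<close>

lemma card_swapped_at:
  assumes \<sigma>: "\<sigma> permutes {1..n}" and s: "s \<in> {1..n - 1}" and j: "1 \<le> j" "j \<le> m - 1"
  shows "card {A. A \<subseteq> {1..n} \<and> card A = m \<and> swapped_at A j \<sigma> s}
    = (s - 1 choose (j - 1)) * (n - s - 1 choose (m - j - 1))"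
proof -
  let ?L = "{B. B \<subseteq> {1..<s} \<and> card B = j - 1}" and ?R = "{B. B \<subseteq> {s + 2..n} \<and> card B = m - j - 1}"
  define f where "f = (\<lambda>(B, C). \<sigma> ` (B \<union> {s, Suc s} \<union> C))"
  have inj: "inj \<sigma>" using \<sigma> by (rule permutes_inj)
  have mem: "\<sigma> x \<in> \<sigma> ` B \<longleftrightarrow> x \<in> B" for x B using inj by (auto simp: inj_eq)
  have img: "\<sigma> ` {1..n} = {1..n}" using \<sigma> by (rule permutes_image)
  have "bij_betw f (?L \<times> ?R) {A. A \<subseteq> {1..n} \<and> card A = m \<and> swapped_at A j \<sigma> s}"
    unfolding bij_betw_def
  proof (intro conjI equalityI subsetI)
    show "inj_on f (?L \<times> ?R)"
    proof (rule inj_onI, clarsimp simp: f_def)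
      fix B C B' C'
      assume "B \<subseteq> {Suc 0..<s}" "C \<subseteq> {Suc (Suc s)..n}" "B' \<subseteq> {Suc 0..<s}" "C' \<subseteq> {Suc (Suc s)..n}"
        and "insert (\<sigma> s) (insert (\<sigma> (Suc s)) (\<sigma> ` (B \<union> C))) = insert (\<sigma> s) (insert (\<sigma> (Suc s)) (\<sigma> ` (B' \<union> C')))"
      moreover then have "\<sigma> ` insert s (insert (Suc s) (B \<union> C)) = \<sigma> ` insert s (insert (Suc s) (B' \<union> C'))" by simp
      then have "insert s (insert (Suc s) (B \<union> C)) = insert s (insert (Suc s) (B' \<union> C'))"
        using inj by (simp only: inj_image_eq_iff)
      then have eq: "x = s \<or> x = Suc s \<or> x \<in> B \<or> x \<in> C \<longleftrightarrow> x = s \<or> x = Suc s \<or> x \<in> B' \<or> x \<in> C'" for x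
        by (auto simp: set_eq_iff)
      show "B = B' \<and> C = C'"
      proof (intro conjI set_eqI)
        fix x
        show "x \<in> B \<longleftrightarrow> x \<in> B'" using eq[of x] calculation by force
        show "x \<in> C \<longleftrightarrow> x \<in> C'" using eq[of x] calculation by force
      qed
    qed
  next
    fix A assume "A \<in> f ` (?L \<times> ?R)"
    then obtain B C where BC: "B \<subseteq> {1..<s}" "card B = j - 1" "C \<subseteq> {s + 2..n}" "card C = m - j - 1"
      and A: "A = \<sigma> ` (B \<union> {s, Suc s} \<union> C)" by (auto simp: f_def)
    have fin: "finite B" "finite C" using BC finite_subset by blast+
    have "{1..<s} \<subseteq> {1..n}" "{s, Suc s} \<subseteq> {1..n}" "{s + 2..n} \<subseteq> {1..n}" using s by auto
    then have sub: "B \<union> {s, Suc s} \<union> C \<subseteq> {1..n}" using BC(1,3) by blast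
    have disj: "(B \<union> {s, Suc s}) \<inter> C = {}" "B \<inter> {s, Suc s} = {}"
      by (auto dest!: subsetD[OF BC(1)] subsetD[OF BC(3)])
    have An: "A \<subseteq> {1..n}" unfolding A using image_mono[OF sub, of \<sigma>] img by simp
    have cardA: "card A = m"
    proof -
      have "card A = card (B \<union> {s, Suc s} \<union> C)"
        unfolding A by (rule card_image[OF inj_on_subset[OF inj subset_UNIV]])
      also have "\<dots> = card (B \<union> {s, Suc s}) + card C"
        using fin disj by (intro card_Un_disjoint) simp_all
      also have "card (B \<union> {s, Suc s}) = card B + card {s, Suc s}"
        using fin disj by (intro card_Un_disjoint) simp_all
      finally show ?thesis using BC j by simp
    qed
    have "{i \<in> {1..s}. \<sigma> i \<in> A} = insert s B"
    proof -
      have "i \<in> {1..s} \<and> i \<in> B \<union> {s, Suc s} \<union> C \<longleftrightarrow> i \<in> insert s B" for i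
        using subsetD[OF BC(1), of i] subsetD[OF BC(3), of i] s by auto
      then show ?thesis unfolding A mem by blast
    qed
    moreover have "s \<notin> B" using disj(2) by blast
    ultimately have cardj: "card {i \<in> {1..s}. \<sigma> i \<in> A} = j"
      using fin(1) BC(2) j by simp
    have "\<sigma> s \<in> A" "\<sigma> (Suc s) \<in> A" by (simp_all add: A)
    then show "A \<in> {A. A \<subseteq> {1..n} \<and> card A = m \<and> swapped_at A j \<sigma> s}"
      unfolding swapped_at_def mem_Collect_eq using An cardA cardj by blast
  next
    fix A assume "A \<in> {A. A \<subseteq> {1..n} \<and> card A = m \<and> swapped_at A j \<sigma> s}"
    then have A: "A \<subseteq> {1..n}" "card A = m" "\<sigma> s \<in> A" "\<sigma> (Suc s) \<in> A" "card {i \<in> {1..s}. \<sigma> i \<in> A} = j"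
      by (auto simp: swapped_at_def)
    define B where "B = {i \<in> {1..<s}. \<sigma> i \<in> A}"
    define C where "C = {i \<in> {s + 2..n}. \<sigma> i \<in> A}"
    have "i \<in> B \<union> {s, Suc s} \<union> C \<longleftrightarrow> i \<in> {1..n} \<and> \<sigma> i \<in> A" for i
      using s A(3,4) by (auto simp: B_def C_def)
    then have U: "B \<union> {s, Suc s} \<union> C = {i \<in> {1..n}. \<sigma> i \<in> A}" by blast
    have img': "\<sigma> ` {i \<in> {1..n}. \<sigma> i \<in> A} = A"
    proof (intro equalityI subsetI)
      fix a assume "a \<in> A"
      then have "a \<in> \<sigma> ` {1..n}" using A(1) img by auto
      then show "a \<in> \<sigma> ` {i \<in> {1..n}. \<sigma> i \<in> A}" using \<open>a \<in> A\<close> by auto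
    qed auto
    have fin: "finite B" "finite C" by (simp_all add: B_def C_def)
    have "{i \<in> {1..s}. \<sigma> i \<in> A} = insert s B" using s A(3) by (auto simp: B_def)
    then have "card B = j - 1" using A(5) fin by (simp add: B_def)
    moreover have "m = card B + 2 + card C"
    proof -
      have "m = card (\<sigma> ` (B \<union> {s, Suc s} \<union> C))" unfolding U img' using A(2) by simp
      also have "\<dots> = card (B \<union> {s, Suc s} \<union> C)"
        by (rule card_image[OF inj_on_subset[OF inj subset_UNIV]])
      also have "\<dots> = card (B \<union> {s, Suc s}) + card C"
        using fin by (intro card_Un_disjoint) (auto simp: B_def C_def)
      also have "card (B \<union> {s, Suc s}) = card B + card {s, Suc s}"
        using fin by (intro card_Un_disjoint) (auto simp: B_def)
      finally show ?thesis by simp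
    qed
    ultimately have "card C = m - j - 1" using j by linarith
    have "A = f (B, C)" unfolding f_def case_prod_conv U img' ..
    moreover have "(B, C) \<in> ?L \<times> ?R"
      using \<open>card B = j - 1\<close> \<open>card C = m - j - 1\<close> by (auto simp: B_def C_def)
    ultimately show "A \<in> f ` (?L \<times> ?R)" by (rule image_eqI)
  qed
  then have "card {A. A \<subseteq> {1..n} \<and> card A = m \<and> swapped_at A j \<sigma> s} = card (?L \<times> ?R)"
    by (rule bij_betw_same_card[symmetric])
  also have "\<dots> = (s - 1 choose (j - 1)) * (n - s - 1 choose (m - j - 1))"
    using s by (simp add: card_cartesian_product n_subsets Suc_diff_Suc)
  finally show ?thesis .
qed

text \<open>Exchange the sums: at a fixed time, count the subsets in which its swap survives at
  location \<open>j\<close>.\<close>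

lemma sum_swapped_at:
  assumes w: "\<omega> \<in> sorting_networks n" and j: "1 \<le> j" "j \<le> m - 1"
  shows "(\<Sum>A | A \<subseteq> {1..n} \<and> card A = m. real (card {t \<in> {1..length (subnetwork n \<omega> A)}. swap_loc (subnetwork n \<omega> A) t = j}))
    = (\<Sum>t<n choose 2. real (\<omega> ! t - 1 choose (j - 1)) * real (n - \<omega> ! t - 1 choose (m - j - 1)))"
proof -
  let ?S = "{A. A \<subseteq> {1..n} \<and> card A = m}"
  have fin: "finite ?S" by (rule finite_subset[of _ "Pow {1..n}"]) auto
  have len: "length \<omega> = n choose 2" and set: "set \<omega> \<subseteq> {1..n - 1}"
    using w by (simp_all add: sorting_networks_def)
  have "(\<Sum>A\<in>?S. real (card {t \<in> {1..length (subnetwork n \<omega> A)}. swap_loc (subnetwork n \<omega> A) t = j}))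
      = (\<Sum>A\<in>?S. \<Sum>t<n choose 2. of_bool (swapped_at A j (word_perm (take t \<omega>)) (\<omega> ! t)))"
  proof (rule sum.cong)
    fix A assume "A \<in> ?S"
    then have A: "A \<subseteq> {1..n}" by simp
    show "real (card {t \<in> {1..length (subnetwork n \<omega> A)}. swap_loc (subnetwork n \<omega> A) t = j})
        = (\<Sum>t<n choose 2. of_bool (swapped_at A j (word_perm (take t \<omega>)) (\<omega> ! t)))"
      unfolding subnetwork_eq_induced[OF w A] card_swap_loc count_list_induced len by simp
  qed simp
  also have "\<dots> = (\<Sum>t<n choose 2. \<Sum>A\<in>?S. of_bool (swapped_at A j (word_perm (take t \<omega>)) (\<omega> ! t)))"
    by (rule sum.swap)
  also have "\<dots> = (\<Sum>t<n choose 2. real (\<omega> ! t - 1 choose (j - 1)) * real (n - \<omega> ! t - 1 choose (m - j - 1)))"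
  proof (rule sum.cong)
    fix t assume t: "t \<in> {..<n choose 2}"
    have "set (take t \<omega>) \<subseteq> {1..n - 1}" using set set_take_subset by fast
    then have p: "word_perm (take t \<omega>) permutes {1..n}" by (rule word_perm_permutes)
    have s: "\<omega> ! t \<in> {1..n - 1}" using set t len nth_mem by (metis lessThan_iff subsetD)
    have "(\<Sum>A\<in>?S. of_bool (swapped_at A j (word_perm (take t \<omega>)) (\<omega> ! t)))
        = real (card (?S \<inter> {A. swapped_at A j (word_perm (take t \<omega>)) (\<omega> ! t)}))"
      using fin by simp
    also have "?S \<inter> {A. swapped_at A j (word_perm (take t \<omega>)) (\<omega> ! t)}
        = {A. A \<subseteq> {1..n} \<and> card A = m \<and> swapped_at A j (word_perm (take t \<omega>)) (\<omega> ! t)}" by auto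
    finally show "(\<Sum>A\<in>?S. of_bool (swapped_at A j (word_perm (take t \<omega>)) (\<omega> ! t)))
        = real (\<omega> ! t - 1 choose (j - 1)) * real (n - \<omega> ! t - 1 choose (m - j - 1))"
      using card_swapped_at[OF p s j] by simp
  qed simp
  finally show ?thesis .
qed

text \<open>The law of the swap location is the same at each of the \<open>n choose 2\<close> times,
  which cancels the denominator in that law.\<close>

lemma sum_sorting_networks:
  fixes g :: "nat \<Rightarrow> real"
  assumes "2 \<le> n"
  shows "(\<Sum>\<omega>\<in>sorting_networks n. \<Sum>t<n choose 2. g (\<omega> ! t))
    = real (card (sorting_networks n)) * (\<Sum>k\<in>{1..n - 1}. half_binom (k - 1) * half_binom (n - k - 1) * g k)"
proof -
  let ?S = "sorting_networks n" and ?N = "n choose 2"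
  have N: "0 < ?N" using assms by simp
  have group: "(\<Sum>\<omega>\<in>?S. g (\<omega> ! t)) = (\<Sum>k\<in>{1..n - 1}. real (card {\<omega> \<in> ?S. \<omega> ! t = k}) * g k)" if t: "t < ?N" for t
  proof -
    have "(\<lambda>\<omega>. \<omega> ! t) ` ?S \<subseteq> {1..n - 1}"
    proof safe
      fix \<omega> assume "\<omega> \<in> ?S"
      then have "set \<omega> \<subseteq> {1..n - 1}" "t < length \<omega>" using t by (auto simp: sorting_networks_def)
      then show "\<omega> ! t \<in> {1..n - 1}" using nth_mem by blast
    qed
    then have "(\<Sum>\<omega>\<in>?S. g (\<omega> ! t)) = (\<Sum>k\<in>{1..n - 1}. \<Sum>\<omega> | \<omega> \<in> ?S \<and> \<omega> ! t = k. g (\<omega> ! t))"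
      using finite_sorting_networks by (intro sum.group[symmetric]) auto
    also have "\<dots> = (\<Sum>k\<in>{1..n - 1}. \<Sum>\<omega> | \<omega> \<in> ?S \<and> \<omega> ! t = k. g k)"
      by (intro sum.cong) auto
    finally show ?thesis by simp
  qed
  have card: "real (card {\<omega> \<in> ?S. \<omega> ! t = k})
      = real (card ?S) * half_binom (k - 1) * half_binom (n - k - 1) / real ?N"
    if "t < ?N" "k \<in> {1..n - 1}" for t k
  proof -
    have "1 \<le> k" "k < n" using that assms by auto
    then show ?thesis
      using card_sorting_networks_nth[of k n t] that(1) N by (simp add: field_simps)
  qed
  have "(\<Sum>\<omega>\<in>?S. g (\<omega> ! t))
      = (\<Sum>k\<in>{1..n - 1}. real (card ?S) * half_binom (k - 1) * half_binom (n - k - 1) / real ?N * g k)"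
    if "t < ?N" for t
    unfolding group[OF that] using card[OF that] by (intro sum.cong) (simp_all only:)
  then have "(\<Sum>t<?N. \<Sum>\<omega>\<in>?S. g (\<omega> ! t))
      = (\<Sum>t<?N. \<Sum>k\<in>{1..n - 1}. real (card ?S) * half_binom (k - 1) * half_binom (n - k - 1) / real ?N * g k)"
    by (intro sum.cong) auto
  also have "\<dots> = real (card ?S) * (\<Sum>k\<in>{1..n - 1}. half_binom (k - 1) * half_binom (n - k - 1) * g k)"
    using N by (simp add: sum_distrib_left sum_divide_distrib mult_ac)
  finally show ?thesis by (subst sum.swap)
qed

theorem theorem1:
  fixes m n j :: nat
  assumes "1 \<le> m" and "m \<le> n" and "1 \<le> j" and "j \<le> m - 1"
  shows "measure_pmf.expectation (random_subnetwork n m)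
           (\<lambda>\<omega>. real (card {t \<in> {1..length \<omega>}. swap_loc \<omega> t = j})) =
         falling_fact (real j - 1/2) (j - 1) * falling_fact (real m - real j - 1/2) (m - j - 1)
           / (fact (j - 1) * fact (m - j - 1))"
proof -
  let ?S = "sorting_networks n" and ?T = "{A. A \<subseteq> {1..n} \<and> card A = m}"
  let ?c = "\<lambda>\<eta>. real (card {t \<in> {1..length \<eta>}. swap_loc \<eta> t = j})"
  have n: "2 \<le> n" using assms by linarith
  have finT: "finite ?T" by (rule finite_subset[of _ "Pow {1..n}"]) auto
  have cardT: "card ?T = n choose m" using n_subsets[of "{1..n}" m] by simp
  then have T: "?T \<noteq> {}" using assms(2) by (metis card.empty zero_less_binomial less_irrefl)
  have S: "?S \<noteq> {}" "finite ?S"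
    using card_sorting_networks_pos[of n] finite_sorting_networks by auto
  have "measure_pmf.expectation (random_subnetwork n m) ?c
      = measure_pmf.expectation (pmf_of_set (?S \<times> ?T)) (\<lambda>(\<omega>, A). ?c (subnetwork n \<omega> A))"
    using S T finT
    by (simp add: random_subnetwork_def uniform_network_def uniform_subset_def pair_pmf_of_set case_prod_unfold)
  also have "\<dots> = (\<Sum>(\<omega>, A)\<in>?S \<times> ?T. ?c (subnetwork n \<omega> A)) / real (card (?S \<times> ?T))"
    using S T finT by (intro integral_pmf_of_set) auto
  also have "(\<Sum>(\<omega>, A)\<in>?S \<times> ?T. ?c (subnetwork n \<omega> A)) = (\<Sum>\<omega>\<in>?S. \<Sum>A\<in>?T. ?c (subnetwork n \<omega> A))"
    by (rule sum.cartesian_product[symmetric])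
  also have "\<dots> = (\<Sum>\<omega>\<in>?S. \<Sum>t<n choose 2. real (\<omega> ! t - 1 choose (j - 1)) * real (n - \<omega> ! t - 1 choose (m - j - 1)))"
    using assms(3,4) by (intro sum.cong sum_swapped_at) auto
  also have "\<dots> = real (card ?S) * (\<Sum>k\<in>{1..n - 1}. half_binom (k - 1) * half_binom (n - k - 1)
      * (real (k - 1 choose (j - 1)) * real (n - k - 1 choose (m - j - 1))))"
    using n by (rule sum_sorting_networks)
  \<comment> \<open>Substituting \<open>k = r + 1\<close> makes this a convolution with
    \<open>L = n - 2\<close>.\<close>
  also have "(\<Sum>k\<in>{1..n - 1}. half_binom (k - 1) * half_binom (n - k - 1)
      * (real (k - 1 choose (j - 1)) * real (n - k - 1 choose (m - j - 1))))
    = (\<Sum>r\<le>n - 2. half_binom r * real (r choose (j - 1)) * (half_binom (n - 2 - r) * real ((n - 2 - r) choose (m - j - 1))))"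
    using n by (intro sum.reindex_bij_witness[of _ Suc "\<lambda>k. k - 1"]) (auto simp: numeral_2_eq_2)
  also have "\<dots> = half_binom (j - 1) * half_binom (m - j - 1) * real ((n - 2 + 2) choose (j - 1 + (m - j - 1) + 2))"
    using assms n by (intro sum_half_binom[where M = "n - m"]) auto
  \<comment> \<open>The lower index becomes \<open>m\<close>, so the binomial coefficient is the
    number of subsets and cancels; nothing else depends on \<open>n\<close>.\<close>
  also have "j - 1 + (m - j - 1) + 2 = m" using assms by linarith
  also have "n - 2 + 2 = n" using n by simp
  also have "real (card ?S) * (half_binom (j - 1) * half_binom (m - j - 1) * real (n choose m)) / real (card (?S \<times> ?T))
      = half_binom (j - 1) * half_binom (m - j - 1)"
    using card_sorting_networks_pos[of n] assms(2) unfolding card_cartesian_product cardT by simp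
  also have "\<dots> = falling_fact (real j - 1/2) (j - 1) * falling_fact (real m - real j - 1/2) (m - j - 1)
           / (fact (j - 1) * fact (m - j - 1))"
  proof -
    have "real (j - 1) + 1 / 2 = real j - 1/2" "real (m - j - 1) + 1 / 2 = real m - real j - 1/2"
      using assms by (simp_all add: of_nat_diff)
    then show ?thesis using falling_fact_half[of "j - 1"] falling_fact_half[of "m - j - 1"]
      by (simp flip: times_divide_times_eq)
  qed
  finally show ?thesis .
qed

end
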